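(* Let $\phi^0,\phi,\bar\phi$ be Lipschitz feedback functions. There exists a constant $L$ depending only on $T$ and the Lipschitz constants of $\phi^0,\phi,\bar\phi,f,f^0,g,g^0,q$ and $q^0$ such that for all $N>0$, $t\le T$, $x\in\mathcal{P}^N$, $i=1,\dots,M$ and $i^0=1,\dots,M^0$, $$|J^{0,N}_{\phi^0,\phi}(t,i^0,x)-J^0_{\phi^0,\phi}(t,i^0,x)|\le L/\sqrt N,$$ $$|J^N_{\phi^0,\phi,\bar\phi}(t,i,i^0,x)-J_{\phi^0,\phi,\bar\phi}(t,i,i^0,x)|\le L/\sqrt N.$$
   Context: Model data. Fix $T>0$, integers $M^0\ge1$, $M\ge2$, convex sets $A_0$ (controls of the major player) and $A$ (controls of the minor players) in normed vector spaces, and $\mathcal{P}=\{x\in\mathbb{R}^{M-1}: x_i\ge0,\ \sum_i x_i\le1\}$; write $x_M:=1-\sum_{i=1}^{M-1}x_i$. Given are rate functions $q(t,i,j,\alpha,i^0,x)$, $q^0(t,i^0,j^0,\alpha^0,x)$ and real-valued costs $f^0(t,i^0,\alpha^0,x)$, $g^0(i^0,x)$, $f(t,i,\alpha,i^0,x)$, $g(i,i^0,x)$, with $t\in[0,T]$, $i,j\in\{1,\dots,M\}$, $i^0,j^0\in\{1,\dots,M^0\}$, $\alpha\in A$, $\alpha^0\in A_0$, $x\in\mathcal{P}$ (standing assumption: $q$ and $f$ do not depend on the major player's control). Standing assumptions. (a) For all values of the other arguments, $[q(t,i,j,\alpha,i^0,x)]_{i,j}$ and $[q^0(t,i^0,j^0,\alpha^0,x)]_{i^0,j^0}$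 are Q-matrices (nonnegative off-diagonal entries, zero row sums). (b) $f,f^0,g,g^0,q,q^0$ are Lipschitz in $(t,x,\alpha^0,\alpha)$ (in those variables they depend on), uniformly in the discrete variables. (c) $|q|\le C$ for some constant $C$. (d) There is $\epsilon>0$ such that for all $t,\alpha,i^0$ and all $i\ne j$ in $\{1,\dots,M-1\}$: $x_i<\epsilon$ implies $q(t,i,j,\alpha,i^0,x)=0$, and $1-\sum_{k=1}^{M-1}x_k<\epsilon$ implies $q(t,M,i,\alpha,i^0,x)=0$. Feedback functions: $\phi^0:[0,T]\times\{1,\dots,M^0\}\times\mathcal{P}\to A_0$ and $\phi,\bar\phi:[0,T]\times\{1,\dots,M\}\times\{1,\dots,M^0\}\times\mathcal{P}\to A$; Lipschitz means Lipschitz in $(t,x)$ uniformly in the discrete variables. Put $q^0_{\phi^0}(t,i^0,j^0,x)=q^0(t,i^0,j^0,\phi^0(t,i^0,x),x)$, $q_\phi(t,i,j,i^0,x)=q(t,i,j,\phi(t,i,i^0,x),i^0,x)$, $f^0_{\phi^0}(t,i^0,x)=f^0(t,i^0,\phi^0(t,i^0,x),x)$, $f_\phi(t,i,i^0,x)=f(t,i,\phi(t,i,i^0,x),i^0,x)$. Mean field game. $(X^0_t,\mu_t)$ and $(X_t,X^0_t,\mu_t)$ are the time-inhomogeneous Markov processes, with values in $\{1,\dots,M^0\}\times\mathcal{P}$ and $\{1,\dots,M\}\times\{1,\dots,M^0\}\times\mathcal{P}$, with space-time generators $$[\mathcal{G}^0_{\phi^0,\phi}F](t,i^0,x)=\partial_tF+\sum_{j^0\ne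 i^0}[F(t,j^0,x)-F(t,i^0,x)]q^0_{\phi^0}(t,i^0,j^0,x)+\sum_{k,l=1}^{M-1}\partial_{x_l}F\,x_k\,q_\phi(t,k,l,i^0,x)+\Bigl(1-\sum_{k=1}^{M-1}x_k\Bigr)\sum_{l=1}^{M-1}\partial_{x_l}F\,q_\phi(t,M,l,i^0,x),$$ $$\begin{aligned}[\mathcal{G}_{\phi^0,\phi,\bar\phi}F](t,i,i^0,x)=\;&\partial_tF+\sum_{j^0\ne i^0}[F(t,i,j^0,x)-F(t,i,i^0,x)]q^0_{\phi^0}(t,i^0,j^0,x)+\sum_{j\ne i}[F(t,j,i^0,x)-F(t,i,i^0,x)]q_{\bar\phi}(t,i,j,i^0,x)\\&+\sum_{k,l=1}^{M-1}\partial_{x_l}F\,x_k\,q_\phi(t,k,l,i^0,x)+\Bigl(1-\sum_{k=1}^{M-1}x_k\Bigr)\sum_{l=1}^{M-1}\partial_{x_l}F\,q_\phi(t,M,l,i^0,x).\end{aligned}$$ $J^0_{\phi^0,\phi}(t,i^0,x)=\mathbb{E}[\int_t^Tf^0_{\phi^0}(s,X^0_s,\mu_s)ds+g^0(X^0_T,\mu_T)\mid X^0_t=i^0,\mu_t=x]$ and $J_{\phi^0,\phi,\bar\phi}(t,i,i^0,x)=\mathbb{E}[\int_t^Tf_{\bar\phi}(s,X_s,X^0_s,\mu_s)ds+g(X_T,X^0_T,\mu_T)\mid X_t=i,X^0_t=i^0,\mu_t=x]$. Finite game. $\mathcal{P}^N=\{\frac1N(n_1,\dots,n_{M-1}):n_i\in\mathbb{N},\sum_i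 n_i\le N\}$, $e_{ij}=e_j\mathbf 1_{j\ne M}-e_i\mathbf 1_{i\ne M}$ with $e_i$ the canonical basis of $\mathbb{R}^{M-1}$. When all $N$ minor players use $\phi$, $(X^{0,N}_t,\mu^N_t)$ (major state, empirical distribution of minor states) is the Markov chain on $\{1,\dots,M^0\}\times\mathcal{P}^N$ with jumps $i^0\to j^0$ at rate $q^0_{\phi^0}(t,i^0,j^0,x)$ and $x\to x+\frac1Ne_{ij}$ at rate $Nx_i\,q_\phi(t,i,j,i^0,x)$, $i\ne j$. When one minor player (state $X^N_t$) uses $\bar\phi$ and the other $N-1$ use $\phi$, $(X^N_t,X^{0,N}_t,\mu^N_t)$ is the Markov chain whose jumps from $(i,i^0,x)$ are: to $(i,j^0,x)$ at rate $q^0_{\phi^0}(t,i^0,j^0,x)$; to $(j,i^0,x+\frac1Ne_{ij})$ at rate $q_{\bar\phi}(t,i,j,i^0,x)$; to $(i,i^0,x+\frac1Ne_{kj})$ at rate $(Nx_k-\mathbf 1_{k=i})q_\phi(t,k,j,i^0,x)$; its states satisfy $x_i\ge1/N$ when the distinguished player is in state $i$, and the second inequality of the claim concerns such $(i,x)$. The expected costs are $J^{0,N}_{\phi^0,\phi}(t,i^0,x)=\mathbb{E}[\int_t^Tf^0_{\phi^0}(s,X^{0,N}_s,\mu^N_s)ds+g^0(X^{0,N}_T,\mu^N_T)\mid X^{0,N}_t=i^0,\mu^N_t=x]$ and $J^N_{\phi^0,\phi,\bar\phi}(t,i,i^0,x)=\mathbb{E}[\int_t^Tf_{\bar\phi}(s,X^N_s,X^{0,N}_s,\mu^N_s)ds+g(X^N_T,X^{0,N}_T,\mu^N_T)\mid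 X^N_t=i,X^{0,N}_t=i^0,\mu^N_t=x]$.
   Formalization: L may also depend on M, M^0 and a bound B on the variation across the discrete states of f^0_{φ^0}, f_{φ̄}, g^0, g (such B always exists); with only T and the Lipschitz constants the claim fails, e.g. for g^0 = B·1{i^0=1} with B large. Formally L may also vary with the control and sample spaces. *)

theory Defs
  imports "HOL-Probability.Probability"
begin

section \<open>State space of the empirical distribution\<close>

text \<open>
  The minor states \<open>1, \<dots>, M - 1\<close> are the elements \<open>Some l\<close> of \<open>'m option\<close> with \<open>l :: 'm\<close>,
  and the state \<open>M\<close> is \<open>None\<close>; thus \<open>CARD('m) = M - 1\<close>, and \<open>M \<ge> 2\<close> holds because types are
  nonempty. The major states \<open>1, \<dots>, M\<^sup>0\<close> are the elements of a finite type \<open>'k\<close>.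
\<close>

definition simplex_set :: "(real ^ 'm::finite) set" where
  "simplex_set = {x. (\<forall>l. 0 \<le> x $ l) \<and> (\<Sum>l\<in>UNIV. x $ l) \<le> 1}"

definition simplex_grid :: "nat \<Rightarrow> (real ^ 'm::finite) set" where
  "simplex_grid N =
     {x. \<exists>n :: 'm \<Rightarrow> nat. (\<forall>l. x $ l = real (n l) / real N) \<and> (\<Sum>l\<in>UNIV. n l) \<le> N}"

definition mass :: "real ^ 'm::finite \<Rightarrow> 'm option \<Rightarrow> real" where
  "mass x i = (case i of None \<Rightarrow> 1 - (\<Sum>l\<in>UNIV. x $ l) | Some l \<Rightarrow> x $ l)"

definition unit_vec :: "'m option \<Rightarrow> real ^ 'm::finite" where
  "unit_vec i = (case i of None \<Rightarrow> 0 | Some l \<Rightarrow> axis l 1)"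

definition jump_vec :: "'m option \<Rightarrow> 'm option \<Rightarrow> real ^ 'm::finite" where
  "jump_vec i j = unit_vec j - unit_vec i"


section \<open>Model data\<close>

definition Q_matrix :: "('i::finite \<Rightarrow> 'i \<Rightarrow> real) \<Rightarrow> bool" where
  "Q_matrix a \<longleftrightarrow> (\<forall>i j. i \<noteq> j \<longrightarrow> 0 \<le> a i j) \<and> (\<forall>i. (\<Sum>j\<in>UNIV. a i j) = 0)"

definition game_model ::
  "real \<Rightarrow> 'b::real_normed_vector set \<Rightarrow> 'a::real_normed_vector set
   \<Rightarrow> (real \<Rightarrow> 'm::finite option \<Rightarrow> 'm option \<Rightarrow> 'a \<Rightarrow> 'k::finite \<Rightarrow> real ^ 'm \<Rightarrow> real)
   \<Rightarrow> (real \<Rightarrow> 'k \<Rightarrow> 'k \<Rightarrow> 'b \<Rightarrow> real ^ 'm \<Rightarrow> real)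
   \<Rightarrow> (real \<Rightarrow> 'm option \<Rightarrow> 'a \<Rightarrow> 'k \<Rightarrow> real ^ 'm \<Rightarrow> real)
   \<Rightarrow> (real \<Rightarrow> 'k \<Rightarrow> 'b \<Rightarrow> real ^ 'm \<Rightarrow> real)
   \<Rightarrow> ('m option \<Rightarrow> 'k \<Rightarrow> real ^ 'm \<Rightarrow> real)
   \<Rightarrow> ('k \<Rightarrow> real ^ 'm \<Rightarrow> real)
   \<Rightarrow> real \<Rightarrow> real \<Rightarrow> real \<Rightarrow> real \<Rightarrow> real \<Rightarrow> real \<Rightarrow> bool"
where
  "game_model T A0 A q q0 f f0 g g0 Kq Kq0 Kf Kf0 Kg Kg0 \<longleftrightarrow>
     convex A0 \<and> convex A \<and>
     (\<forall>t\<in>{0..T}. \<forall>\<alpha>\<in>A. \<forall>i0. \<forall>x\<in>simplex_set. Q_matrix (\<lambda>i j. q t i j \<alpha> i0 x)) \<and>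
     (\<forall>t\<in>{0..T}. \<forall>\<alpha>0\<in>A0. \<forall>x\<in>simplex_set. Q_matrix (\<lambda>i0 j0. q0 t i0 j0 \<alpha>0 x)) \<and>
     (\<forall>i j i0. lipschitz_on Kq ({0..T} \<times> A \<times> simplex_set) (\<lambda>(t, \<alpha>, x). q t i j \<alpha> i0 x)) \<and>
     (\<forall>i0 j0. lipschitz_on Kq0 ({0..T} \<times> A0 \<times> simplex_set) (\<lambda>(t, \<alpha>0, x). q0 t i0 j0 \<alpha>0 x)) \<and>
     (\<forall>i i0. lipschitz_on Kf ({0..T} \<times> A \<times> simplex_set) (\<lambda>(t, \<alpha>, x). f t i \<alpha> i0 x)) \<and>
     (\<forall>i0. lipschitz_on Kf0 ({0..T} \<times> A0 \<times> simplex_set) (\<lambda>(t, \<alpha>0, x). f0 t i0 \<alpha>0 x)) \<and>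
     (\<forall>i i0. lipschitz_on Kg simplex_set (\<lambda>x. g i i0 x)) \<and>
     (\<forall>i0. lipschitz_on Kg0 simplex_set (\<lambda>x. g0 i0 x)) \<and>
     (\<exists>C. \<forall>t\<in>{0..T}. \<forall>\<alpha>\<in>A. \<forall>x\<in>simplex_set. \<forall>i j i0. \<bar>q t i j \<alpha> i0 x\<bar> \<le> C) \<and>
     (\<exists>\<epsilon>>0. \<forall>t\<in>{0..T}. \<forall>\<alpha>\<in>A. \<forall>i0. \<forall>x\<in>simplex_set.
        (\<forall>i j. i \<noteq> j \<longrightarrow> x $ i < \<epsilon> \<longrightarrow> q t (Some i) (Some j) \<alpha> i0 x = 0) \<and>
        (\<forall>i. 1 - (\<Sum>k\<in>UNIV. x $ k) < \<epsilon> \<longrightarrow> q t None (Some i) \<alpha> i0 x = 0))"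

definition lipschitz_feedback ::
  "real \<Rightarrow> 'a::real_normed_vector set \<Rightarrow> real \<Rightarrow> (real \<Rightarrow> real ^ 'm::finite \<Rightarrow> 'a) \<Rightarrow> bool"
where
  "lipschitz_feedback T A K \<psi> \<longleftrightarrow>
     (\<forall>t\<in>{0..T}. \<forall>x\<in>simplex_set. \<psi> t x \<in> A) \<and>
     lipschitz_on K ({0..T} \<times> simplex_set) (\<lambda>(t, x). \<psi> t x)"

definition q0_fb where "q0_fb q0 \<phi>0 t i0 j0 x = q0 t i0 j0 (\<phi>0 t i0 x) x"

definition q_fb where "q_fb q \<phi> t i j i0 x = q t i j (\<phi> t i i0 x) i0 x"

definition f0_fb where "f0_fb f0 \<phi>0 t i0 x = f0 t i0 (\<phi>0 t i0 x) x"

definition f_fb where "f_fb f \<phi> t i i0 x = f t i (\<phi> t i i0 x) i0 x"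


section \<open>Time-inhomogeneous Markov processes\<close>

definition borel_top :: "'s topology \<Rightarrow> 's measure" where
  "borel_top X = sigma (topspace X) {U. openin X U}"

definition path_past :: "'w measure \<Rightarrow> 's topology \<Rightarrow> (real \<Rightarrow> 'w \<Rightarrow> 's) \<Rightarrow> real \<Rightarrow> real \<Rightarrow> 'w measure"
where
  "path_past \<Omega> X Z t s =
     sigma (space \<Omega>) {Z r -` B \<inter> space \<Omega> | r B. r \<in> {t..s} \<and> B \<in> sets (borel_top X)}"

text \<open>
  A Markov process on \<open>[0, T]\<close> with state space \<open>topspace X\<close> and right-continuous paths with left
  limits is a family of laws \<open>P t z\<close>, one for each initial time \<open>t\<close> and initial state \<open>z\<close>, on a
  common measurable space \<open>\<Omega>\<close> that carries the paths \<open>Z\<close>. The law \<open>P t z\<close> is the conditional law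
  given \<open>Z t = z\<close>; it concerns the path on \<open>[t, T]\<close> only.
\<close>

definition markov_process ::
  "real \<Rightarrow> 's topology \<Rightarrow> 'w measure \<Rightarrow> (real \<Rightarrow> 's \<Rightarrow> 'w measure) \<Rightarrow> (real \<Rightarrow> 'w \<Rightarrow> 's) \<Rightarrow> bool"
where
  "markov_process T X \<Omega> P Z \<longleftrightarrow>
     (\<forall>s\<in>{0..T}. Z s \<in> measurable \<Omega> (borel_top X)) \<and>
     (\<forall>\<omega>\<in>space \<Omega>. \<forall>s\<in>{0..<T}. limitin X (\<lambda>r. Z r \<omega>) (Z s \<omega>) (at_right s)) \<and>
     (\<forall>\<omega>\<in>space \<Omega>. \<forall>s\<in>{0<..T}. \<exists>z. limitin X (\<lambda>r. Z r \<omega>) z (at_left s)) \<and>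
     (\<forall>t\<in>{0..T}. \<forall>z\<in>topspace X.
        prob_space (P t z) \<and> sets (P t z) = sets \<Omega> \<and> (AE \<omega> in P t z. Z t \<omega> = z)) \<and>
     (\<forall>s\<in>{0..T}. \<forall>u\<in>{s..T}. \<forall>B\<in>sets (borel_top X).
        (\<lambda>z. measure (P s z) (Z u -` B \<inter> space \<Omega>)) \<in> borel_measurable (borel_top X)) \<and>
     (\<forall>t\<in>{0..T}. \<forall>z\<in>topspace X. \<forall>s\<in>{t..T}. \<forall>u\<in>{s..T}. \<forall>B\<in>sets (borel_top X).
        AE \<omega> in P t z.
          real_cond_exp (P t z) (path_past \<Omega> X Z t s) (indicator (Z u -` B \<inter> space \<Omega>)) \<omega>
          = measure (P s (Z s \<omega>)) (Z u -` B \<inter> space \<Omega>))"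

text \<open>
  \<open>G\<close> is the infinitesimal generator of the space-time process \<open>(s, Z s)\<close> on the test functions
  in \<open>D\<close>; the limit is taken in the supremum norm, that is, uniformly in \<open>(s, z)\<close>.
\<close>

definition has_generator ::
  "real \<Rightarrow> 's topology \<Rightarrow> (real \<Rightarrow> 's \<Rightarrow> 'w measure) \<Rightarrow> (real \<Rightarrow> 'w \<Rightarrow> 's)
   \<Rightarrow> (real \<Rightarrow> 's \<Rightarrow> real) set \<Rightarrow> ((real \<Rightarrow> 's \<Rightarrow> real) \<Rightarrow> real \<Rightarrow> 's \<Rightarrow> real) \<Rightarrow> bool"
where
  "has_generator T X P Z D G \<longleftrightarrow>
     (\<forall>F\<in>D. \<forall>\<epsilon>>0. \<exists>\<delta>>0. \<forall>s h. \<forall>z\<in>topspace X.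
        0 \<le> s \<and> 0 < h \<and> h < \<delta> \<and> s + h \<le> T \<longrightarrow>
        \<bar>((\<integral>\<omega>. F (s + h) (Z (s + h) \<omega>) \<partial>P s z) - F s z) / h - G F s z\<bar> < \<epsilon>)"

text \<open>
  \<open>r s z z'\<close> is the rate at time \<open>s\<close> of the jumps from \<open>z\<close> to \<open>z' \<noteq> z\<close>: the probability of
  \<open>Z (s + h) = z'\<close> given \<open>Z s = z\<close> is \<open>r s z z' * h + o(h)\<close>, uniformly in \<open>s\<close>. Without the
  uniformity, jumps at deterministic times would not be excluded.
\<close>

definition has_jump_rates ::
  "real \<Rightarrow> 's set \<Rightarrow> 'w measure \<Rightarrow> (real \<Rightarrow> 's \<Rightarrow> 'w measure) \<Rightarrow> (real \<Rightarrow> 'w \<Rightarrow> 's)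
   \<Rightarrow> (real \<Rightarrow> 's \<Rightarrow> 's \<Rightarrow> real) \<Rightarrow> bool"
where
  "has_jump_rates T E \<Omega> P Z r \<longleftrightarrow>
     (\<forall>z\<in>E. \<forall>z'\<in>E. z \<noteq> z' \<longrightarrow> (\<forall>\<epsilon>>0. \<exists>\<delta>>0. \<forall>s h.
        0 \<le> s \<and> 0 < h \<and> h < \<delta> \<and> s + h \<le> T \<longrightarrow>
        \<bar>measure (P s z) {\<omega> \<in> space \<Omega>. Z (s + h) \<omega> = z'} / h - r s z z'\<bar> < \<epsilon>))"

definition markov_chain ::
  "real \<Rightarrow> 's set \<Rightarrow> (real \<Rightarrow> 's \<Rightarrow> 's \<Rightarrow> real)
   \<Rightarrow> 'w measure \<Rightarrow> (real \<Rightarrow> 's \<Rightarrow> 'w measure) \<Rightarrow> (real \<Rightarrow> 'w \<Rightarrow> 's) \<Rightarrow> bool"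
where
  "markov_chain T E r \<Omega> P Z \<longleftrightarrow>
     markov_process T (discrete_topology E) \<Omega> P Z \<and> has_jump_rates T E \<Omega> P Z r"

definition expected_cost ::
  "real \<Rightarrow> (real \<Rightarrow> 's \<Rightarrow> 'w measure) \<Rightarrow> (real \<Rightarrow> 'w \<Rightarrow> 's)
   \<Rightarrow> (real \<Rightarrow> 's \<Rightarrow> real) \<Rightarrow> ('s \<Rightarrow> real) \<Rightarrow> real \<Rightarrow> 's \<Rightarrow> real"
where
  "expected_cost T P Z c d t z =
     (\<integral>\<omega>. (LINT s:{t..T}|lborel. c s (Z s \<omega>)) + d (Z T \<omega>) \<partial>P t z)"


section \<open>The mean field game\<close>

definition C1_fun :: "(real \<Rightarrow> real ^ 'm::finite \<Rightarrow> real) \<Rightarrow> bool" where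
  "C1_fun F \<longleftrightarrow>
     (\<exists>F' :: real \<times> (real ^ 'm) \<Rightarrow> (real \<times> (real ^ 'm)) \<Rightarrow>\<^sub>L real.
        continuous_on UNIV F' \<and>
        (\<forall>p. ((\<lambda>(t, x). F t x) has_derivative blinfun_apply (F' p)) (at p)))"

definition partial_x :: "'m::finite \<Rightarrow> (real ^ 'm \<Rightarrow> real) \<Rightarrow> real ^ 'm \<Rightarrow> real" where
  "partial_x l h x = deriv (\<lambda>r. h (x + r *\<^sub>R axis l 1)) 0"

definition mf_transport ::
  "(real \<Rightarrow> 'm::finite option \<Rightarrow> 'm option \<Rightarrow> 'k \<Rightarrow> real ^ 'm \<Rightarrow> real)
   \<Rightarrow> (real ^ 'm \<Rightarrow> real) \<Rightarrow> real \<Rightarrow> 'k \<Rightarrow> real ^ 'm \<Rightarrow> real"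
where
  "mf_transport q\<phi> h t i0 x =
     (\<Sum>k\<in>UNIV. \<Sum>l\<in>UNIV. partial_x l h x * (x $ k) * q\<phi> t (Some k) (Some l) i0 x)
     + (1 - (\<Sum>k\<in>UNIV. x $ k)) * (\<Sum>l\<in>UNIV. partial_x l h x * q\<phi> t None (Some l) i0 x)"

definition mf_major_generator ::
  "(real \<Rightarrow> 'k::finite \<Rightarrow> 'k \<Rightarrow> real ^ 'm::finite \<Rightarrow> real)
   \<Rightarrow> (real \<Rightarrow> 'm option \<Rightarrow> 'm option \<Rightarrow> 'k \<Rightarrow> real ^ 'm \<Rightarrow> real)
   \<Rightarrow> (real \<Rightarrow> 'k \<times> (real ^ 'm) \<Rightarrow> real) \<Rightarrow> real \<Rightarrow> 'k \<times> (real ^ 'm) \<Rightarrow> real"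
where
  "mf_major_generator q0\<phi> q\<phi> F = (\<lambda>t (i0, x).
     deriv (\<lambda>r. F r (i0, x)) t
     + (\<Sum>j0\<in>UNIV - {i0}. (F t (j0, x) - F t (i0, x)) * q0\<phi> t i0 j0 x)
     + mf_transport q\<phi> (\<lambda>y. F t (i0, y)) t i0 x)"

definition mf_minor_generator ::
  "(real \<Rightarrow> 'k::finite \<Rightarrow> 'k \<Rightarrow> real ^ 'm::finite \<Rightarrow> real)
   \<Rightarrow> (real \<Rightarrow> 'm option \<Rightarrow> 'm option \<Rightarrow> 'k \<Rightarrow> real ^ 'm \<Rightarrow> real)
   \<Rightarrow> (real \<Rightarrow> 'm option \<Rightarrow> 'm option \<Rightarrow> 'k \<Rightarrow> real ^ 'm \<Rightarrow> real)
   \<Rightarrow> (real \<Rightarrow> 'm option \<times> 'k \<times> (real ^ 'm) \<Rightarrow> real)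
   \<Rightarrow> real \<Rightarrow> 'm option \<times> 'k \<times> (real ^ 'm) \<Rightarrow> real"
where
  "mf_minor_generator q0\<phi> q\<phi> q\<psi> F = (\<lambda>t (i, i0, x).
     deriv (\<lambda>r. F r (i, i0, x)) t
     + (\<Sum>j0\<in>UNIV - {i0}. (F t (i, j0, x) - F t (i, i0, x)) * q0\<phi> t i0 j0 x)
     + (\<Sum>j\<in>UNIV - {i}. (F t (j, i0, x) - F t (i, i0, x)) * q\<psi> t i j i0 x)
     + mf_transport q\<phi> (\<lambda>y. F t (i, i0, y)) t i0 x)"

definition mf_major_process where
  "mf_major_process T q0\<phi> q\<phi> \<Omega> P Z \<longleftrightarrow>
     (let X = prod_topology (discrete_topology UNIV) (top_of_set simplex_set) in
      markov_process T X \<Omega> P Z \<and>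
      has_generator T X P Z {F. \<forall>i0. C1_fun (\<lambda>t x. F t (i0, x))} (mf_major_generator q0\<phi> q\<phi>))"

definition mf_minor_process where
  "mf_minor_process T q0\<phi> q\<phi> q\<psi> \<Omega> P Z \<longleftrightarrow>
     (let X = prod_topology (discrete_topology UNIV)
                (prod_topology (discrete_topology UNIV) (top_of_set simplex_set)) in
      markov_process T X \<Omega> P Z \<and>
      has_generator T X P Z {F. \<forall>i i0. C1_fun (\<lambda>t x. F t (i, i0, x))}
        (mf_minor_generator q0\<phi> q\<phi> q\<psi>))"


section \<open>The game with finitely many minor players\<close>

text \<open>The rates below are only used for pairs of distinct states.\<close>

definition N_major_rate ::
  "nat \<Rightarrow> (real \<Rightarrow> 'k \<Rightarrow> 'k \<Rightarrow> real ^ 'm::finite \<Rightarrow> real)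
   \<Rightarrow> (real \<Rightarrow> 'm option \<Rightarrow> 'm option \<Rightarrow> 'k \<Rightarrow> real ^ 'm \<Rightarrow> real)
   \<Rightarrow> real \<Rightarrow> 'k \<times> (real ^ 'm) \<Rightarrow> 'k \<times> (real ^ 'm) \<Rightarrow> real"
where
  "N_major_rate N q0\<phi> q\<phi> = (\<lambda>t (i0, x) (j0, y).
     of_bool (y = x) * q0\<phi> t i0 j0 x
     + of_bool (j0 = i0) *
       (\<Sum>i\<in>UNIV. \<Sum>j\<in>UNIV - {i}.
          of_bool (y = x + (1 / real N) *\<^sub>R jump_vec i j) * (real N * mass x i * q\<phi> t i j i0 x)))"

definition N_minor_rate ::
  "nat \<Rightarrow> (real \<Rightarrow> 'k \<Rightarrow> 'k \<Rightarrow> real ^ 'm::finite \<Rightarrow> real)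
   \<Rightarrow> (real \<Rightarrow> 'm option \<Rightarrow> 'm option \<Rightarrow> 'k \<Rightarrow> real ^ 'm \<Rightarrow> real)
   \<Rightarrow> (real \<Rightarrow> 'm option \<Rightarrow> 'm option \<Rightarrow> 'k \<Rightarrow> real ^ 'm \<Rightarrow> real)
   \<Rightarrow> real \<Rightarrow> 'm option \<times> 'k \<times> (real ^ 'm) \<Rightarrow> 'm option \<times> 'k \<times> (real ^ 'm) \<Rightarrow> real"
where
  "N_minor_rate N q0\<phi> q\<phi> q\<psi> = (\<lambda>t (i, i0, x) (i', j0, y).
     of_bool (i' = i \<and> y = x) * q0\<phi> t i0 j0 x
     + of_bool (i' \<noteq> i \<and> j0 = i0 \<and> y = x + (1 / real N) *\<^sub>R jump_vec i i') * q\<psi> t i i' i0 x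
     + of_bool (i' = i \<and> j0 = i0) *
       (\<Sum>k\<in>UNIV. \<Sum>j\<in>UNIV - {k}.
          of_bool (y = x + (1 / real N) *\<^sub>R jump_vec k j) *
          ((real N * mass x k - of_bool (k = i)) * q\<phi> t k j i0 x)))"

definition N_major_process where
  "N_major_process T N q0\<phi> q\<phi> \<Omega> P Z \<longleftrightarrow>
     markov_chain T (UNIV \<times> simplex_grid N) (N_major_rate N q0\<phi> q\<phi>) \<Omega> P Z"

definition N_minor_process where
  "N_minor_process T N q0\<phi> q\<phi> q\<psi> \<Omega> P Z \<longleftrightarrow>
     markov_chain T {(i, i0, x). x \<in> simplex_grid N \<and> 1 / real N \<le> mass x i}
       (N_minor_rate N q0\<phi> q\<phi> q\<psi>) \<Omega> P Z"


section \<open>Expected costs\<close>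

definition major_cost where
  "major_cost T f0 g0 \<phi>0 P Z t i0 x =
     expected_cost T P Z (\<lambda>s (j0, y). f0_fb f0 \<phi>0 s j0 y) (\<lambda>(j0, y). g0 j0 y) t (i0, x)"

definition minor_cost where
  "minor_cost T f g \<psi> P Z t i i0 x =
     expected_cost T P Z (\<lambda>s (j, j0, y). f_fb f \<psi> s j j0 y) (\<lambda>(j, j0, y). g j j0 y) t (i, i0, x)"

end

theory Submission
  imports Defs
begin

text \<open>
  Both games are written as Markov processes of pairs \<open>(d, x)\<close>. The label \<open>d\<close> ranges over a finite
  type: it is the major state in the first inequality, and the pair of the states of the distinguished
  minor player and of the major player in the second. The position \<open>x\<close> is the distribution of the
  minor players, in the second inequality of the other \<open>N - 1\<close> players only. In both the finite game
  and its limit the label jumps without moving the position, at rates that are Lipschitz in the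
  position. The position jumps by \<open>(e\<^sub>j - e\<^sub>k) / N\<close> at rate \<open>N n\<^sub>k q k j\<close> in the finite game, where \<open>n\<close> is the
  vector of masses; in the limit it follows the corresponding ordinary differential equation
  \<open>x\<^sub>l' = (\<Sum>k. x\<^sub>k q k l)\<close>.

  The costs are compared by a coupling that keeps the two labels together as long as possible and moves
  the positions independently, given the labels. With \<open>\<kappa> = sqrt N\<close>, the distance of positions \<open>x\<close> of the finite
  game and \<open>y\<close> of the limit is measured by \<open>gap \<kappa> x y = \<kappa> |x - y|\<^sup>2 + (4 / \<kappa>) (\<Sum>l. x\<^sub>l) + 1 / \<kappa>\<close>. At the initial time it is
  at most \<open>6 / \<kappa>\<close>, and it dominates both \<open>1 / \<kappa>\<close> and \<open>|x - y|\<close>. Under the coupling it grows at most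
  exponentially. The labels separate at a rate proportional to \<open>|x - y|\<close>, and then the
  difference of the remaining costs is at most a constant because the oscillation of the costs is
  bounded. Until then the costs per unit of time differ by at most a multiple of \<open>|x - y|\<close>. So the costs
  differ by at most a multiple of the initial gap.

  The constant involves only the Lipschitz constants and the oscillation bound, although the rates may be
  much larger. Two facts make this possible. First, all rates into a state \<open>l \<noteq> M\<close> are at most the
  Lipschitz constant of \<open>q\<close>: they vanish where the mass of the state that is left is small, and every point of the simplex
  has distance at most 1 from such a point (\<open>q_into_minor_state_bound\<close>). Only the rates \<open>q l M\<close> and those of the major
  player are not controlled. Second, large rates \<open>q l M\<close> do no harm (\<open>gap_drift_bound\<close>): their contribution to
  the derivative of \<open>|x - y|\<^sup>2\<close> is \<open>- 2 q l M (x\<^sub>l - y\<^sub>l)\<^sup>2\<close> up to terms bounded by the Lipschitz constants, and the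
  quadratic variation that they cause is compensated by the decrease of \<open>(\<Sum>l. x\<^sub>l)\<close>, the mass outside of the
  state \<open>M\<close>. This is the purpose of the second summand of the gap. Taking the distribution of the other
  players as the position is essential here too, for a jump of the distinguished player then leaves it fixed.

  The processes are given by their behaviour in a short time only, so that the coupling is made in small
  time steps. The expected cost is the limit of the values \<open>dp_value\<close> of a backward recursion with step \<open>h\<close>
  (\<open>expected_cost_dp_limit\<close>, by the Chapman-Kolmogorov equation and right-continuity of the paths). One step of
  the recursion is estimated in \<open>one_step\<close>, which needs the coupled laws of one step through few moments of
  labels and positions: \<open>coupled_expectation_le\<close> is the coupling, and \<open>jump_rates_rate_of\<close> and
  \<open>generator_rate_of\<close> give the moments for the finite and the limit game. Summing over the steps gives
  \<open>dp_value_comparison\<close>, and its limit \<open>expected_cost_comparison\<close>. The lemma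
  \<open>labelled_game_comparison\<close> collects this for both inequalities.
\<close>

section \<open>Transition laws of a Markov process\<close>

lemma space_borel_top [simp]: "space (borel_top X) = topspace X"
  unfolding borel_top_def by (rule space_measure_of) (use openin_subset in blast)

lemma sets_borel_top: "sets (borel_top X) = sigma_sets (topspace X) {U. openin X U}"
  unfolding borel_top_def by (rule sets_measure_of) (use openin_subset in blast)

lemma borel_top_measurable_euclidean:
  assumes "continuous_map X euclidean f"
  shows "f \<in> borel_measurable (borel_top X)"
proof (rule borel_measurableI)
  fix S :: "'b set" assume "open S"
  then have "openin X {x \<in> topspace X. f x \<in> S}"
    using assms by (auto simp: continuous_map_def)
  moreover have "f -` S \<inter> space (borel_top X) = {x \<in> topspace X. f x \<in> S}" by auto
  ultimately show "f -` S \<inter> space (borel_top X) \<in> sets (borel_top X)"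
    by (auto simp: sets_borel_top)
qed

locale markov =
  fixes T :: real and X :: "'s topology" and \<Omega> :: "'w measure"
    and P :: "real \<Rightarrow> 's \<Rightarrow> 'w measure" and Z :: "real \<Rightarrow> 'w \<Rightarrow> 's"
  assumes process: "markov_process T X \<Omega> P Z"
begin

text \<open>
  The law of the state at time \<open>u\<close> given the state \<open>z\<close> at time \<open>s\<close>. The two games live on different spaces of
  paths; it is these laws on the state spaces that are coupled.
\<close>
definition law :: "real \<Rightarrow> real \<Rightarrow> 's \<Rightarrow> 's measure" where
  "law s u z = distr (P s z) (borel_top X) (Z u)"

lemma space_law [simp]: "space (law s u z) = topspace X"
  and sets_law [simp, measurable_cong]: "sets (law s u z) = sets (borel_top X)"
  by (simp_all add: law_def)

context
  fixes s u :: real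
  assumes su: "0 \<le> s" "s \<le> u" "u \<le> T"
begin

lemma path_measurable: "Z u \<in> measurable \<Omega> (borel_top X)"
  using process su by (auto simp: markov_process_def)

lemma P_prob: "z \<in> topspace X \<Longrightarrow> prob_space (P s z)"
  and sets_P: "z \<in> topspace X \<Longrightarrow> sets (P s z) = sets \<Omega>"
  using process su by (auto simp: markov_process_def)

lemma space_P: "z \<in> topspace X \<Longrightarrow> space (P s z) = space \<Omega>"
  using sets_P sets_eq_imp_space_eq by blast

lemma path_measurable_P: "z \<in> topspace X \<Longrightarrow> Z u \<in> measurable (P s z) (borel_top X)"
  using path_measurable sets_P measurable_cong_sets by blast

lemma prob_space_law: "z \<in> topspace X \<Longrightarrow> prob_space (law s u z)"
  unfolding law_def by (intro prob_space.prob_space_distr P_prob path_measurable_P)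

lemma integral_law:
  fixes F :: "'s \<Rightarrow> real"
  assumes "z \<in> topspace X" "F \<in> borel_measurable (borel_top X)"
  shows "(\<integral>\<omega>. F (Z u \<omega>) \<partial>P s z) = (\<integral>z'. F z' \<partial>law s u z)"
  unfolding law_def using path_measurable_P[OF assms(1)] assms(2) by (simp add: integral_distr)

lemma measure_law:
  assumes "z \<in> topspace X" "B \<in> sets (borel_top X)"
  shows "measure (law s u z) B = measure (P s z) (Z u -` B \<inter> space \<Omega>)"
  unfolding law_def
  by (subst measure_distr[OF path_measurable_P[OF assms(1)] assms(2)])
     (simp add: space_P[OF assms(1)])

lemma law_kernel: "law s u \<in> measurable (borel_top X) (subprob_algebra (borel_top X))"
proof (rule measurable_subprob_algebra)
  fix z assume z: "z \<in> space (borel_top X)"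
  then show "subprob_space (law s u z)"
    using prob_space_law prob_space_imp_subprob_space by auto
  show "sets (law s u z) = sets (borel_top X)" by simp
next
  fix B assume B: "B \<in> sets (borel_top X)"
  have "(\<lambda>z. measure (P s z) (Z u -` B \<inter> space \<Omega>)) \<in> borel_measurable (borel_top X)"
    using process su B by (auto simp: markov_process_def)
  then have "(\<lambda>z. ennreal (measure (P s z) (Z u -` B \<inter> space \<Omega>))) \<in> borel_measurable (borel_top X)"
    by measurable
  moreover have "emeasure (law s u z) B = ennreal (measure (P s z) (Z u -` B \<inter> space \<Omega>))"
    if "z \<in> space (borel_top X)" for z
  proof -
    interpret prob_space "law s u z" using that prob_space_law by auto
    show ?thesis using measure_law[of z B] that B by (simp add: emeasure_eq_measure)
  qed
  ultimately show "(\<lambda>z. emeasure (law s u z) B) \<in> borel_measurable (borel_top X)"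
    using measurable_cong[where M="borel_top X" and f="\<lambda>z. emeasure (law s u z) B"
        and g="\<lambda>z. ennreal (measure (P s z) (Z u -` B \<inter> space \<Omega>))"] by blast
qed

end

text \<open>
  The Markov property is stated for conditional probabilities of single events. Their expectation gives the
  Chapman-Kolmogorov equation for sets, and the measurability of the transition probabilities turns it into
  an equation of kernels and then of integrals.
\<close>
lemma law_measure_chapman_kolmogorov:
  assumes ts: "0 \<le> t" "t \<le> s" "s \<le> u" "u \<le> T" and z: "z \<in> topspace X"
    and B: "B \<in> sets (borel_top X)"
  shows "measure (law t u z) B = (\<integral>z'. measure (law s u z') B \<partial>law t s z)"
proof -
  let ?M = "P t z" and ?F = "path_past \<Omega> X Z t s"
  let ?B = "Z u -` B \<inter> space \<Omega>"
  interpret prob_space ?M using P_prob[of t t z] ts z by auto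
  have spM: "space ?M = space \<Omega>" and seM: "sets ?M = sets \<Omega>"
    using space_P[of t t z] sets_P[of t t z] ts z by auto
  let ?G = "{Z r -` B \<inter> space \<Omega> | r B. r \<in> {t..s} \<and> B \<in> sets (borel_top X)}"
  have G: "?G \<subseteq> Pow (space \<Omega>)" by auto
  have spF: "space ?F = space \<Omega>" unfolding path_past_def by (rule space_measure_of[OF G])
  have seF: "sets ?F = sigma_sets (space \<Omega>) ?G" unfolding path_past_def by (rule sets_measure_of[OF G])
  have "Z r -` C \<inter> space \<Omega> \<in> sets \<Omega>" if "r \<in> {t..s}" "C \<in> sets (borel_top X)" for r C
    using path_measurable[of t r] ts that by (auto intro: measurable_sets)
  then have "?G \<subseteq> sets \<Omega>" by blast
  then have "sets ?F \<subseteq> sets ?M" unfolding seF seM by (rule sets.sigma_sets_subset)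
  then have sub: "subalgebra ?M ?F" by (simp add: subalgebra_def spM spF)
  interpret finite_measure_subalgebra ?M ?F by unfold_locales (rule sub)
  interpret sigma_finite_subalgebra ?M ?F
    by (rule finite_measure_subalgebra_is_sigma_finite) unfold_locales
  have Bm: "?B \<in> sets ?M"
    using path_measurable[of s u] ts B seM by (auto intro: measurable_sets)
  have i: "integrable ?M (indicator ?B :: _ \<Rightarrow> real)"
    by (rule integrable_const_bound[where B=1]) (use Bm in \<open>auto simp: indicator_def\<close>)
  have "measure (law t u z) B = measure ?M ?B"
    using measure_law[of t u z B] ts z B by auto
  also have "\<dots> = (\<integral>\<omega>. indicator ?B \<omega> \<partial>?M)" using Bm by (simp add: spM)
  also have "\<dots> = (\<integral>\<omega>. real_cond_exp ?M ?F (indicator ?B) \<omega> \<partial>?M)"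
    using real_cond_exp_int(2)[OF i] by simp
  also have "\<dots> = (\<integral>\<omega>. measure (law s u (Z s \<omega>)) B \<partial>?M)"
  proof (rule integral_cong_AE)
    have mk: "(\<lambda>z'. measure (law s u z') B) \<in> borel_measurable (borel_top X)"
      using measurable_compose[OF law_kernel[of s u] measurable_measure_subprob_algebra[OF B]] ts
      by simp
    show "(\<lambda>\<omega>. measure (law s u (Z s \<omega>)) B) \<in> borel_measurable ?M"
      using measurable_compose[OF path_measurable_P[of t s z] mk] ts z by simp
    have "AE \<omega> in ?M. real_cond_exp ?M ?F (indicator ?B) \<omega> = measure (P s (Z s \<omega>)) ?B"
      using process ts z B unfolding markov_process_def by auto
    moreover have "measure (P s (Z s \<omega>)) ?B = measure (law s u (Z s \<omega>)) B" if "\<omega> \<in> space ?M" for \<omega>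
    proof -
      have "Z s \<omega> \<in> topspace X"
        using path_measurable_P[of t s z] ts z that by (auto simp: measurable_def)
      then show ?thesis using measure_law[of s u "Z s \<omega>" B] ts B by simp
    qed
    ultimately show "AE \<omega> in ?M. real_cond_exp ?M ?F (indicator ?B) \<omega> = measure (law s u (Z s \<omega>)) B"
      using AE_space by fastforce
  qed (use borel_measurable_cond_exp2 in auto)
  also have "\<dots> = (\<integral>z'. measure (law s u z') B \<partial>law t s z)"
  proof (rule integral_law)
    show "(\<lambda>z'. measure (law s u z') B) \<in> borel_measurable (borel_top X)"
      using measurable_compose[OF law_kernel[of s u] measurable_measure_subprob_algebra[OF B]] ts
      by simp
  qed (use ts z in auto)
  finally show ?thesis .
qed

lemma law_bind:
  assumes ts: "0 \<le> t" "t \<le> s" "s \<le> u" "u \<le> T" and z: "z \<in> topspace X"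
  shows "law t u z = bind (law t s z) (law s u)"
proof (rule measure_eqI)
  have K: "law s u \<in> measurable (law t s z) (subprob_algebra (borel_top X))"
    using law_kernel[of s u] ts by (simp cong: measurable_cong_sets)
  have ne: "space (law t s z) \<noteq> {}" using z by auto
  show se: "sets (law t u z) = sets (bind (law t s z) (law s u))"
    using sets_bind[OF _ ne, of "law s u" "borel_top X"] by simp
  interpret p: prob_space "law t u z" using prob_space_law[of t u z] ts z by auto
  interpret q: prob_space "law t s z" using prob_space_law[of t s z] ts z by auto
  fix B assume "B \<in> sets (law t u z)"
  then have B: "B \<in> sets (borel_top X)" by simp
  have "emeasure (bind (law t s z) (law s u)) B = (\<integral>\<^sup>+z'. emeasure (law s u z') B \<partial>law t s z)"
    by (rule emeasure_bind[OF ne K B])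
  also have "\<dots> = (\<integral>\<^sup>+z'. ennreal (measure (law s u z') B) \<partial>law t s z)"
  proof (rule nn_integral_cong)
    fix z' assume "z' \<in> space (law t s z)"
    then interpret prob_space "law s u z'" using prob_space_law[of s u z'] ts by auto
    show "emeasure (law s u z') B = ennreal (measure (law s u z') B)"
      by (rule emeasure_eq_measure)
  qed
  also have "\<dots> = ennreal (\<integral>z'. measure (law s u z') B \<partial>law t s z)"
  proof (rule nn_integral_eq_integral)
    have mk: "(\<lambda>z'. measure (law s u z') B) \<in> borel_measurable (law t s z)"
      using measurable_compose[OF K measurable_measure_subprob_algebra[OF B]] .
    have le: "measure (law s u z') B \<le> 1" if "z' \<in> topspace X" for z'
      using prob_space.prob_le_1[OF prob_space_law[of s u z']] that ts by auto
    show "integrable (law t s z) (\<lambda>z'. measure (law s u z') B)"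
      by (rule q.integrable_const_bound[where B=1]) (use mk le in auto)
  qed auto
  also have "\<dots> = emeasure (law t u z) B"
    using law_measure_chapman_kolmogorov[OF ts z B] p.emeasure_eq_measure by simp
  finally show "emeasure (law t u z) B = emeasure (bind (law t s z) (law s u)) B" by simp
qed

lemma law_integrable:
  fixes F :: "'s \<Rightarrow> real"
  assumes "0 \<le> s" "s \<le> u" "u \<le> T" "z \<in> topspace X" "F \<in> borel_measurable (borel_top X)"
    and "\<And>z'. z' \<in> topspace X \<Longrightarrow> \<bar>F z'\<bar> \<le> C"
  shows "integrable (law s u z) F"
proof -
  interpret prob_space "law s u z" using prob_space_law assms by auto
  show ?thesis by (rule integrable_const_bound[where B=C]) (use assms in auto)
qed

lemma law_integral_measurable:
  fixes F :: "'s \<Rightarrow> real"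
  assumes "0 \<le> s" "s \<le> u" "u \<le> T" "F \<in> borel_measurable (borel_top X)"
  shows "(\<lambda>z. \<integral>z'. F z' \<partial>law s u z) \<in> borel_measurable (borel_top X)"
  using measurable_compose[OF law_kernel[OF assms(1-3)]
      integral_measurable_subprob_algebra[OF assms(4)]] by simp

lemma law_integral_bound:
  fixes F :: "'s \<Rightarrow> real"
  assumes "0 \<le> s" "s \<le> u" "u \<le> T" "z \<in> topspace X" "F \<in> borel_measurable (borel_top X)"
    and "\<And>z'. z' \<in> topspace X \<Longrightarrow> \<bar>F z' - a\<bar> \<le> C"
  shows "\<bar>(\<integral>z'. F z' \<partial>law s u z) - a\<bar> \<le> C"
proof -
  interpret prob_space "law s u z" using prob_space_law assms by auto
  have F: "\<bar>F z'\<bar> \<le> C + \<bar>a\<bar>" if "z' \<in> topspace X" for z' using assms(6)[OF that] by linarith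
  have i: "integrable (law s u z) F" by (rule law_integrable[OF assms(1-5) F])
  have "(\<integral>z'. F z' \<partial>law s u z) \<le> (\<integral>z'. a + C \<partial>law s u z)"
    by (rule integral_mono) (use i assms(6) in \<open>auto simp: abs_le_iff algebra_simps\<close>)
  moreover have "(\<integral>z'. a - C \<partial>law s u z) \<le> (\<integral>z'. F z' \<partial>law s u z)"
    by (rule integral_mono) (use i assms(6) in \<open>auto simp: abs_le_iff algebra_simps\<close>)
  ultimately show ?thesis using prob_space by (simp add: abs_le_iff)
qed

lemma chapman_kolmogorov:
  fixes F :: "'s \<Rightarrow> real"
  assumes ts: "0 \<le> t" "t \<le> s" "s \<le> u" "u \<le> T" and z: "z \<in> topspace X"
    and F: "F \<in> borel_measurable (borel_top X)" "\<And>z'. z' \<in> topspace X \<Longrightarrow> \<bar>F z'\<bar> \<le> C"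
  shows "(\<integral>z'. F z' \<partial>law t u z) = (\<integral>z'. (\<integral>z''. F z'' \<partial>law s u z') \<partial>law t s z)"
  unfolding law_bind[OF ts z]
proof (rule integral_bind[where B'=1 and B=C])
  interpret q: prob_space "law t s z" using prob_space_law[of t s z] ts z by auto
  show "law s u \<in> measurable (law t s z) (subprob_algebra (borel_top X))"
    using law_kernel[of s u] ts by (simp cong: measurable_cong_sets)
  show "finite_measure (law t s z)" by unfold_locales
  show "AE z' in law t s z. emeasure (law s u z') (space (law s u z')) \<le> ennreal 1"
    using prob_space.emeasure_space_1[OF prob_space_law[of s u]] ts by (intro AE_I2) auto
qed (use F z in auto)

end

context markov
begin

section \<open>Expected costs as limits of a backward recursion\<close>

text \<open>
  The values of a backward recursion with time step \<open>h\<close>, with \<open>m\<close> steps left until \<open>T\<close>. The running cost of a step is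
  evaluated at the end of the step because the paths are continuous from the right.
\<close>
primrec dp_value :: "(real \<Rightarrow> 's \<Rightarrow> real) \<Rightarrow> ('s \<Rightarrow> real) \<Rightarrow> real \<Rightarrow> nat \<Rightarrow> 's \<Rightarrow> real" where
  "dp_value c d h 0 = d"
| "dp_value c d h (Suc m) = (\<lambda>z. \<integral>z'. h * c (T - real m * h) z' + dp_value c d h m z'
     \<partial>law (T - real (Suc m) * h) (T - real m * h) z)"

lemma dp_value_measurable:
  assumes "0 \<le> h" "real m * h \<le> T"
    and "\<And>s. s \<in> {0..T} \<Longrightarrow> c s \<in> borel_measurable (borel_top X)"
    and "d \<in> borel_measurable (borel_top X)"
  shows "dp_value c d h m \<in> borel_measurable (borel_top X)"
  using assms(2)
proof (induction m)
  case 0 then show ?case using assms by simp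
next
  case (Suc m)
  have le: "real m * h \<le> T" "0 \<le> real m * h" using Suc.prems assms(1) by (auto simp: algebra_simps)
  have [measurable]: "c (T - real m * h) \<in> borel_measurable (borel_top X)" using le by (intro assms(3)) auto
  note [measurable] = Suc.IH[OF le(1)]
  have "(\<lambda>z'. h * c (T - real m * h) z' + dp_value c d h m z') \<in> borel_measurable (borel_top X)"
    by measurable
  then show ?case
    unfolding dp_value.simps
    by (intro law_integral_measurable) (use Suc.prems le assms(1) in \<open>auto simp: algebra_simps\<close>)
qed

text \<open>
  Only the oscillation of the costs around a reference \<open>c0\<close>, \<open>d0\<close> enters the bound. The reference may depend on time and
  cancels when two processes are compared, so that the final constant depends on the costs through their oscillation.
\<close>
lemma dp_value_bound:
  assumes "0 \<le> h" "real m * h \<le> T"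
    and c: "\<And>s. s \<in> {0..T} \<Longrightarrow> c s \<in> borel_measurable (borel_top X)"
    and d: "d \<in> borel_measurable (borel_top X)"
    and cb: "\<And>s z. s \<in> {0..T} \<Longrightarrow> z \<in> topspace X \<Longrightarrow> \<bar>c s z - c0 s\<bar> \<le> C"
    and db: "\<And>z. z \<in> topspace X \<Longrightarrow> \<bar>d z - d0\<bar> \<le> C"
    and z: "z \<in> topspace X"
  shows "\<bar>dp_value c d h m z - (d0 + (\<Sum>k<m. h * c0 (T - real k * h)))\<bar> \<le> C * (1 + real m * h)"
  using assms(2) z
proof (induction m arbitrary: z)
  case 0 then show ?case using db by simp
next
  case (Suc m)
  have le: "real m * h \<le> T" "0 \<le> real m * h" using Suc.prems assms(1) by (auto simp: algebra_simps)
  have [measurable]: "c (T - real m * h) \<in> borel_measurable (borel_top X)" using le by (intro c) auto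
  have [measurable]: "dp_value c d h m \<in> borel_measurable (borel_top X)"
    by (rule dp_value_measurable) (use assms le in auto)
  have "(\<lambda>z'. h * c (T - real m * h) z' + dp_value c d h m z') \<in> borel_measurable (borel_top X)"
    by measurable
  then show ?case
    unfolding dp_value.simps
  proof (intro law_integral_bound)
    fix z' assume z': "z' \<in> topspace X"
    have "\<bar>h * c (T - real m * h) z' - h * c0 (T - real m * h)\<bar> \<le> h * C"
      using cb[of "T - real m * h" z'] z' le assms(1)
      by (simp add: right_diff_distrib[symmetric] abs_mult mult_left_mono)
    then show "\<bar>h * c (T - real m * h) z' + dp_value c d h m z' -
          (d0 + (\<Sum>k<Suc m. h * c0 (T - real k * h)))\<bar> \<le> C * (1 + real (Suc m) * h)"
      using Suc.IH[OF le(1) z'] by (simp add: algebra_simps)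
  qed (use Suc.prems le assms(1) in \<open>auto simp: algebra_simps\<close>)
qed

text \<open>
  By the Chapman-Kolmogorov equation the recursion is the expectation of a Riemann sum of the running cost.
\<close>
lemma dp_value_unfold:
  assumes "0 \<le> h" "real m * h \<le> T"
    and c: "\<And>s. s \<in> {0..T} \<Longrightarrow> c s \<in> borel_measurable (borel_top X)"
    and d: "d \<in> borel_measurable (borel_top X)"
    and cb: "\<And>s z. s \<in> {0..T} \<Longrightarrow> z \<in> topspace X \<Longrightarrow> \<bar>c s z\<bar> \<le> C"
    and db: "\<And>z. z \<in> topspace X \<Longrightarrow> \<bar>d z\<bar> \<le> C"
    and z: "z \<in> topspace X" and m: "m \<noteq> 0"
  shows "dp_value c d h m z =
    (\<Sum>k<m. h * (\<integral>z'. c (T - real k * h) z' \<partial>law (T - real m * h) (T - real k * h) z))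
      + (\<integral>z'. d z' \<partial>law (T - real m * h) T z)"
  using assms(2) z m
proof (induction m arbitrary: z)
  case 0 then show ?case by simp
next
  case (Suc m)
  have le: "real m * h \<le> T" "0 \<le> real m * h" "real (Suc m) * h \<le> T" "0 \<le> real (Suc m) * h" "real m * h \<le> real (Suc m) * h"
    using Suc.prems assms(1) by (auto simp: algebra_simps)
  let ?s = "T - real (Suc m) * h" and ?u = "T - real m * h"
  have su: "0 \<le> ?s" "?s \<le> ?u" "?u \<le> T" using le by linarith+
  have [measurable]: "c ?u \<in> borel_measurable (borel_top X)" using le by (intro c) auto
  note [measurable] = d
  have [measurable]: "dp_value c d h m \<in> borel_measurable (borel_top X)"
    by (rule dp_value_measurable) (use assms le in auto)
  have dpb: "\<bar>dp_value c d h m z\<bar> \<le> C * (1 + real m * h)" if "z \<in> topspace X" for z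
    using dp_value_bound[where ?c0.0="\<lambda>_. 0" and ?d0.0=0, OF assms(1) le(1) c d _ _ that] cb db by simp
  have ci: "integrable (law ?s ?u z) (c ?u)"
    by (rule law_integrable[OF su Suc.prems(2), where C=C]) (use cb le in auto)
  have di: "integrable (law ?s ?u z) (dp_value c d h m)"
    by (rule law_integrable[OF su Suc.prems(2), where C="C * (1 + real m * h)"]) (use dpb in auto)
  have split: "dp_value c d h (Suc m) z =
      h * (\<integral>z'. c ?u z' \<partial>law ?s ?u z) + (\<integral>z'. dp_value c d h m z' \<partial>law ?s ?u z)"
    unfolding dp_value.simps using ci di by simp
  show ?case
  proof (cases "m = 0")
    case True then show ?thesis using split by simp
  next
    case False
    have uk: "?u \<le> T - real k * h" "0 \<le> T - real k * h" "T - real k * h \<le> T" if "k < m" for k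
    proof -
      have "real k * h \<le> real m * h" using that assms(1) by (intro mult_right_mono) auto
      then show "?u \<le> T - real k * h" "0 \<le> T - real k * h" "T - real k * h \<le> T" using le assms(1) by auto
    qed
    have cm: "c (T - real k * h) \<in> borel_measurable (borel_top X)" if "k < m" for k
      using uk[OF that] by (intro c) auto
    have cbk: "\<bar>c (T - real k * h) z\<bar> \<le> C" if "k < m" "z \<in> topspace X" for k z
      using uk[OF that(1)] that by (intro cb) auto
    have "(\<integral>z'. dp_value c d h m z' \<partial>law ?s ?u z) =
      (\<integral>z'. ((\<Sum>k<m. h * (\<integral>z''. c (T - real k * h) z'' \<partial>law ?u (T - real k * h) z'))
      + (\<integral>z''. d z'' \<partial>law ?u T z')) \<partial>law ?s ?u z)"
      by (rule Bochner_Integration.integral_cong[OF refl]) (use Suc.IH le False in auto)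
    also have "\<dots> = (\<Sum>k<m. h * (\<integral>z'. (\<integral>z''. c (T - real k * h) z'' \<partial>law ?u (T - real k * h) z') \<partial>law ?s ?u z))
       + (\<integral>z'. (\<integral>z''. d z'' \<partial>law ?u T z') \<partial>law ?s ?u z)"
    proof -
      have i1: "integrable (law ?s ?u z) (\<lambda>z'. \<integral>z''. c (T - real k * h) z'' \<partial>law ?u (T - real k * h) z')"
        if k: "k < m" for k
      proof (rule law_integrable[OF su Suc.prems(2), where C=C])
        show "(\<lambda>z'. \<integral>z''. c (T - real k * h) z'' \<partial>law ?u (T - real k * h) z') \<in> borel_measurable (borel_top X)"
          by (rule law_integral_measurable) (use su uk[OF k] cm[OF k] in auto)
        fix z' assume "z' \<in> topspace X"
        then show "\<bar>\<integral>z''. c (T - real k * h) z'' \<partial>law ?u (T - real k * h) z'\<bar> \<le> C"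
          using law_integral_bound[of ?u "T - real k * h" z' "c (T - real k * h)" 0 C] su uk[OF k] cm[OF k] cbk[OF k]
          by auto
      qed
      have i2: "integrable (law ?s ?u z) (\<lambda>z'. \<integral>z''. d z'' \<partial>law ?u T z')"
      proof (rule law_integrable[OF su Suc.prems(2), where C=C])
        show "(\<lambda>z'. \<integral>z''. d z'' \<partial>law ?u T z') \<in> borel_measurable (borel_top X)"
          by (rule law_integral_measurable) (use su in auto)
        fix z' assume "z' \<in> topspace X"
        then show "\<bar>\<integral>z''. d z'' \<partial>law ?u T z'\<bar> \<le> C"
          using law_integral_bound[of ?u T z' d 0 C] su db by auto
      qed
      show ?thesis using i1 i2
        by (subst Bochner_Integration.integral_add)
           (auto intro!: Bochner_Integration.integrable_sum simp: Bochner_Integration.integral_sum)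
    qed
    also have "\<dots> = (\<Sum>k<m. h * (\<integral>z'. c (T - real k * h) z' \<partial>law ?s (T - real k * h) z))
       + (\<integral>z'. d z' \<partial>law ?s T z)"
    proof -
      have "(\<integral>z'. (\<integral>z''. c (T - real k * h) z'' \<partial>law ?u (T - real k * h) z') \<partial>law ?s ?u z)
        = (\<integral>z'. c (T - real k * h) z' \<partial>law ?s (T - real k * h) z)" if k: "k < m" for k
        by (rule chapman_kolmogorov[symmetric, where C=C])
           (use su uk[OF k] cm[OF k] cbk[OF k] Suc.prems in auto)
      moreover have "(\<integral>z'. (\<integral>z''. d z'' \<partial>law ?u T z') \<partial>law ?s ?u z) = (\<integral>z'. d z' \<partial>law ?s T z)"
        by (rule chapman_kolmogorov[symmetric, where C=C]) (use su db Suc.prems in auto)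
      ultimately show ?thesis by simp
    qed
    finally show ?thesis using split by simp
  qed
qed

end

text \<open>
  The Riemann sums with right endpoints are the integrals of step functions that converge pointwise: the
  right endpoint of the interval of \<open>s\<close> tends to \<open>s\<close> from the right. Hence right-continuity and boundedness
  suffice, and the integrand is measurable as a limit of step functions.
\<close>
lemma right_continuous_grid_sum:
  fixes f :: "real \<Rightarrow> real"
  assumes tT: "t < T"
    and rc: "\<And>s. s \<in> {t..<T} \<Longrightarrow> (f \<longlongrightarrow> f s) (at_right s)"
    and fb: "\<And>s. s \<in> {t..T} \<Longrightarrow> \<bar>f s\<bar> \<le> C"
  shows "(\<lambda>n. \<Sum>k<Suc n. (T - t) / Suc n * f (T - k * ((T - t) / Suc n)))
    \<longlonglongrightarrow> (LINT s:{t..T}|lborel. f s)"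
proof -
  define h where "h n = (T - t) / Suc n" for n
  have h: "h n > 0" "real (Suc n) * h n = T - t" for n using tT by (auto simp: h_def)
  define S where "S n k = {T - real (Suc k) * h n <.. T - real k * h n}" for n k
  define F where "F n s = (\<Sum>k<Suc n. f (T - real k * h n) * indicator (S n k) s)" for n s
  have S_uniq: "j = k" if "s \<in> S n j" "s \<in> S n k" for n j k s
  proof -
    have *: "\<not> j < k" if "s \<in> S n j" "s \<in> S n k" for j k
    proof
      assume "j < k"
      then have "Suc j * h n \<le> real k * h n" using h(1)[of n] by (intro mult_right_mono) auto
      then show False using that by (auto simp: S_def)
    qed
    show ?thesis using *[OF that] *[OF that(2,1)] by linarith
  qed
  have Fk: "F n s = f (T - real k * h n)" if "k < Suc n" "s \<in> S n k" for n k s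
  proof -
    have "F n s = (\<Sum>j<Suc n. if j = k then f (T - real k * h n) else 0)"
      unfolding F_def by (rule sum.cong) (use that S_uniq in \<open>auto simp: indicator_def\<close>)
    then show ?thesis using that by simp
  qed
  have ex: "\<exists>k<Suc n. s \<in> S n k" if s: "s \<in> {t<..<T}" for n s
  proof -
    let ?k = "nat \<lfloor>(T - s) / h n\<rfloor>"
    have p: "0 \<le> (T - s) / h n" using s h(1)[of n] by auto
    have k1: "real ?k \<le> (T - s) / h n" "(T - s) / h n < real ?k + 1" using p by linarith+
    have "(T - s) / h n < Suc n" using s h[of n] by (simp add: divide_less_eq)
    then have "?k < Suc n" using k1 by linarith
    moreover have "s \<in> S n ?k" using k1 h(1)[of n] by (auto simp: S_def field_simps)
    ultimately show ?thesis by blast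
  qed
  have Flim: "(\<lambda>n. F n s) \<longlonglongrightarrow> f s" if s: "s \<in> {t<..<T}" for s
  proof (rule LIMSEQ_I)
    fix e :: real assume e: "0 < e"
    have "eventually (\<lambda>r. \<bar>f r - f s\<bar> < e) (at_right s)"
      using rc[of s] s e by (auto simp: tendsto_iff dist_real_def)
    then obtain b where b: "b > s" "\<And>r. s < r \<Longrightarrow> r < b \<Longrightarrow> \<bar>f r - f s\<bar> < e"
      by (auto simp: eventually_at_right_field)
    have "h \<longlonglongrightarrow> 0"
      unfolding h_def using LIMSEQ_Suc[OF lim_const_over_n[of "T - t"]] by simp
    then obtain n0 where n0: "\<And>n. n \<ge> n0 \<Longrightarrow> h n < b - s"
      using LIMSEQ_D[of h 0 "b - s"] b h(1) by (auto simp: abs_of_pos)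
    have "norm (F n s - f s) < e" if n: "n \<ge> n0" for n
    proof -
      obtain k where k: "k < Suc n" "s \<in> S n k" using ex[OF s] by blast
      have "s \<le> T - real k * h n" "T - real k * h n < b"
        using k(2) n0[OF n] by (auto simp: S_def algebra_simps)
      then show ?thesis using Fk[OF k] b(2)[of "T - real k * h n"] e by (cases "s = T - real k * h n") auto
    qed
    then show "\<exists>no. \<forall>n\<ge>no. norm (F n s - f s) < e" by blast
  qed
  have Fb: "\<bar>F n s\<bar> \<le> C" if s: "s \<in> {t<..<T}" for n s
  proof -
    obtain k where k: "k < Suc n" "s \<in> S n k" using ex[OF s] by blast
    have "real k * h n \<le> real (Suc n) * h n" using k h(1)[of n] by (intro mult_right_mono) auto
    moreover have "0 \<le> real k * h n" using h(1)[of n] by simp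
    ultimately have "T - real k * h n \<in> {t..T}"
      unfolding h(2) by simp
    then show ?thesis using Fk[OF k] fb by simp
  qed
  have Fint: "(LINT s|lborel. F n s * indicator {t<..<T} s) = (\<Sum>k<Suc n. h n * f (T - real k * h n))" for n
  proof -
    have sub: "real k * h n \<le> real (Suc n) * h n" "real (Suc k) * h n \<le> real (Suc n) * h n" "0 \<le> real k * h n"
      if "k < Suc n" for k
      using that h(1)[of n] by (auto intro!: mult_right_mono)
    have S_T: "S n k \<subseteq> {t<..T}" if k: "k < Suc n" for k
    proof
      fix s assume "s \<in> S n k"
      then have "T - real (Suc k) * h n < s" "s \<le> T - real k * h n" by (auto simp: S_def)
      then show "s \<in> {t<..T}" using sub[OF k] h(2)[of n] by auto
    qed
    have "F n s * indicator {t<..T} s = F n s" for s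
    proof -
      have "f (T - real k * h n) * indicator (S n k) s * indicator {t<..T} s
         = f (T - real k * h n) * indicator (S n k) s" if "k < Suc n" for k
        using S_T[OF that] by (auto simp: indicator_def)
      then show ?thesis unfolding F_def sum_distrib_right by (intro sum.cong) auto
    qed
    moreover have "AE s in lborel. s \<noteq> T" by (rule AE_lborel_singleton)
    then have "AE s in lborel. F n s * indicator {t<..<T} s = F n s * indicator {t<..T} s"
      by eventually_elim (auto simp: indicator_def)
    moreover have [measurable]: "F n \<in> borel_measurable lborel"
      unfolding F_def S_def by measurable
    ultimately have "(LINT s|lborel. F n s * indicator {t<..<T} s) = (LINT s|lborel. F n s)"
      by (subst integral_cong_AE[where g="F n"]) auto
    also have "\<dots> = (\<Sum>k<Suc n. LINT s|lborel. f (T - real k * h n) * indicator (S n k) s)"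
      unfolding F_def
    proof (rule Bochner_Integration.integral_sum)
      fix k assume "k \<in> {..<Suc n}"
      have "T - real (Suc k) * h n \<le> T - real k * h n" using h(1)[of n] by (auto simp: algebra_simps)
      then show "integrable lborel (\<lambda>s. f (T - real k * h n) * indicator (S n k) s)"
        by (intro integrable_mult_right integrable_real_indicator)
           (auto simp: S_def simp del: of_nat_Suc)
    qed
    also have "\<dots> = (\<Sum>k<Suc n. h n * f (T - real k * h n))"
    proof (rule sum.cong[OF refl])
      fix k
      have "T - real (Suc k) * h n \<le> T - real k * h n" using h(1)[of n] by (auto simp: algebra_simps)
      then show "(LINT s|lborel. f (T - real k * h n) * indicator (S n k) s) = h n * f (T - real k * h n)"
        by (simp add: S_def algebra_simps)
    qed
    finally show ?thesis .
  qed
  have fmeas: "(\<lambda>s. f s * indicator {t<..<T} s) \<in> borel_measurable lborel"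
  proof (rule borel_measurable_LIMSEQ_metric)
    show "(\<lambda>s. F n s * indicator {t<..<T} s) \<in> borel_measurable lborel" for n
      unfolding F_def S_def by measurable
    show "(\<lambda>n. F n s * indicator {t<..<T} s) \<longlonglongrightarrow> f s * indicator {t<..<T} s" for s
      using Flim[of s] by (cases "s \<in> {t<..<T}") auto
  qed
  have "(\<lambda>n. LINT s|lborel. F n s * indicator {t<..<T} s) \<longlonglongrightarrow> (LINT s|lborel. f s * indicator {t<..<T} s)"
  proof (rule integral_dominated_convergence[where w="\<lambda>s. C * indicator {t<..<T} s"])
    show "integrable lborel (\<lambda>s. C * indicator {t<..<T} s)"
      by (intro integrable_mult_right integrable_real_indicator) (use tT in auto)
    show "(\<lambda>s. F n s * indicator {t<..<T} s) \<in> borel_measurable lborel" for n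
      unfolding F_def S_def by measurable
    show "AE s in lborel. (\<lambda>n. F n s * indicator {t<..<T} s) \<longlonglongrightarrow> f s * indicator {t<..<T} s"
      using Flim by (intro AE_I2) (auto simp: indicator_def)
    show "AE s in lborel. norm (F n s * indicator {t<..<T} s) \<le> C * indicator {t<..<T} s" for n
      using Fb[of _ n] by (intro AE_I2) (auto simp: indicator_def)
  qed (rule fmeas)
  moreover have "(LINT s|lborel. f s * indicator {t<..<T} s) = (LINT s:{t..T}|lborel. f s)"
  proof -
    have ae: "AE s in lborel. f s * indicator {t<..<T} s = indicator {t..T} s *\<^sub>R f s"
      using AE_lborel_singleton[of t] AE_lborel_singleton[of T]
      by eventually_elim (auto simp: indicator_def)
    have "(\<lambda>s. indicator {t..T} s *\<^sub>R f s) = (\<lambda>s. f s * indicator {t<..<T} s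
       + f t * indicator {t} s + f T * indicator {T} s)"
      using tT by (auto simp: indicator_def fun_eq_iff)
    then have "(\<lambda>s. indicator {t..T} s *\<^sub>R f s) \<in> borel_measurable lborel"
      using fmeas by simp
    then show ?thesis unfolding set_lebesgue_integral_def
      by (intro integral_cong_AE fmeas ae)
  qed
  ultimately show ?thesis using Fint by (simp add: h_def)
qed

lemma (in markov) expected_cost_dp_limit:
  assumes tT: "0 \<le> t" "t \<le> T"
    and c: "\<And>s. s \<in> {0..T} \<Longrightarrow> c s \<in> borel_measurable (borel_top X)"
    and d: "d \<in> borel_measurable (borel_top X)"
    and cb: "\<And>s z. s \<in> {0..T} \<Longrightarrow> z \<in> topspace X \<Longrightarrow> \<bar>c s z\<bar> \<le> C"
    and db: "\<And>z. z \<in> topspace X \<Longrightarrow> \<bar>d z\<bar> \<le> C"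
    and rc: "\<And>\<omega> s. \<omega> \<in> space \<Omega> \<Longrightarrow> s \<in> {0..<T} \<Longrightarrow>
      ((\<lambda>r. c r (Z r \<omega>)) \<longlongrightarrow> c s (Z s \<omega>)) (at_right s)"
    and z: "z \<in> topspace X"
  shows "(\<lambda>n. dp_value c d ((T - t) / Suc n) (Suc n) z) \<longlonglongrightarrow> expected_cost T P Z c d t z"
proof -
  define h where "h n = (T - t) / Suc n" for n
  have h: "h n \<ge> 0" "real (Suc n) * h n = T - t" for n using tT by (auto simp: h_def)
  interpret p: prob_space "P t z" using P_prob[of t t z] tT z by auto
  have sp: "space (P t z) = space \<Omega>" using space_P[of t t z] tT z by auto
  have tk: "t \<le> T - real k * h n" "T - real k * h n \<le> T" if "k < Suc n" for k n
  proof -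
    have "real k * h n \<le> real (Suc n) * h n" using that h(1)[of n] by (intro mult_right_mono) auto
    then show "t \<le> T - real k * h n" "T - real k * h n \<le> T" using h[of n] by auto
  qed
  have Zin: "Z s \<omega> \<in> topspace X" if "s \<in> {0..T}" "\<omega> \<in> space \<Omega>" for s \<omega>
    using path_measurable[of s s] that by (auto simp: measurable_def)
  have cZb: "\<bar>c (T - real k * h n) (Z (T - real k * h n) \<omega>)\<bar> \<le> C"
    if "k < Suc n" "\<omega> \<in> space \<Omega>" for k n \<omega>
  proof -
    have "T - real k * h n \<in> {0..T}" using tk[OF that(1)] tT by auto
    then show ?thesis using cb Zin that(2) by blast
  qed
  define R where "R n \<omega> = (\<Sum>k<Suc n. h n * c (T - real k * h n) (Z (T - real k * h n) \<omega>)) + d (Z T \<omega>)" for n \<omega>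
  have cZ: "(\<lambda>\<omega>. c (T - real k * h n) (Z (T - real k * h n) \<omega>)) \<in> borel_measurable (P t z)" if "k < Suc n" for k n
    by (rule measurable_compose[OF path_measurable_P[of t "T - real k * h n"] c]) (use tk[OF that] tT z in auto)
  have dZ: "(\<lambda>\<omega>. d (Z T \<omega>)) \<in> borel_measurable (P t z)"
    by (rule measurable_compose[OF path_measurable_P[of t T] d]) (use tT z in auto)
  have cZi: "integrable (P t z) (\<lambda>\<omega>. c (T - real k * h n) (Z (T - real k * h n) \<omega>))" if "k < Suc n" for k n
    by (rule p.integrable_const_bound[where B=C])
       (use cZ[OF that] tk[OF that] tT cb Zin in \<open>auto simp: sp intro!: AE_I2\<close>)
  have dZi: "integrable (P t z) (\<lambda>\<omega>. d (Z T \<omega>))"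
    by (rule p.integrable_const_bound[where B=C])
       (use dZ tT db Zin in \<open>auto simp: sp intro!: AE_I2\<close>)
  have "(\<integral>\<omega>. R n \<omega> \<partial>P t z) = dp_value c d (h n) (Suc n) z" for n
  proof -
    have "(\<integral>\<omega>. R n \<omega> \<partial>P t z) = (\<Sum>k<Suc n. h n * (\<integral>\<omega>. c (T - real k * h n) (Z (T - real k * h n) \<omega>) \<partial>P t z))
       + (\<integral>\<omega>. d (Z T \<omega>) \<partial>P t z)"
      unfolding R_def using cZi dZi
      by (subst Bochner_Integration.integral_add)
         (auto intro!: Bochner_Integration.integrable_sum simp: Bochner_Integration.integral_sum
           simp del: sum.lessThan_Suc)
    also have "\<dots> = (\<Sum>k<Suc n. h n * (\<integral>z'. c (T - real k * h n) z' \<partial>law t (T - real k * h n) z))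
       + (\<integral>z'. d z' \<partial>law t T z)"
    proof -
      have "(\<integral>\<omega>. c (T - real k * h n) (Z (T - real k * h n) \<omega>) \<partial>P t z) = (\<integral>z'. c (T - real k * h n) z' \<partial>law t (T - real k * h n) z)"
        if "k < Suc n" for k
        by (rule integral_law) (use tk[OF that] tT z c in auto)
      moreover have "(\<integral>\<omega>. d (Z T \<omega>) \<partial>P t z) = (\<integral>z'. d z' \<partial>law t T z)"
        by (rule integral_law) (use tT z d in auto)
      ultimately show ?thesis by simp
    qed
    also have "\<dots> = dp_value c d (h n) (Suc n) z"
    proof -
      have t: "t = T - real (Suc n) * h n" using h(2)[of n] by linarith
      have "real (Suc n) * h n \<le> T" using h(2)[of n] tT by linarith
      have "dp_value c d (h n) (Suc n) z =
        (\<Sum>k<Suc n. h n * (\<integral>z'. c (T - real k * h n) z' \<partial>law (T - real (Suc n) * h n) (T - real k * h n) z))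
        + (\<integral>z'. d z' \<partial>law (T - real (Suc n) * h n) T z)"
        by (rule dp_value_unfold[where C=C]) (use h(1) \<open>real (Suc n) * h n \<le> T\<close> c d cb db z in auto)
      then show ?thesis unfolding t[symmetric] by (rule sym)
    qed
    finally show ?thesis .
  qed
  moreover have "(\<lambda>n. \<integral>\<omega>. R n \<omega> \<partial>P t z) \<longlonglongrightarrow>
     (\<integral>\<omega>. (LINT s:{t..T}|lborel. c s (Z s \<omega>)) + d (Z T \<omega>) \<partial>P t z)"
  proof -
    have Rm: "R n \<in> borel_measurable (P t z)" for n
      unfolding R_def by (intro borel_measurable_add borel_measurable_sum borel_measurable_times cZ dZ) auto
    have Rlim: "(\<lambda>n. R n \<omega>) \<longlonglongrightarrow> (LINT s:{t..T}|lborel. c s (Z s \<omega>)) + d (Z T \<omega>)"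
      if w: "\<omega> \<in> space \<Omega>" for \<omega>
    proof (cases "t < T")
      case True
      show ?thesis unfolding R_def h_def
        by (intro tendsto_add tendsto_const
              right_continuous_grid_sum[where f="\<lambda>s. c s (Z s \<omega>)" and C=C])
           (use True rc[OF w] cb Zin[OF _ w] tT in auto)
    next
      case False
      then have tTe: "t = T" using tT by simp
      have "AE s in lborel. indicator {T..T} s *\<^sub>R c s (Z s \<omega>) = (0::real)"
        using AE_lborel_singleton[of T] by eventually_elim auto
      then have "(LINT s:{t..T}|lborel. c s (Z s \<omega>)) = 0"
        unfolding set_lebesgue_integral_def tTe by (rule integral_eq_zero_AE)
      then show ?thesis unfolding R_def h_def tTe by simp
    qed
    have C0: "0 \<le> C" using db[OF z] by linarith
    show ?thesis
    proof (rule integral_dominated_convergence[where w="\<lambda>_. (T - t) * C + C"])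
      show "(\<lambda>\<omega>. (LINT s:{t..T}|lborel. c s (Z s \<omega>)) + d (Z T \<omega>)) \<in> borel_measurable (P t z)"
        by (rule borel_measurable_LIMSEQ_metric[OF Rm]) (use Rlim in \<open>auto simp: sp\<close>)
      show "AE \<omega> in P t z. norm (R n \<omega>) \<le> (T - t) * C + C" for n
      proof (rule AE_I2)
        fix \<omega> assume w: "\<omega> \<in> space (P t z)"
        have "\<bar>\<Sum>k<Suc n. h n * c (T - real k * h n) (Z (T - real k * h n) \<omega>)\<bar> \<le> (\<Sum>k<Suc n. h n * C)"
          by (rule order_trans[OF sum_abs sum_mono])
             (use cZb w h(1)[of n] in \<open>auto simp: abs_mult sp simp del: of_nat_Suc intro!: mult_left_mono\<close>)
        also have "\<dots> = real (Suc n) * h n * C" by (simp only: sum_constant card_lessThan mult.assoc)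
        also have "\<dots> = (T - t) * C" unfolding h(2) by (rule refl)
        finally show "norm (R n \<omega>) \<le> (T - t) * C + C"
          unfolding R_def using db[of "Z T \<omega>"] Zin[of T \<omega>] w tT sp by auto
      qed
    qed (use Rm Rlim in \<open>auto simp: sp\<close>)
  qed
  ultimately show ?thesis unfolding expected_cost_def h_def by simp
qed

section \<open>Coupling of two laws with finitely many labels\<close>

text \<open>
  The coupling of two laws. Let \<open>a j\<close> and \<open>b j\<close> be the probabilities of the label \<open>j\<close>. The labels are
  both equal to \<open>j\<close> with probability \<open>min (a j) (b j)\<close>, and given this the two points are independent, with
  their conditional laws. Inequality \<open>le\<close> applies to such pairs. The remaining probability is at most
  \<open>(\<Sum>j. \<bar>a j - b j\<bar>)\<close>, and there \<open>W1 - W2\<close> is at most \<open>2 * D\<close>. The bound by a sum \<open>v + A \<omega>1 + B \<omega>2\<close> of functions of one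
  point each makes the conditional expectations integrals of a single law, so that the coupled law
  itself never has to be constructed.
\<close>
lemma coupled_expectation_le:
  fixes W1 A :: "'p \<Rightarrow> real" and W2 B :: "'q \<Rightarrow> real"
    and L1 :: "'p \<Rightarrow> 'd::finite" and L2 :: "'q \<Rightarrow> 'd"
  assumes "prob_space M1" "prob_space M2"
    and L1: "\<And>j. {\<omega> \<in> space M1. L1 \<omega> = j} \<in> sets M1"
    and L2: "\<And>j. {\<omega> \<in> space M2. L2 \<omega> = j} \<in> sets M2"
    and W1: "integrable M1 W1" and A: "integrable M1 A"
    and W2: "integrable M2 W2" and B: "integrable M2 B"
    and W1b: "\<And>\<omega>. \<omega> \<in> space M1 \<Longrightarrow> \<bar>W1 \<omega> - \<alpha>\<bar> \<le> D"
    and W2b: "\<And>\<omega>. \<omega> \<in> space M2 \<Longrightarrow> \<bar>W2 \<omega> - \<alpha>\<bar> \<le> D"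
    and le: "\<And>\<omega>1 \<omega>2. \<omega>1 \<in> space M1 \<Longrightarrow> \<omega>2 \<in> space M2 \<Longrightarrow> L1 \<omega>1 = L2 \<omega>2 \<Longrightarrow>
      W1 \<omega>1 - W2 \<omega>2 \<le> v + A \<omega>1 + B \<omega>2"
    and v: "0 \<le> v"
  defines "a \<equiv> \<lambda>j. (\<integral>\<omega>. of_bool (L1 \<omega> = j) \<partial>M1)"
    and "b \<equiv> \<lambda>j. (\<integral>\<omega>. of_bool (L2 \<omega> = j) \<partial>M2)"
  shows "(\<integral>\<omega>. W1 \<omega> \<partial>M1) - (\<integral>\<omega>. W2 \<omega> \<partial>M2) \<le> v
    + (\<Sum>j\<in>UNIV. min (a j) (b j) / a j * (\<integral>\<omega>. of_bool (L1 \<omega> = j) * A \<omega> \<partial>M1)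
        + min (a j) (b j) / b j * (\<integral>\<omega>. of_bool (L2 \<omega> = j) * B \<omega> \<partial>M2))
    + 2 * D * (\<Sum>j\<in>UNIV. \<bar>a j - b j\<bar>)"
proof -
  interpret M1: prob_space M1 by fact
  interpret M2: prob_space M2 by fact
  have m1[measurable]: "(\<lambda>\<omega>. of_bool (L1 \<omega> = j) :: real) \<in> borel_measurable M1" for j
  proof -
    have [measurable]: "Measurable.pred M1 (\<lambda>\<omega>. L1 \<omega> = j)" using L1[of j] by (simp add: pred_def)
    show ?thesis unfolding of_bool_def by measurable
  qed
  have m2[measurable]: "(\<lambda>\<omega>. of_bool (L2 \<omega> = j) :: real) \<in> borel_measurable M2" for j
  proof -
    have [measurable]: "Measurable.pred M2 (\<lambda>\<omega>. L2 \<omega> = j)" using L2[of j] by (simp add: pred_def)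
    show ?thesis unfolding of_bool_def by measurable
  qed
  have i1: "integrable M1 (\<lambda>\<omega>. of_bool (L1 \<omega> = j) * F \<omega>)" if "integrable M1 F" for F :: "'p \<Rightarrow> real" and j
    by (rule Bochner_Integration.integrable_bound[OF that]) (use that in \<open>auto intro!: AE_I2\<close>)
  have i2: "integrable M2 (\<lambda>\<omega>. of_bool (L2 \<omega> = j) * F \<omega>)" if "integrable M2 F" for F :: "'q \<Rightarrow> real" and j
    by (rule Bochner_Integration.integrable_bound[OF that]) (use that in \<open>auto intro!: AE_I2\<close>)
  have o1: "integrable M1 (\<lambda>\<omega>. of_bool (L1 \<omega> = j) :: real)" for j
    using i1[of "\<lambda>_. 1" j] by simp
  have o2: "integrable M2 (\<lambda>\<omega>. of_bool (L2 \<omega> = j) :: real)" for j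
    using i2[of "\<lambda>_. 1" j] by simp
  \<comment> \<open>A common shift makes both functions nonnegative, so that unequal weights of a label can be
    compared by scaling the larger one down.\<close>
  define U1 where "U1 \<omega> = W1 \<omega> - \<alpha> + D" for \<omega>
  define U2 where "U2 \<omega> = W2 \<omega> - \<alpha> + D" for \<omega>
  have U1: "integrable M1 U1" and U2: "integrable M2 U2"
    unfolding U1_def U2_def using W1 W2 by auto
  have U1b: "0 \<le> U1 \<omega>" "U1 \<omega> \<le> 2 * D" if "\<omega> \<in> space M1" for \<omega>
    using W1b[OF that] by (auto simp: U1_def)
  have U2b: "0 \<le> U2 \<omega>" "U2 \<omega> \<le> 2 * D" if "\<omega> \<in> space M2" for \<omega>
    using W2b[OF that] by (auto simp: U2_def)
  have D: "0 \<le> D"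
  proof -
    obtain \<omega> where "\<omega> \<in> space M1" using M1.not_empty by blast
    then show ?thesis using W1b[of \<omega>] by linarith
  qed
  define a1 where "a1 j = (\<integral>\<omega>. of_bool (L1 \<omega> = j) * U1 \<omega> \<partial>M1)" for j
  define b1 where "b1 j = (\<integral>\<omega>. of_bool (L2 \<omega> = j) * U2 \<omega> \<partial>M2)" for j
  define IA where "IA j = (\<integral>\<omega>. of_bool (L1 \<omega> = j) * A \<omega> \<partial>M1)" for j
  define IB where "IB j = (\<integral>\<omega>. of_bool (L2 \<omega> = j) * B \<omega> \<partial>M2)" for j
  have a0: "0 \<le> a j" "0 \<le> b j" for j unfolding a_def b_def by (auto intro!: integral_nonneg)
  have a1b: "0 \<le> a1 j" "a1 j \<le> 2 * D * a j" for j
  proof -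
    show "0 \<le> a1 j" unfolding a1_def by (rule Bochner_Integration.integral_nonneg) (use U1b in auto)
    have "a1 j \<le> (\<integral>\<omega>. of_bool (L1 \<omega> = j) * (2 * D) \<partial>M1)"
      unfolding a1_def using U1b i1[OF U1] i1[of "\<lambda>_. 2 * D"]
      by (intro integral_mono) (auto intro!: mult_left_mono)
    then show "a1 j \<le> 2 * D * a j" using o1[of j] by (simp add: a_def mult.commute)
  qed
  have b1b: "0 \<le> b1 j" for j
    unfolding b1_def by (rule Bochner_Integration.integral_nonneg) (use U2b in auto)
  have sum1: "(\<Sum>j\<in>UNIV. (\<integral>\<omega>. of_bool (L1 \<omega> = j) * F \<omega> \<partial>M1)) = (\<integral>\<omega>. F \<omega> \<partial>M1)"
    if "integrable M1 F" for F :: "'p \<Rightarrow> real"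
  proof -
    have "(\<integral>\<omega>. F \<omega> \<partial>M1) = (\<integral>\<omega>. (\<Sum>j\<in>UNIV. of_bool (L1 \<omega> = j) * F \<omega>) \<partial>M1)"
      by (simp add: sum_distrib_right[symmetric])
    also have "\<dots> = (\<Sum>j\<in>UNIV. (\<integral>\<omega>. of_bool (L1 \<omega> = j) * F \<omega> \<partial>M1))"
      by (rule Bochner_Integration.integral_sum) (rule i1[OF that])
    finally show ?thesis by simp
  qed
  have sum2: "(\<Sum>j\<in>UNIV. (\<integral>\<omega>. of_bool (L2 \<omega> = j) * F \<omega> \<partial>M2)) = (\<integral>\<omega>. F \<omega> \<partial>M2)"
    if "integrable M2 F" for F :: "'q \<Rightarrow> real"
  proof -
    have "(\<integral>\<omega>. F \<omega> \<partial>M2) = (\<integral>\<omega>. (\<Sum>j\<in>UNIV. of_bool (L2 \<omega> = j) * F \<omega>) \<partial>M2)"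
      by (simp add: sum_distrib_right[symmetric])
    also have "\<dots> = (\<Sum>j\<in>UNIV. (\<integral>\<omega>. of_bool (L2 \<omega> = j) * F \<omega> \<partial>M2))"
      by (rule Bochner_Integration.integral_sum) (rule i2[OF that])
    finally show ?thesis by simp
  qed
  have asum: "(\<Sum>j\<in>UNIV. a j) = 1"
    using sum1[of "\<lambda>_. 1"] M1.prob_space by (simp add: a_def)
  \<comment> \<open>The inequality integrated over the product of the two laws, restricted to the label \<open>j\<close>.\<close>
  have star: "b j * a1 j - a j * b1 j \<le> a j * b j * v + b j * IA j + a j * IB j" for j
  proof -
    have inner: "b j * U1 \<omega>1 - b1 j \<le> b j * v + b j * A \<omega>1 + IB j"
      if w: "\<omega>1 \<in> space M1" "L1 \<omega>1 = j" for \<omega>1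
    proof -
      have "(\<integral>\<omega>. of_bool (L2 \<omega> = j) * (U1 \<omega>1 - U2 \<omega>) \<partial>M2)
        \<le> (\<integral>\<omega>. of_bool (L2 \<omega> = j) * (v + A \<omega>1 + B \<omega>) \<partial>M2)"
      proof (rule integral_mono)
        fix \<omega> assume "\<omega> \<in> space M2"
        then show "of_bool (L2 \<omega> = j) * (U1 \<omega>1 - U2 \<omega>) \<le> of_bool (L2 \<omega> = j) * (v + A \<omega>1 + B \<omega>)"
          using le[of \<omega>1 \<omega>] w by (auto simp: U1_def U2_def)
      qed (rule i2, use U2 B in auto)+
      also have "(\<integral>\<omega>. of_bool (L2 \<omega> = j) * (U1 \<omega>1 - U2 \<omega>) \<partial>M2) = b j * U1 \<omega>1 - b1 j"
        using o2[of j] i2[OF U2, of j] by (simp add: b_def b1_def right_diff_distrib)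
      also have "(\<integral>\<omega>. of_bool (L2 \<omega> = j) * (v + A \<omega>1 + B \<omega>) \<partial>M2) = b j * v + b j * A \<omega>1 + IB j"
        using o2[of j] i2[OF B, of j] by (simp add: b_def IB_def distrib_left)
      finally show ?thesis .
    qed
    have "(\<integral>\<omega>. of_bool (L1 \<omega> = j) * (b j * U1 \<omega> - b1 j) \<partial>M1)
      \<le> (\<integral>\<omega>. of_bool (L1 \<omega> = j) * (b j * v + b j * A \<omega> + IB j) \<partial>M1)"
    proof (rule integral_mono)
      fix \<omega> assume "\<omega> \<in> space M1"
      then show "of_bool (L1 \<omega> = j) * (b j * U1 \<omega> - b1 j) \<le> of_bool (L1 \<omega> = j) * (b j * v + b j * A \<omega> + IB j)"
        using inner[of \<omega>] by auto
    qed (rule i1, use U1 A in auto)+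
    also have "(\<integral>\<omega>. of_bool (L1 \<omega> = j) * (b j * U1 \<omega> - b1 j) \<partial>M1) = b j * a1 j - a j * b1 j"
    proof -
      have "(\<integral>\<omega>. of_bool (L1 \<omega> = j) * (b j * U1 \<omega> - b1 j) \<partial>M1)
        = (\<integral>\<omega>. b j * (of_bool (L1 \<omega> = j) * U1 \<omega>) - of_bool (L1 \<omega> = j) * b1 j \<partial>M1)"
        by (intro Bochner_Integration.integral_cong) (auto simp: algebra_simps)
      then show ?thesis using o1[of j] i1[OF U1, of j] by (simp add: a_def a1_def)
    qed
    also have "(\<integral>\<omega>. of_bool (L1 \<omega> = j) * (b j * v + b j * A \<omega> + IB j) \<partial>M1)
       = a j * b j * v + b j * IA j + a j * IB j"
    proof -
      have "(\<integral>\<omega>. of_bool (L1 \<omega> = j) * (b j * v + b j * A \<omega> + IB j) \<partial>M1)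
        = (\<integral>\<omega>. of_bool (L1 \<omega> = j) * (b j * v) + b j * (of_bool (L1 \<omega> = j) * A \<omega>) + of_bool (L1 \<omega> = j) * IB j \<partial>M1)"
        by (intro Bochner_Integration.integral_cong) (auto simp: algebra_simps)
      then show ?thesis using o1[of j] i1[OF A, of j] by (simp add: a_def IA_def)
    qed
    finally show ?thesis .
  qed
  have main: "a1 j - b1 j \<le> min (a j) (b j) * v + (min (a j) (b j) / a j * IA j + min (a j) (b j) / b j * IB j)
     + 2 * D * \<bar>a j - b j\<bar>" for j
  proof -
    consider "a j = 0" | "b j = 0" | "0 < b j" "b j \<le> a j" | "0 < a j" "a j \<le> b j"
      using a0[of j] by linarith
    then show ?thesis
    proof cases
      case 1
      then have "a1 j = 0" using a1b[of j] by simp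
      moreover have "0 \<le> 2 * D * \<bar>a j - b j\<bar>" using D by simp
      moreover have "min (a j) (b j) = 0" using 1 a0[of j] by simp
      ultimately show ?thesis using b1b[of j] by simp
    next
      case 2
      moreover have "min (a j) (b j) = 0" using 2 a0[of j] by simp
      ultimately show ?thesis using a1b[of j] b1b[of j] a0[of j] by simp
    next
      case 3
      have aj: "0 < a j" using 3 by linarith
      have "b j / a j * a1 j - b1 j = (b j * a1 j - a j * b1 j) / a j" using aj by (simp add: field_simps)
      also have "\<dots> \<le> (a j * b j * v + b j * IA j + a j * IB j) / a j"
        using star[of j] aj by (intro divide_right_mono) auto
      also have "\<dots> = b j * v + b j / a j * IA j + IB j" using aj by (simp add: field_simps)
      finally have 1: "b j / a j * a1 j - b1 j \<le> b j * v + b j / a j * IA j + IB j" .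
      have "a1 j - b j / a j * a1 j = (1 - b j / a j) * a1 j" by (simp add: algebra_simps)
      also have "\<dots> \<le> (1 - b j / a j) * (2 * D * a j)"
        using a1b[of j] 3 aj by (intro mult_left_mono) auto
      also have "\<dots> = 2 * D * (a j - b j)" using aj by (simp add: field_simps)
      finally show ?thesis using 1 3 by (simp add: min_def) (use 3 in \<open>auto split: if_splits\<close>)
    next
      case 4
      have bj: "0 < b j" using 4 by linarith
      have "a1 j - a j / b j * b1 j = (b j * a1 j - a j * b1 j) / b j" using bj by (simp add: field_simps)
      also have "\<dots> \<le> (a j * b j * v + b j * IA j + a j * IB j) / b j"
        using star[of j] bj by (intro divide_right_mono) auto
      also have "\<dots> = a j * v + IA j + a j / b j * IB j" using bj by (simp add: field_simps)
      finally have 1: "a1 j - a j / b j * b1 j \<le> a j * v + IA j + a j / b j * IB j" .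
      have "a j / b j * b1 j \<le> 1 * b1 j"
        using b1b[of j] 4 bj by (intro mult_right_mono) auto
      moreover have "0 \<le> 2 * D * \<bar>a j - b j\<bar>" using D by simp
      ultimately show ?thesis using 1 4 by (simp add: min_def)
    qed
  qed
  have "(\<integral>\<omega>. W1 \<omega> \<partial>M1) - (\<integral>\<omega>. W2 \<omega> \<partial>M2) = (\<integral>\<omega>. U1 \<omega> \<partial>M1) - (\<integral>\<omega>. U2 \<omega> \<partial>M2)"
    unfolding U1_def U2_def using W1 W2 M1.prob_space M2.prob_space by simp
  also have "\<dots> = (\<Sum>j\<in>UNIV. a1 j - b1 j)"
    unfolding sum_subtractf a1_def b1_def using sum1[OF U1] sum2[OF U2] by simp
  also have "\<dots> \<le> (\<Sum>j\<in>UNIV. min (a j) (b j) * v + (min (a j) (b j) / a j * IA j + min (a j) (b j) / b j * IB j)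
     + 2 * D * \<bar>a j - b j\<bar>)"
    by (rule sum_mono) (rule main)
  also have "\<dots> = (\<Sum>j\<in>UNIV. min (a j) (b j)) * v
      + (\<Sum>j\<in>UNIV. min (a j) (b j) / a j * IA j + min (a j) (b j) / b j * IB j)
      + 2 * D * (\<Sum>j\<in>UNIV. \<bar>a j - b j\<bar>)"
    by (simp only: sum.distrib sum_distrib_right sum_distrib_left)
  also have "(\<Sum>j\<in>UNIV. min (a j) (b j)) * v \<le> 1 * v"
    using sum_mono[of UNIV "\<lambda>j. min (a j) (b j)" a] asum v by (intro mult_right_mono) auto
  finally show ?thesis unfolding IA_def IB_def by simp
qed

section \<open>Processes with a label and a position\<close>

text \<open>
  The expectation of \<open>\<Gamma> z\<close> after a time \<open>h\<close>, started at \<open>z\<close>, is \<open>\<Gamma> z z + h * g s z + o(h)\<close>, uniformly in \<open>s\<close>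
  and \<open>z\<close>. The test function may depend on the starting point, as centred moments do.
\<close>
definition (in markov) rate_of :: "('s \<Rightarrow> 's \<Rightarrow> real) \<Rightarrow> (real \<Rightarrow> 's \<Rightarrow> real) \<Rightarrow> bool" where
  "rate_of \<Gamma> g \<longleftrightarrow> (\<forall>\<epsilon>>0. \<exists>\<delta>>0. \<forall>s h. \<forall>z\<in>topspace X.
     0 \<le> s \<longrightarrow> 0 < h \<longrightarrow> h < \<delta> \<longrightarrow> s + h \<le> T \<longrightarrow>
     \<bar>(\<integral>z'. \<Gamma> z z' \<partial>law s (s + h) z) - \<Gamma> z z - h * g s z\<bar> \<le> \<epsilon> * h)"

lemma (in markov) rate_of_family:
  fixes \<Gamma> :: "'i::finite \<Rightarrow> 's \<Rightarrow> 's \<Rightarrow> real"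
  assumes "\<And>i. rate_of (\<Gamma> i) (g i)" "0 < \<epsilon>"
  shows "\<exists>\<delta>>0. \<forall>i s h. \<forall>z\<in>topspace X. 0 \<le> s \<longrightarrow> 0 < h \<longrightarrow> h < \<delta> \<longrightarrow> s + h \<le> T \<longrightarrow>
      \<bar>(\<integral>z'. \<Gamma> i z z' \<partial>law s (s + h) z) - \<Gamma> i z z - h * g i s z\<bar> \<le> \<epsilon> * h"
proof -
  define Q where "Q i \<delta> \<longleftrightarrow> 0 < \<delta> \<and> (\<forall>s h. \<forall>z\<in>topspace X.
     0 \<le> s \<longrightarrow> 0 < h \<longrightarrow> h < \<delta> \<longrightarrow> s + h \<le> T \<longrightarrow>
     \<bar>(\<integral>z'. \<Gamma> i z z' \<partial>law s (s + h) z) - \<Gamma> i z z - h * g i s z\<bar> \<le> \<epsilon> * h)" for i \<delta>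
  have "\<exists>\<delta>. Q i \<delta>" for i
    using assms(1)[of i] assms(2) unfolding rate_of_def Q_def by blast
  then obtain d where d: "\<And>i. Q i (d i)" using choice[of Q] by blast
  have pos: "0 < Min (range d)" using d by (subst Min_gr_iff) (auto simp: Q_def)
  have le: "Min (range d) \<le> d i" for i by (rule Min_le) auto
  show ?thesis
  proof (intro exI[of _ "Min (range d)"] conjI pos allI ballI impI)
    fix i s h z assume "z \<in> topspace X" "0 \<le> s" "0 < h" "h < Min (range d)" "s + h \<le> T"
    moreover have "h < d i" using le[of i] \<open>h < Min (range d)\<close> by linarith
    ultimately show "\<bar>(\<integral>z'. \<Gamma> i z z' \<partial>law s (s + h) z) - \<Gamma> i z z - h * g i s z\<bar> \<le> \<epsilon> * h"
      using d[of i] unfolding Q_def by blast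
  qed
qed

text \<open>
  The short-time behaviour that the coupling needs: the label jumps at rates \<open>r\<close>; to first order the position
  moves only while the label stays, with drift \<open>b\<close> and quadratic variation \<open>\<tau>\<close>. Jump chains
  and flows (with \<open>\<tau> = 0\<close>) are both of this form. The bound on the
  coefficients determines how small the time steps have to be.
\<close>
locale labelled_markov = markov T X \<Omega> P Z
  for T :: real and X :: "'s topology" and \<Omega> :: "'w measure" and P Z +
  fixes lab :: "'s \<Rightarrow> 'd::finite" and pos :: "'s \<Rightarrow> real ^ 'm::finite"
    and r :: "real \<Rightarrow> 's \<Rightarrow> 'd \<Rightarrow> real" and b :: "real \<Rightarrow> 's \<Rightarrow> real ^ 'm" and \<tau> :: "real \<Rightarrow> 's \<Rightarrow> real"
  assumes lab_cont: "continuous_map X (discrete_topology UNIV) lab"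
    and pos_cont: "continuous_map X euclidean pos"
    and pos_bound: "\<And>z. z \<in> topspace X \<Longrightarrow> norm (pos z) \<le> 1"
    and rate_lab: "\<And>j. rate_of (\<lambda>z z'. of_bool (lab z' = j)) (\<lambda>s z. r s z j)"
    and rate_pos: "\<And>j l. rate_of (\<lambda>z z'. of_bool (lab z' = j) * (pos z' - pos z) $ l)
       (\<lambda>s z. if lab z = j then b s z $ l else 0)"
    and rate_sq: "\<And>j. rate_of (\<lambda>z z'. of_bool (lab z' = j) * (norm (pos z' - pos z))\<^sup>2)
       (\<lambda>s z. if lab z = j then \<tau> s z else 0)"
    and coeff_bound: "\<exists>C. \<forall>s\<in>{0..T}. \<forall>z\<in>topspace X. \<forall>j l.
       \<bar>r s z j\<bar> \<le> C \<and> \<bar>b s z $ l\<bar> \<le> C \<and> \<bar>\<tau> s z\<bar> \<le> C"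
begin

lemma lab_sets: "{z \<in> topspace X. lab z = j} \<in> sets (borel_top X)"
proof -
  have "\<forall>U. openin X {z \<in> topspace X. lab z \<in> U}"
    using lab_cont by (auto simp: continuous_map_def)
  from spec[OF this, of "{j}"] show ?thesis by (auto simp: sets_borel_top)
qed

lemma lab_measurable [measurable]: "(\<lambda>z. of_bool (lab z = j) :: real) \<in> borel_measurable (borel_top X)"
proof -
  have [measurable]: "Measurable.pred (borel_top X) (\<lambda>z. lab z = j)"
    using lab_sets[of j] by (simp add: pred_def)
  show ?thesis unfolding of_bool_def by measurable
qed

lemma pos_measurable [measurable]: "pos \<in> borel_measurable (borel_top X)"
  by (rule borel_top_measurable_euclidean[OF pos_cont])

lemma pos_nth_measurable [measurable]: "(\<lambda>z. pos z $ l) \<in> borel_measurable (borel_top X)"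
  using measurable_compose[OF pos_measurable borel_measurable_nth] .

lemma uniform_rates:
  assumes "0 < \<epsilon>"
  obtains \<delta> where "0 < \<delta>"
    "\<And>s h z j. z \<in> topspace X \<Longrightarrow> 0 \<le> s \<Longrightarrow> 0 < h \<Longrightarrow> h < \<delta> \<Longrightarrow> s + h \<le> T \<Longrightarrow>
      \<bar>(\<integral>z'. of_bool (lab z' = j) \<partial>law s (s + h) z) - of_bool (lab z = j) - h * r s z j\<bar> \<le> \<epsilon> * h"
    "\<And>s h z j l. z \<in> topspace X \<Longrightarrow> 0 \<le> s \<Longrightarrow> 0 < h \<Longrightarrow> h < \<delta> \<Longrightarrow> s + h \<le> T \<Longrightarrow>
      \<bar>(\<integral>z'. of_bool (lab z' = j) * (pos z' - pos z) $ l \<partial>law s (s + h) z)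
        - (if lab z = j then h * b s z $ l else 0)\<bar> \<le> \<epsilon> * h"
    "\<And>s h z j. z \<in> topspace X \<Longrightarrow> 0 \<le> s \<Longrightarrow> 0 < h \<Longrightarrow> h < \<delta> \<Longrightarrow> s + h \<le> T \<Longrightarrow>
      \<bar>(\<integral>z'. of_bool (lab z' = j) * (norm (pos z' - pos z))\<^sup>2 \<partial>law s (s + h) z)
        - (if lab z = j then h * \<tau> s z else 0)\<bar> \<le> \<epsilon> * h"
proof -
  let ?A = "\<lambda>j z z'. of_bool (lab z' = j) :: real"
  let ?B = "\<lambda>jl z z'. of_bool (lab z' = fst jl) * (pos z' - pos z) $ snd jl"
  let ?C = "\<lambda>j z z'. of_bool (lab z' = j) * (norm (pos z' - pos z))\<^sup>2"
  let ?a = "\<lambda>j s z. r s z j"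
  let ?b = "\<lambda>jl s z. if lab z = fst jl then b s z $ snd jl else 0"
  let ?c = "\<lambda>j s z. if lab z = j then \<tau> s z else 0"
  obtain d1 where d1: "0 < d1" "\<forall>j s h. \<forall>z\<in>topspace X. 0 \<le> s \<longrightarrow> 0 < h \<longrightarrow> h < d1 \<longrightarrow> s + h \<le> T \<longrightarrow>
      \<bar>(\<integral>z'. ?A j z z' \<partial>law s (s + h) z) - ?A j z z - h * ?a j s z\<bar> \<le> \<epsilon> * h"
    using rate_of_family[where \<Gamma>="?A" and g="?a", OF rate_lab assms] by (elim exE conjE)
  obtain d2 where d2: "0 < d2" "\<forall>j s h. \<forall>z\<in>topspace X. 0 \<le> s \<longrightarrow> 0 < h \<longrightarrow> h < d2 \<longrightarrow> s + h \<le> T \<longrightarrow>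
      \<bar>(\<integral>z'. ?B j z z' \<partial>law s (s + h) z) - ?B j z z - h * ?b j s z\<bar> \<le> \<epsilon> * h"
    using rate_of_family[where \<Gamma>="?B" and g="?b", OF rate_pos assms] by (elim exE conjE)
  obtain d3 where d3: "0 < d3" "\<forall>j s h. \<forall>z\<in>topspace X. 0 \<le> s \<longrightarrow> 0 < h \<longrightarrow> h < d3 \<longrightarrow> s + h \<le> T \<longrightarrow>
      \<bar>(\<integral>z'. ?C j z z' \<partial>law s (s + h) z) - ?C j z z - h * ?c j s z\<bar> \<le> \<epsilon> * h"
    using rate_of_family[where \<Gamma>="?C" and g="?c", OF rate_sq assms] by (elim exE conjE)
  show thesis
  proof (rule that[of "min d1 (min d2 d3)"])
    show "0 < min d1 (min d2 d3)" using d1(1) d2(1) d3(1) by simp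
  next
    fix s h z j assume z: "z \<in> topspace X" "0 \<le> s" "0 < h" "h < min d1 (min d2 d3)" "s + h \<le> T"
    show "\<bar>(\<integral>z'. of_bool (lab z' = j) \<partial>law s (s + h) z) - of_bool (lab z = j) - h * r s z j\<bar> \<le> \<epsilon> * h"
      using d1(2)[rule_format, OF z(1-3) _ z(5), of j] z(4) by simp
  next
    fix s h z j l assume z: "z \<in> topspace X" "0 \<le> s" "0 < h" "h < min d1 (min d2 d3)" "s + h \<le> T"
    have "h < d2" using z(4) by simp
    from d2(2)[rule_format, OF z(1-3) this z(5), of "(j, l)"]
    show "\<bar>(\<integral>z'. of_bool (lab z' = j) * (pos z' - pos z) $ l \<partial>law s (s + h) z)
        - (if lab z = j then h * b s z $ l else 0)\<bar> \<le> \<epsilon> * h"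
      by (auto split: if_splits)
  next
    fix s h z j assume z: "z \<in> topspace X" "0 \<le> s" "0 < h" "h < min d1 (min d2 d3)" "s + h \<le> T"
    have "h < d3" using z(4) by simp
    from d3(2)[rule_format, OF z(1-3) this z(5), of j]
    show "\<bar>(\<integral>z'. of_bool (lab z' = j) * (norm (pos z' - pos z))\<^sup>2 \<partial>law s (s + h) z)
        - (if lab z = j then h * \<tau> s z else 0)\<bar> \<le> \<epsilon> * h"
      by (auto split: if_splits)
  qed
qed

end

text \<open>
  The integrals over the labels enter with the weights \<open>min (a j) (b j) / a j\<close>. Those of the labels \<open>j \<noteq> d\<close>
  multiply negligible terms, and the weight of the present label \<open>d\<close> is close to 1.
\<close>
lemma weighted_sum_near_point:
  fixes w I :: "'d::finite \<Rightarrow> real" and \<eta> e g G :: real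
  assumes w: "\<And>j. 0 \<le> w j" "\<And>j. w j \<le> 1" "1 - w d \<le> \<eta>"
    and I: "\<And>j. j \<noteq> d \<Longrightarrow> \<bar>I j\<bar> \<le> e" "\<bar>I d - g\<bar> \<le> e" "\<bar>g\<bar> \<le> G"
  shows "(\<Sum>j\<in>UNIV. w j * I j) \<le> g + CARD('d) * e + (G + e) * \<eta>"
proof -
  have e0: "0 \<le> e" using I(2) by linarith
  have "w d * I d = I d - (1 - w d) * I d" by (simp add: algebra_simps)
  also have "\<dots> \<le> I d + (1 - w d) * \<bar>I d\<bar>"
    using mult_left_mono[of "- I d" "\<bar>I d\<bar>" "1 - w d"] w(2)[of d] by simp
  also have "(1 - w d) * \<bar>I d\<bar> \<le> \<eta> * (G + e)"
    using I w(2)[of d] w(3) by (intro mult_mono) auto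
  also have "I d \<le> g + e" using I(2) by linarith
  finally have d: "w d * I d \<le> g + e + (G + e) * \<eta>" by (simp add: mult.commute)
  have "w j * I j \<le> e" if "j \<noteq> d" for j
  proof -
    have "w j * I j \<le> w j * \<bar>I j\<bar>" using w(1)[of j] by (intro mult_left_mono) auto
    also have "\<dots> \<le> 1 * e" using I(1)[OF that] w(1)[of j] w(2)[of j] by (intro mult_mono) auto
    finally show ?thesis by simp
  qed
  then have "(\<Sum>j\<in>UNIV - {d}. w j * I j) \<le> (\<Sum>j\<in>UNIV - {d}. e)" by (intro sum_mono) auto
  also have "\<dots> = real (CARD('d) - 1) * e" by (simp add: card_Diff_singleton)
  also have "real (CARD('d) - 1) = real CARD('d) - 1"
    by (simp add: of_nat_diff Suc_leI)
  finally have "w d * I d + (\<Sum>j\<in>UNIV - {d}. w j * I j) \<le> g + CARD('d) * e + (G + e) * \<eta>"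
    using d by (simp add: algebra_simps)
  then show ?thesis by (subst sum.remove[of _ d]) auto
qed

text \<open>
  The increment of \<open>\<kappa> |v|\<^sup>2 + p (\<Sum>l. x\<^sub>l)\<close> if \<open>v\<close> and \<open>x\<close> move by \<open>\<xi>\<close>, except for the factor 2 of the
  square: it leaves room for replacing \<open>|\<xi> - \<eta>|\<^sup>2\<close> by \<open>2 |\<xi>|\<^sup>2 + 2 |\<eta>|\<^sup>2\<close>, which separates the two processes.
\<close>
definition displacement :: "real \<Rightarrow> real \<Rightarrow> real ^ 'm::finite \<Rightarrow> real ^ 'm \<Rightarrow> real" where
  "displacement \<kappa> p v \<xi> = \<kappa> * (2 * (v \<bullet> \<xi>) + 2 * (norm \<xi>)\<^sup>2) + p * (\<Sum>l\<in>UNIV. \<xi> $ l)"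

lemma linear_moment_bound:
  fixes v \<alpha> \<beta> :: "'m::finite \<Rightarrow> real"
  assumes "0 \<le> \<kappa>" "0 \<le> p" "\<And>l. \<bar>v l\<bar> \<le> 2" "\<And>l. \<bar>\<alpha> l - \<beta> l\<bar> \<le> e" "\<bar>t - \<sigma>\<bar> \<le> e"
  shows "\<bar>(\<kappa> * (2 * (\<Sum>l\<in>UNIV. v l * \<alpha> l) + 2 * t) + p * (\<Sum>l\<in>UNIV. \<alpha> l))
     - (\<kappa> * (2 * (\<Sum>l\<in>UNIV. v l * \<beta> l) + 2 * \<sigma>) + p * (\<Sum>l\<in>UNIV. \<beta> l))\<bar>
    \<le> (\<kappa> * (4 * CARD('m) + 2) + p * CARD('m)) * e"
proof -
  have "\<bar>(\<Sum>l\<in>UNIV. v l * \<alpha> l) - (\<Sum>l\<in>UNIV. v l * \<beta> l)\<bar> = \<bar>\<Sum>l\<in>UNIV. v l * (\<alpha> l - \<beta> l)\<bar>"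
    by (simp add: sum_subtractf algebra_simps)
  also have "\<dots> \<le> (\<Sum>l\<in>(UNIV :: 'm set). 2 * e)"
    by (rule order_trans[OF sum_abs sum_mono]) (use assms in \<open>auto simp: abs_mult intro!: mult_mono\<close>)
  finally have 1: "\<bar>(\<Sum>l\<in>UNIV. v l * \<alpha> l) - (\<Sum>l\<in>UNIV. v l * \<beta> l)\<bar> \<le> CARD('m) * (2 * e)" by simp
  have "\<bar>(\<Sum>l\<in>UNIV. \<alpha> l) - (\<Sum>l\<in>UNIV. \<beta> l)\<bar> \<le> (\<Sum>l\<in>(UNIV :: 'm set). e)"
    unfolding sum_subtractf[symmetric]
    by (rule order_trans[OF sum_abs sum_mono]) (use assms in auto)
  then have 2: "\<bar>(\<Sum>l\<in>UNIV. \<alpha> l) - (\<Sum>l\<in>UNIV. \<beta> l)\<bar> \<le> CARD('m) * e" by simp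
  have "\<bar>(\<kappa> * (2 * (\<Sum>l\<in>UNIV. v l * \<alpha> l) + 2 * t) + p * (\<Sum>l\<in>UNIV. \<alpha> l))
     - (\<kappa> * (2 * (\<Sum>l\<in>UNIV. v l * \<beta> l) + 2 * \<sigma>) + p * (\<Sum>l\<in>UNIV. \<beta> l))\<bar>
   = \<bar>\<kappa> * (2 * ((\<Sum>l\<in>UNIV. v l * \<alpha> l) - (\<Sum>l\<in>UNIV. v l * \<beta> l)) + 2 * (t - \<sigma>))
     + p * ((\<Sum>l\<in>UNIV. \<alpha> l) - (\<Sum>l\<in>UNIV. \<beta> l))\<bar>"
    by (simp add: algebra_simps)
  also have "\<dots> \<le> \<kappa> * \<bar>2 * ((\<Sum>l\<in>UNIV. v l * \<alpha> l) - (\<Sum>l\<in>UNIV. v l * \<beta> l)) + 2 * (t - \<sigma>)\<bar>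
     + p * \<bar>(\<Sum>l\<in>UNIV. \<alpha> l) - (\<Sum>l\<in>UNIV. \<beta> l)\<bar>"
    using assms(1,2) by (intro order_trans[OF abs_triangle_ineq]) (simp add: abs_mult)
  also have "\<dots> \<le> \<kappa> * (2 * (CARD('m) * (2 * e)) + 2 * e) + p * (CARD('m) * e)"
  proof -
    have "\<bar>2 * ((\<Sum>l\<in>UNIV. v l * \<alpha> l) - (\<Sum>l\<in>UNIV. v l * \<beta> l)) + 2 * (t - \<sigma>)\<bar>
       \<le> 2 * (CARD('m) * (2 * e)) + 2 * e"
    proof -
      have "\<bar>2 * x + 2 * y\<bar> \<le> 2 * a + 2 * b" if "\<bar>x\<bar> \<le> a" "\<bar>y\<bar> \<le> b" for x y a b :: real
        using that by linarith
      then show ?thesis using 1 assms(5) by blast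
    qed
    then show ?thesis using 2 assms(1,2) by (intro add_mono mult_left_mono)
  qed
  finally show ?thesis by (simp add: algebra_simps)
qed

context labelled_markov
begin

lemma displacement_integral:
  assumes su: "0 \<le> s" "s \<le> u" "u \<le> T" and z: "z \<in> topspace X"
  shows "integrable (law s u z) (\<lambda>z'. displacement \<kappa> p v (pos z' - pos z))"
    and "(\<integral>z'. of_bool (lab z' = j) * displacement \<kappa> p v (pos z' - pos z) \<partial>law s u z) =
     \<kappa> * (2 * (\<Sum>l\<in>UNIV. v $ l * (\<integral>z'. of_bool (lab z' = j) * (pos z' - pos z) $ l \<partial>law s u z))
       + 2 * (\<integral>z'. of_bool (lab z' = j) * (norm (pos z' - pos z))\<^sup>2 \<partial>law s u z))
     + p * (\<Sum>l\<in>UNIV. \<integral>z'. of_bool (lab z' = j) * (pos z' - pos z) $ l \<partial>law s u z)"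
proof -
  have nb: "norm (pos z' - pos z) \<le> 2" if "z' \<in> topspace X" for z'
    using norm_triangle_ineq4[of "pos z'" "pos z"] pos_bound[OF that] pos_bound[OF z] by linarith
  have lb: "\<bar>(pos z' - pos z) $ l\<bar> \<le> 2" if "z' \<in> topspace X" for z' l
    using component_le_norm_cart[of "pos z' - pos z" l] nb[OF that] by linarith
  have sb: "(norm (pos z' - pos z))\<^sup>2 \<le> 4" if "z' \<in> topspace X" for z'
    using power_mono[OF nb[OF that], of 2] by simp
  have i1: "integrable (law s u z) (\<lambda>z'. (pos z' - pos z) $ l)" for l
    by (rule law_integrable[OF su z, where C=2]) (use lb in auto)
  have i2: "integrable (law s u z) (\<lambda>z'. (norm (pos z' - pos z))\<^sup>2)"
    by (rule law_integrable[OF su z, where C=4]) (use sb in auto)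
  have o1: "integrable (law s u z) (\<lambda>z'. of_bool (lab z' = j) * (pos z' - pos z) $ l)" for l
    by (rule law_integrable[OF su z, where C=2]) (use lb in auto)
  have o2: "integrable (law s u z) (\<lambda>z'. of_bool (lab z' = j) * (norm (pos z' - pos z))\<^sup>2)"
    by (rule law_integrable[OF su z, where C=4]) (use sb in auto)
  show "integrable (law s u z) (\<lambda>z'. displacement \<kappa> p v (pos z' - pos z))"
    unfolding displacement_def inner_vec_def inner_real_def
    by (intro Bochner_Integration.integrable_add integrable_mult_right Bochner_Integration.integrable_sum i1 i2)
  have "(\<integral>z'. of_bool (lab z' = j) * displacement \<kappa> p v (pos z' - pos z) \<partial>law s u z) =
    (\<integral>z'. \<kappa> * (2 * (\<Sum>l\<in>UNIV. v $ l * (of_bool (lab z' = j) * (pos z' - pos z) $ l))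
       + 2 * (of_bool (lab z' = j) * (norm (pos z' - pos z))\<^sup>2))
     + p * (\<Sum>l\<in>UNIV. of_bool (lab z' = j) * (pos z' - pos z) $ l) \<partial>law s u z)"
    unfolding displacement_def inner_vec_def inner_real_def
    by (intro Bochner_Integration.integral_cong) (auto simp: of_bool_def)
  also have "\<dots> = \<kappa> * (2 * (\<Sum>l\<in>UNIV. v $ l * (\<integral>z'. of_bool (lab z' = j) * (pos z' - pos z) $ l \<partial>law s u z))
       + 2 * (\<integral>z'. of_bool (lab z' = j) * (norm (pos z' - pos z))\<^sup>2 \<partial>law s u z))
     + p * (\<Sum>l\<in>UNIV. \<integral>z'. of_bool (lab z' = j) * (pos z' - pos z) $ l \<partial>law s u z)"
    by (intro has_bochner_integral_integral_eq has_bochner_integral_add has_bochner_integral_mult_right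
        has_bochner_integral_sum has_bochner_integral_integrable o1 o2)
  finally show "(\<integral>z'. of_bool (lab z' = j) * displacement \<kappa> p v (pos z' - pos z) \<partial>law s u z) =
     \<kappa> * (2 * (\<Sum>l\<in>UNIV. v $ l * (\<integral>z'. of_bool (lab z' = j) * (pos z' - pos z) $ l \<partial>law s u z))
       + 2 * (\<integral>z'. of_bool (lab z' = j) * (norm (pos z' - pos z))\<^sup>2 \<partial>law s u z))
     + p * (\<Sum>l\<in>UNIV. \<integral>z'. of_bool (lab z' = j) * (pos z' - pos z) $ l \<partial>law s u z)" .
qed

text \<open>
  The contribution of one process to a step of the coupling. The weight of the present label may be off by
  \<open>\<eta>\<close>, which will be of order \<open>h\<close>; as the integral is of order \<open>h\<close> too, the product is negligible.
\<close>
lemma weighted_displacement_rate: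
  fixes \<kappa> p K :: real
  assumes "0 < \<epsilon>" "0 \<le> \<kappa>" "0 \<le> p"
    and K: "\<forall>s\<in>{0..T}. \<forall>z\<in>topspace X. \<forall>j l.
       \<bar>r s z j\<bar> \<le> K \<and> \<bar>b s z $ l\<bar> \<le> K \<and> \<bar>\<tau> s z\<bar> \<le> K"
  defines "c \<equiv> \<kappa> * (4 * CARD('m) + 2) + p * CARD('m)"
  shows "\<exists>\<delta>>0. \<forall>s h v w \<eta>. \<forall>z\<in>topspace X. 0 \<le> s \<longrightarrow> 0 < h \<longrightarrow> h < \<delta> \<longrightarrow> s + h \<le> T \<longrightarrow>
    (\<forall>l. \<bar>v $ l\<bar> \<le> 2) \<longrightarrow> (\<forall>j. 0 \<le> w j \<and> w j \<le> 1) \<longrightarrow> 1 - w (lab z) \<le> \<eta> \<longrightarrow> 0 \<le> \<eta> \<longrightarrow>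
    (\<Sum>j\<in>UNIV. w j * (\<integral>z'. of_bool (lab z' = j) * displacement \<kappa> p v (pos z' - pos z) \<partial>law s (s + h) z))
      \<le> h * (\<kappa> * (2 * (v \<bullet> b s z) + 2 * \<tau> s z) + p * (\<Sum>l\<in>UNIV. b s z $ l)) + \<epsilon> * h + h * (c * (K + 1)) * \<eta>"
proof -
  have c0: "0 \<le> c" unfolding c_def using assms by auto
  define e where "e = min 1 (\<epsilon> / (CARD('d) * c + 1))"
  have pos1: "0 < CARD('d) * c + 1" using c0 by (simp add: add_nonneg_pos)
  have e: "0 < e" "e \<le> 1" using assms(1) pos1 by (auto simp: e_def)
  have "e * (CARD('d) * c + 1) \<le> \<epsilon> / (CARD('d) * c + 1) * (CARD('d) * c + 1)"
    using pos1 by (intro mult_right_mono) (auto simp: e_def)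
  also have "\<dots> = \<epsilon>" using pos1 by simp
  finally have ec: "CARD('d) * (c * e) \<le> \<epsilon>" using e by (simp add: algebra_simps)
  obtain \<delta> where \<delta>: "0 < \<delta>"
    "\<And>s h z j. z \<in> topspace X \<Longrightarrow> 0 \<le> s \<Longrightarrow> 0 < h \<Longrightarrow> h < \<delta> \<Longrightarrow> s + h \<le> T \<Longrightarrow>
      \<bar>(\<integral>z'. of_bool (lab z' = j) \<partial>law s (s + h) z) - of_bool (lab z = j) - h * r s z j\<bar> \<le> e * h"
    "\<And>s h z j l. z \<in> topspace X \<Longrightarrow> 0 \<le> s \<Longrightarrow> 0 < h \<Longrightarrow> h < \<delta> \<Longrightarrow> s + h \<le> T \<Longrightarrow>
      \<bar>(\<integral>z'. of_bool (lab z' = j) * (pos z' - pos z) $ l \<partial>law s (s + h) z)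
        - (if lab z = j then h * b s z $ l else 0)\<bar> \<le> e * h"
    "\<And>s h z j. z \<in> topspace X \<Longrightarrow> 0 \<le> s \<Longrightarrow> 0 < h \<Longrightarrow> h < \<delta> \<Longrightarrow> s + h \<le> T \<Longrightarrow>
      \<bar>(\<integral>z'. of_bool (lab z' = j) * (norm (pos z' - pos z))\<^sup>2 \<partial>law s (s + h) z)
        - (if lab z = j then h * \<tau> s z else 0)\<bar> \<le> e * h"
    using uniform_rates[OF e(1)] by blast
  show ?thesis
  proof (intro exI[of _ \<delta>] conjI \<delta>(1) allI ballI impI)
    fix s h :: real and v :: "real ^ 'm" and w :: "'d \<Rightarrow> real" and \<eta> :: real and z
    assume z: "z \<in> topspace X" "0 \<le> s" "0 < h" "h < \<delta>" "s + h \<le> T"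
      and v: "\<forall>l. \<bar>v $ l\<bar> \<le> 2" and w: "\<forall>j. 0 \<le> w j \<and> w j \<le> 1" "1 - w (lab z) \<le> \<eta>" "0 \<le> \<eta>"
    define I where "I j = (\<integral>z'. of_bool (lab z' = j) * displacement \<kappa> p v (pos z' - pos z) \<partial>law s (s + h) z)" for j
    define al where "al j l = (\<integral>z'. of_bool (lab z' = j) * (pos z' - pos z) $ l \<partial>law s (s + h) z)" for j l
    define t where "t j = (\<integral>z'. of_bool (lab z' = j) * (norm (pos z' - pos z))\<^sup>2 \<partial>law s (s + h) z)" for j
    define g where "g = \<kappa> * (2 * (\<Sum>l\<in>UNIV. v $ l * (h * b s z $ l)) + 2 * (h * \<tau> s z)) + p * (\<Sum>l\<in>UNIV. h * b s z $ l)"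
    have I_eq: "I j = \<kappa> * (2 * (\<Sum>l\<in>UNIV. v $ l * al j l) + 2 * t j) + p * (\<Sum>l\<in>UNIV. al j l)" for j
      unfolding I_def al_def t_def by (rule displacement_integral(2)) (use z in auto)
    have g_eq: "g = h * (\<kappa> * (2 * (v \<bullet> b s z) + 2 * \<tau> s z) + p * (\<Sum>l\<in>UNIV. b s z $ l))"
      unfolding g_def inner_vec_def inner_real_def
      by (simp add: sum_distrib_left algebra_simps)
    have s: "s \<in> {0..T}" using z by auto
    have "\<bar>I j\<bar> \<le> c * (e * h)" if "j \<noteq> lab z" for j
      using linear_moment_bound[OF assms(2,3), of "\<lambda>l. v $ l" "al j" "\<lambda>_. 0" "e * h" "t j" 0] v
        \<delta>(3)[OF z, of j] \<delta>(4)[OF z, of j] that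
      unfolding I_eq c_def al_def t_def by (auto split: if_splits)
    moreover have "\<bar>I (lab z) - g\<bar> \<le> c * (e * h)"
      unfolding I_eq g_def c_def
      by (rule linear_moment_bound[OF assms(2,3)])
         (use v \<delta>(3)[OF z, of "lab z"] \<delta>(4)[OF z, of "lab z"] in \<open>auto simp: al_def t_def\<close>)
    moreover have "\<bar>g\<bar> \<le> c * (K * h)"
    proof -
      have "\<bar>h * b s z $ l\<bar> \<le> K * h" "\<bar>h * \<tau> s z\<bar> \<le> K * h" for l
        using K[rule_format, OF s z(1), of undefined l] z(3) by (auto simp: abs_mult mult.commute[of _ h])
      then show ?thesis
        using linear_moment_bound[OF assms(2,3), of "\<lambda>l. v $ l" "\<lambda>l. h * b s z $ l" "\<lambda>_. 0" "K * h" "h * \<tau> s z" 0] v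
        unfolding g_def c_def by simp
    qed
    ultimately have "(\<Sum>j\<in>UNIV. w j * I j) \<le> g + CARD('d) * (c * (e * h)) + (c * (K * h) + c * (e * h)) * \<eta>"
      using w by (intro weighted_sum_near_point[where d="lab z"]) auto
    also have "CARD('d) * (c * (e * h)) \<le> \<epsilon> * h"
      using mult_right_mono[OF ec, of h] z(3) by (simp add: algebra_simps)
    also have "(c * (K * h) + c * (e * h)) * \<eta> \<le> h * (c * (K + 1)) * \<eta>"
    proof (rule mult_right_mono[OF _ w(3)])
      have "c * (e * h) \<le> c * (1 * h)" using e z(3) c0 by (intro mult_left_mono mult_right_mono) auto
      then show "c * (K * h) + c * (e * h) \<le> h * (c * (K + 1))" by (simp add: algebra_simps)
    qed
    finally show "(\<Sum>j\<in>UNIV. w j * (\<integral>z'. of_bool (lab z' = j) * displacement \<kappa> p v (pos z' - pos z) \<partial>law s (s + h) z))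
      \<le> h * (\<kappa> * (2 * (v \<bullet> b s z) + 2 * \<tau> s z) + p * (\<Sum>l\<in>UNIV. b s z $ l)) + \<epsilon> * h + h * (c * (K + 1)) * \<eta>"
      unfolding I_def g_eq by simp
  qed
qed

end

section \<open>The gap between two coupled processes\<close>

text \<open>
  The second summand absorbs the quadratic variation of jumps with large rates. The third one keeps
  the gap above \<open>1 / \<kappa>\<close> and with the first it dominates \<open>2 * norm (x - y)\<close>.
\<close>
definition gap :: "real \<Rightarrow> real ^ 'm::finite \<Rightarrow> real ^ 'm \<Rightarrow> real" where
  "gap \<kappa> x y = \<kappa> * (norm (x - y))\<^sup>2 + 4 / \<kappa> * (\<Sum>l\<in>UNIV. x $ l) + 1 / \<kappa>"

lemma gap_displaced:
  fixes x y x' y' :: "real ^ 'm::finite"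
  assumes "0 < \<kappa>"
  shows "gap \<kappa> x' y' \<le> gap \<kappa> x y + displacement \<kappa> (4 / \<kappa>) (x - y) (x' - x)
    + displacement \<kappa> 0 (y - x) (y' - y)"
proof -
  let ?u = "x - y" and ?a = "x' - x" and ?b = "y' - y"
  have "(norm (x' - y'))\<^sup>2 = (norm (?u + ?a - ?b))\<^sup>2" by (simp add: algebra_simps)
  also have "\<dots> = (norm ?u)\<^sup>2 + 2 * (?u \<bullet> ?a) - 2 * (?u \<bullet> ?b) + (norm (?a - ?b))\<^sup>2"
    unfolding power2_norm_eq_inner by (simp add: inner_diff inner_add inner_commute algebra_simps)
  also have "(norm (?a - ?b))\<^sup>2 \<le> 2 * (norm ?a)\<^sup>2 + 2 * (norm ?b)\<^sup>2"
  proof -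
    have "(norm (?a - ?b))\<^sup>2 + (norm (?a + ?b))\<^sup>2 = 2 * (norm ?a)\<^sup>2 + 2 * (norm ?b)\<^sup>2"
      unfolding power2_norm_eq_inner by (simp add: inner_diff inner_add inner_commute algebra_simps)
    then show ?thesis using zero_le_power2[of "norm (?a + ?b)"] by linarith
  qed
  finally have "(norm (x' - y'))\<^sup>2 \<le> (norm ?u)\<^sup>2 + 2 * (?u \<bullet> ?a) - 2 * (?u \<bullet> ?b)
    + (2 * (norm ?a)\<^sup>2 + 2 * (norm ?b)\<^sup>2)" by simp
  then have "\<kappa> * (norm (x' - y'))\<^sup>2 \<le> \<kappa> * ((norm ?u)\<^sup>2 + 2 * (?u \<bullet> ?a) - 2 * (?u \<bullet> ?b)
    + (2 * (norm ?a)\<^sup>2 + 2 * (norm ?b)\<^sup>2))" using assms by (intro mult_left_mono) auto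
  moreover have "(y - x) \<bullet> ?b = - (?u \<bullet> ?b)" by (simp add: inner_diff_left)
  moreover have "(\<Sum>l\<in>UNIV. x' $ l) = (\<Sum>l\<in>UNIV. x $ l) + (\<Sum>l\<in>UNIV. ?a $ l)"
    by (simp add: sum_subtractf)
  ultimately show ?thesis unfolding gap_def displacement_def
    by (simp add: distrib_left right_diff_distrib)
qed

locale coupled_markov =
  A: labelled_markov T X1 \<Omega>1 P1 Z1 lab1 pos1 r1 b1 \<tau>1 +
  B: labelled_markov T X2 \<Omega>2 P2 Z2 lab2 pos2 r2 b2 \<tau>2
  for T :: real and X1 :: "'s1 topology" and \<Omega>1 :: "'w1 measure" and P1 Z1
    and lab1 :: "'s1 \<Rightarrow> 'd::finite" and pos1 :: "'s1 \<Rightarrow> real ^ 'm::finite" and r1 b1 \<tau>1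
    and X2 :: "'s2 topology" and \<Omega>2 :: "'w2 measure" and P2 Z2
    and lab2 :: "'s2 \<Rightarrow> 'd" and pos2 :: "'s2 \<Rightarrow> real ^ 'm" and r2 b2 \<tau>2 +
  fixes \<kappa> \<gamma> \<rho> :: real
  assumes kappa: "1 \<le> \<kappa>"
    and rho: "0 \<le> \<gamma>" "0 \<le> \<rho>"
    and pos1_nonneg: "\<And>z l. z \<in> topspace X1 \<Longrightarrow> 0 \<le> pos1 z $ l"
    and drift: "\<And>s z1 z2. s \<in> {0..T} \<Longrightarrow> z1 \<in> topspace X1 \<Longrightarrow> z2 \<in> topspace X2 \<Longrightarrow> lab1 z1 = lab2 z2 \<Longrightarrow>
      \<kappa> * (2 * ((pos1 z1 - pos2 z2) \<bullet> (b1 s z1 - b2 s z2)) + 2 * \<tau>1 s z1 + 2 * \<tau>2 s z2)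
        + 4 / \<kappa> * (\<Sum>l\<in>UNIV. b1 s z1 $ l) \<le> \<gamma> * gap \<kappa> (pos1 z1) (pos2 z2)"
    and jumps: "\<And>s z1 z2. s \<in> {0..T} \<Longrightarrow> z1 \<in> topspace X1 \<Longrightarrow> z2 \<in> topspace X2 \<Longrightarrow> lab1 z1 = lab2 z2 \<Longrightarrow>
      (\<Sum>j\<in>UNIV. \<bar>r1 s z1 j - r2 s z2 j\<bar>) \<le> \<rho> * gap \<kappa> (pos1 z1) (pos2 z2)"
begin

lemma gap_pos: "z1 \<in> topspace X1 \<Longrightarrow> 1 / \<kappa> \<le> gap \<kappa> (pos1 z1) y"
  unfolding gap_def using kappa sum_nonneg[of UNIV "\<lambda>l. pos1 z1 $ l"] pos1_nonneg by simp

text \<open>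
  Let \<open>W1\<close> exceed \<open>W2\<close> by at most \<open>\<theta>\<close> times the gap plus \<open>e\<close> if the labels agree. Then so do their expectations after a
  time \<open>h\<close>, up to \<open>h * \<epsilon>\<close> and with \<open>\<theta>\<close> increased by \<open>h\<close> times \<open>\<theta> * \<gamma> + 2 * D * \<rho>\<close>: the first summand is the growth of the gap while the
  labels agree, the second one is the cost of losing the coupling.
\<close>
lemma one_step:
  fixes \<epsilon> D \<Theta> :: real
  assumes \<epsilon>: "0 < \<epsilon>" and D: "0 \<le> D" and \<Theta>: "0 < \<Theta>"
  shows "\<exists>\<delta>>0. \<forall>s h \<theta> e \<alpha> W1 W2. \<forall>z1\<in>topspace X1. \<forall>z2\<in>topspace X2.
    0 \<le> s \<longrightarrow> 0 < h \<longrightarrow> h < \<delta> \<longrightarrow> s + h \<le> T \<longrightarrow> 0 \<le> \<theta> \<longrightarrow> \<theta> \<le> \<Theta> \<longrightarrow> 0 \<le> e \<longrightarrow> lab1 z1 = lab2 z2 \<longrightarrow>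
    W1 \<in> borel_measurable (borel_top X1) \<longrightarrow> W2 \<in> borel_measurable (borel_top X2) \<longrightarrow>
    (\<forall>z\<in>topspace X1. \<bar>W1 z - \<alpha>\<bar> \<le> D) \<longrightarrow> (\<forall>z\<in>topspace X2. \<bar>W2 z - \<alpha>\<bar> \<le> D) \<longrightarrow>
    (\<forall>z1'\<in>topspace X1. \<forall>z2'\<in>topspace X2. lab1 z1' = lab2 z2' \<longrightarrow>
       W1 z1' - W2 z2' \<le> \<theta> * gap \<kappa> (pos1 z1') (pos2 z2') + e) \<longrightarrow>
    (\<integral>z. W1 z \<partial>A.law s (s + h) z1) - (\<integral>z. W2 z \<partial>B.law s (s + h) z2)
      \<le> (\<theta> * (1 + h * \<gamma>) + h * (2 * D * \<rho>)) * gap \<kappa> (pos1 z1) (pos2 z2) + e + h * \<epsilon>"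
proof -
  obtain K1 where K1: "\<And>s z j l. s \<in> {0..T} \<Longrightarrow> z \<in> topspace X1 \<Longrightarrow>
       \<bar>r1 s z j\<bar> \<le> K1 \<and> \<bar>b1 s z $ l\<bar> \<le> K1 \<and> \<bar>\<tau>1 s z\<bar> \<le> K1"
    using A.coeff_bound by blast
  obtain K2 where K2: "\<And>s z j l. s \<in> {0..T} \<Longrightarrow> z \<in> topspace X2 \<Longrightarrow>
       \<bar>r2 s z j\<bar> \<le> K2 \<and> \<bar>b2 s z $ l\<bar> \<le> K2 \<and> \<bar>\<tau>2 s z\<bar> \<le> K2"
    using B.coeff_bound by blast
  define K where "K = max 0 (max K1 K2)"
  have K0: "0 \<le> K" by (simp add: K_def)
  have KA: "\<bar>r1 s z j\<bar> \<le> K \<and> \<bar>b1 s z $ l\<bar> \<le> K \<and> \<bar>\<tau>1 s z\<bar> \<le> K"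
    if "s \<in> {0..T}" "z \<in> topspace X1" for s z j l
    using K1[OF that, of j l] by (auto simp: K_def)
  have KA': "\<forall>s\<in>{0..T}. \<forall>z\<in>topspace X1. \<forall>j l.
     \<bar>r1 s z j\<bar> \<le> K \<and> \<bar>b1 s z $ l\<bar> \<le> K \<and> \<bar>\<tau>1 s z\<bar> \<le> K"
    using KA by blast
  have KB: "\<bar>r2 s z j\<bar> \<le> K \<and> \<bar>b2 s z $ l\<bar> \<le> K \<and> \<bar>\<tau>2 s z\<bar> \<le> K"
    if "s \<in> {0..T}" "z \<in> topspace X2" for s z j l
    using K2[OF that, of j l] by (auto simp: K_def)
  have KB': "\<forall>s\<in>{0..T}. \<forall>z\<in>topspace X2. \<forall>j l.
     \<bar>r2 s z j\<bar> \<le> K \<and> \<bar>b2 s z $ l\<bar> \<le> K \<and> \<bar>\<tau>2 s z\<bar> \<le> K"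
    using KB by blast
  define n where "n = real CARD('d)"
  have n0: "0 < n" by (simp add: n_def)
  define cA where "cA = \<kappa> * (4 * CARD('m) + 2) + 4 / \<kappa> * CARD('m)"
  define cB where "cB = \<kappa> * real (4 * CARD('m) + 2) + 0 * real CARD('m)"
  have c0: "0 \<le> cA" "0 \<le> cB" using kappa by (auto simp: cA_def cB_def)
  \<comment> \<open>The error \<open>\<epsilon> * h\<close> is split into four parts: two for the moments of the positions, one for the
    products of terms of order \<open>h\<close> (collected in \<open>Q\<close>), one for the probabilities of the labels.\<close>
  define \<epsilon>1 where "\<epsilon>1 = \<epsilon> / (4 * \<Theta>)"
  have \<epsilon>1: "0 < \<epsilon>1" using \<epsilon> \<Theta> by (simp add: \<epsilon>1_def)
  define \<epsilon>2 where "\<epsilon>2 = min 1 (\<epsilon> / (16 * D * n + 1))"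
  have q: "0 < 16 * D * n + 1" using D n0 by (simp add: add_nonneg_pos)
  have \<epsilon>2: "0 < \<epsilon>2" "\<epsilon>2 \<le> 1" using \<epsilon> q by (auto simp: \<epsilon>2_def)
  have "\<epsilon>2 * (16 * D * n + 1) \<le> \<epsilon> / (16 * D * n + 1) * (16 * D * n + 1)"
    using q by (intro mult_right_mono) (auto simp: \<epsilon>2_def)
  also have "\<dots> = \<epsilon>" using q by simp
  finally have \<epsilon>2D: "4 * D * n * \<epsilon>2 \<le> \<epsilon> / 4" using \<epsilon>2 by (simp add: algebra_simps)
  define Q where "Q = (cA + cB) * (K + 1) * (4 * (K + 1)) * \<Theta>"
  have Q0: "0 \<le> Q" using c0 K0 \<Theta> by (simp add: Q_def)
  have k0: "0 \<le> \<kappa>" and k4: "0 \<le> 4 / \<kappa>" using kappa by auto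
  obtain \<delta>1 where \<delta>1: "0 < \<delta>1" "\<forall>s h v w \<eta>. \<forall>z\<in>topspace X1. 0 \<le> s \<longrightarrow> 0 < h \<longrightarrow> h < \<delta>1 \<longrightarrow> s + h \<le> T \<longrightarrow>
    (\<forall>l. \<bar>v $ l\<bar> \<le> 2) \<longrightarrow> (\<forall>j. 0 \<le> w j \<and> w j \<le> 1) \<longrightarrow> 1 - w (lab1 z) \<le> \<eta> \<longrightarrow> 0 \<le> \<eta> \<longrightarrow>
    (\<Sum>j\<in>UNIV. w j * (\<integral>z'. of_bool (lab1 z' = j) * displacement \<kappa> (4 / \<kappa>) v (pos1 z' - pos1 z) \<partial>A.law s (s + h) z))
      \<le> h * (\<kappa> * (2 * (v \<bullet> b1 s z) + 2 * \<tau>1 s z) + 4 / \<kappa> * (\<Sum>l\<in>UNIV. b1 s z $ l)) + \<epsilon>1 * h + h * (cA * (K + 1)) * \<eta>"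
    using A.weighted_displacement_rate[OF \<epsilon>1 k0 k4 KA', folded cA_def] by (elim exE conjE) (rule that)
  obtain \<delta>2 where \<delta>2: "0 < \<delta>2" "\<forall>s h v w \<eta>. \<forall>z\<in>topspace X2. 0 \<le> s \<longrightarrow> 0 < h \<longrightarrow> h < \<delta>2 \<longrightarrow> s + h \<le> T \<longrightarrow>
    (\<forall>l. \<bar>v $ l\<bar> \<le> 2) \<longrightarrow> (\<forall>j. 0 \<le> w j \<and> w j \<le> 1) \<longrightarrow> 1 - w (lab2 z) \<le> \<eta> \<longrightarrow> 0 \<le> \<eta> \<longrightarrow>
    (\<Sum>j\<in>UNIV. w j * (\<integral>z'. of_bool (lab2 z' = j) * displacement \<kappa> 0 v (pos2 z' - pos2 z) \<partial>B.law s (s + h) z))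
      \<le> h * (\<kappa> * (2 * (v \<bullet> b2 s z) + 2 * \<tau>2 s z) + 0 * (\<Sum>l\<in>UNIV. b2 s z $ l)) + \<epsilon>1 * h + h * (cB * (K + 1)) * \<eta>"
    using B.weighted_displacement_rate[OF \<epsilon>1 k0 order_refl KB', folded cB_def] by (elim exE conjE) (rule that)
  obtain \<delta>3 where \<delta>3: "0 < \<delta>3" "\<forall>j s h. \<forall>z\<in>topspace X1. 0 \<le> s \<longrightarrow> 0 < h \<longrightarrow> h < \<delta>3 \<longrightarrow> s + h \<le> T \<longrightarrow>
      \<bar>(\<integral>z'. of_bool (lab1 z' = j) \<partial>A.law s (s + h) z) - of_bool (lab1 z = j) - h * r1 s z j\<bar> \<le> \<epsilon>2 * h"
    using A.rate_of_family[where \<Gamma>="\<lambda>j z z'. of_bool (lab1 z' = j)" and g="\<lambda>j s z. r1 s z j",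
        OF A.rate_lab \<epsilon>2(1)] by (elim exE conjE) (rule that)
  obtain \<delta>4 where \<delta>4: "0 < \<delta>4" "\<forall>j s h. \<forall>z\<in>topspace X2. 0 \<le> s \<longrightarrow> 0 < h \<longrightarrow> h < \<delta>4 \<longrightarrow> s + h \<le> T \<longrightarrow>
      \<bar>(\<integral>z'. of_bool (lab2 z' = j) \<partial>B.law s (s + h) z) - of_bool (lab2 z = j) - h * r2 s z j\<bar> \<le> \<epsilon>2 * h"
    using B.rate_of_family[where \<Gamma>="\<lambda>j z z'. of_bool (lab2 z' = j)" and g="\<lambda>j s z. r2 s z j",
        OF B.rate_lab \<epsilon>2(1)] by (elim exE conjE) (rule that)
  define \<delta>5 where "\<delta>5 = 1 / (2 * (K + 1))"
  define \<delta>6 where "\<delta>6 = \<epsilon> / (4 * (Q + 1))"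
  have \<delta>56: "0 < \<delta>5" "0 < \<delta>6" using K0 Q0 \<epsilon> by (auto simp: \<delta>5_def \<delta>6_def)
  define \<delta> where "\<delta> = Min {\<delta>1, \<delta>2, \<delta>3, \<delta>4, \<delta>5, \<delta>6}"
  have \<delta>: "0 < \<delta>" "\<delta> \<le> \<delta>1" "\<delta> \<le> \<delta>2" "\<delta> \<le> \<delta>3" "\<delta> \<le> \<delta>4" "\<delta> \<le> \<delta>5" "\<delta> \<le> \<delta>6"
    unfolding \<delta>_def using \<delta>1(1) \<delta>2(1) \<delta>3(1) \<delta>4(1) \<delta>56 by auto
  show ?thesis
  proof (intro exI[of _ \<delta>] conjI \<delta>(1) allI ballI impI)
    fix s h \<theta> e \<alpha> :: real and W1 W2 z1 z2
    assume z1: "z1 \<in> topspace X1" and z2: "z2 \<in> topspace X2"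
      and s0: "0 \<le> s" and h0: "0 < h" and hd: "h < \<delta>" and sT: "s + h \<le> T"
      and \<theta>: "0 \<le> \<theta>" "\<theta> \<le> \<Theta>" and e0: "0 \<le> e" and lab: "lab1 z1 = lab2 z2"
      and W1m: "W1 \<in> borel_measurable (borel_top X1)" and W2m: "W2 \<in> borel_measurable (borel_top X2)"
      and W1b: "\<forall>z\<in>topspace X1. \<bar>W1 z - \<alpha>\<bar> \<le> D" and W2b: "\<forall>z\<in>topspace X2. \<bar>W2 z - \<alpha>\<bar> \<le> D"
      and W: "\<forall>z1'\<in>topspace X1. \<forall>z2'\<in>topspace X2. lab1 z1' = lab2 z2' \<longrightarrow>
       W1 z1' - W2 z2' \<le> \<theta> * gap \<kappa> (pos1 z1') (pos2 z2') + e"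
    let ?M1 = "A.law s (s + h) z1" and ?M2 = "B.law s (s + h) z2"
    let ?V = "gap \<kappa> (pos1 z1) (pos2 z2)"
    let ?x = "pos1 z1" and ?y = "pos2 z2"
    have hlt: "h < \<delta>1" "h < \<delta>2" "h < \<delta>3" "h < \<delta>4" "h \<le> \<delta>5" "h \<le> \<delta>6" using \<delta> hd by linarith+
    have sh: "0 \<le> s" "s \<le> s + h" "s + h \<le> T" using s0 h0 sT by auto
    have sI: "s \<in> {0..T}" using sh by auto
    have V0: "0 \<le> ?V" using gap_pos[OF z1, of ?y] kappa by (smt (verit) divide_nonneg_pos)
    let ?A = "\<lambda>z. displacement \<kappa> (4 / \<kappa>) (?x - ?y) (pos1 z - ?x)"
    let ?B = "\<lambda>z. displacement \<kappa> 0 (?y - ?x) (pos2 z - ?y)"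
    define a :: "'d \<Rightarrow> real" where "a j = (\<integral>z. of_bool (lab1 z = j) \<partial>?M1)" for j
    define b :: "'d \<Rightarrow> real" where "b j = (\<integral>z. of_bool (lab2 z = j) \<partial>?M2)" for j
    define IA where "IA j = (\<integral>z. of_bool (lab1 z = j) * ?A z \<partial>?M1)" for j
    define IB where "IB j = (\<integral>z. of_bool (lab2 z = j) * ?B z \<partial>?M2)" for j
    have iA: "integrable ?M1 ?A" by (rule A.displacement_integral(1)[OF sh z1])
    have iB: "integrable ?M2 ?B" by (rule B.displacement_integral(1)[OF sh z2])
    have coupled: "(\<integral>z. W1 z \<partial>?M1) - (\<integral>z. W2 z \<partial>?M2) \<le> (\<theta> * ?V + e)
      + (\<Sum>j\<in>UNIV. min (a j) (b j) / a j * (\<integral>z. of_bool (lab1 z = j) * (\<theta> * ?A z) \<partial>?M1)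
        + min (a j) (b j) / b j * (\<integral>z. of_bool (lab2 z = j) * (\<theta> * ?B z) \<partial>?M2))
      + 2 * D * (\<Sum>j\<in>UNIV. \<bar>a j - b j\<bar>)"
      unfolding a_def b_def
    proof (rule coupled_expectation_le)
      show "prob_space ?M1" "prob_space ?M2"
        using A.prob_space_law[OF sh z1] B.prob_space_law[OF sh z2] by auto
      show "{\<omega> \<in> space ?M1. lab1 \<omega> = j} \<in> sets ?M1" "{\<omega> \<in> space ?M2. lab2 \<omega> = j} \<in> sets ?M2" for j
        using A.lab_sets[of j] B.lab_sets[of j] by auto
      have bd1: "\<bar>W1 z\<bar> \<le> D + \<bar>\<alpha>\<bar>" if "z \<in> topspace X1" for z
        using bspec[OF W1b that] by linarith
      have bd2: "\<bar>W2 z\<bar> \<le> D + \<bar>\<alpha>\<bar>" if "z \<in> topspace X2" for z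
        using bspec[OF W2b that] by linarith
      show "integrable ?M1 W1" by (rule A.law_integrable[OF sh z1 W1m bd1])
      show "integrable ?M2 W2" by (rule B.law_integrable[OF sh z2 W2m bd2])
      show "integrable ?M1 (\<lambda>z. \<theta> * ?A z)" "integrable ?M2 (\<lambda>z. \<theta> * ?B z)" using iA iB by auto
      show "\<bar>W1 z - \<alpha>\<bar> \<le> D" if "z \<in> space ?M1" for z using that W1b by simp
      show "\<bar>W2 z - \<alpha>\<bar> \<le> D" if "z \<in> space ?M2" for z using that W2b by simp
      show "0 \<le> \<theta> * ?V + e" using \<theta> V0 e0 by simp
      fix z z' assume zz: "z \<in> space ?M1" "z' \<in> space ?M2" "lab1 z = lab2 z'"
      then have "W1 z - W2 z' \<le> \<theta> * gap \<kappa> (pos1 z) (pos2 z') + e" using W by simp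
      also have "\<theta> * gap \<kappa> (pos1 z) (pos2 z') \<le> \<theta> * (?V + ?A z + ?B z')"
        using gap_displaced[of \<kappa> "pos1 z" "pos2 z'" ?x ?y] kappa \<theta> by (intro mult_left_mono) auto
      finally show "W1 z - W2 z' \<le> \<theta> * ?V + e + \<theta> * ?A z + \<theta> * ?B z'"
        by (simp add: algebra_simps)
    qed
    have IAe: "(\<integral>z. of_bool (lab1 z = j) * (\<theta> * ?A z) \<partial>?M1) = \<theta> * IA j" for j
      unfolding IA_def by (subst Bochner_Integration.integral_mult_right_zero[symmetric]) (simp add: mult_ac)
    have IBe: "(\<integral>z. of_bool (lab2 z = j) * (\<theta> * ?B z) \<partial>?M2) = \<theta> * IB j" for j
      unfolding IB_def by (subst Bochner_Integration.integral_mult_right_zero[symmetric]) (simp add: mult_ac)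
    have ra: "\<bar>a j - of_bool (lab1 z1 = j) - h * r1 s z1 j\<bar> \<le> \<epsilon>2 * h" for j
      unfolding a_def by (rule \<delta>3(2)[rule_format, OF z1 s0 h0 hlt(3) sT])
    have rb: "\<bar>b j - of_bool (lab1 z1 = j) - h * r2 s z2 j\<bar> \<le> \<epsilon>2 * h" for j
      unfolding b_def lab by (rule \<delta>4(2)[rule_format, OF z2 s0 h0 hlt(4) sT])
    have ab: "\<bar>a j - b j\<bar> \<le> h * \<bar>r1 s z1 j - r2 s z2 j\<bar> + 2 * \<epsilon>2 * h" for j
    proof -
      have "\<bar>a j - b j\<bar> \<le> \<bar>h * r1 s z1 j - h * r2 s z2 j\<bar> + 2 * \<epsilon>2 * h" using ra[of j] rb[of j] by linarith
      also have "\<bar>h * r1 s z1 j - h * r2 s z2 j\<bar> = h * \<bar>r1 s z1 j - r2 s z2 j\<bar>"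
        using h0 by (simp add: abs_mult flip: right_diff_distrib)
      finally show ?thesis .
    qed
    have nonneg: "0 \<le> a j" "0 \<le> b j" for j unfolding a_def b_def by (auto intro!: integral_nonneg)
    \<comment> \<open>\<open>\<eta>\<close> bounds \<open>2 * \<bar>a d - b d\<bar>\<close> for the present label \<open>d\<close>, whose probabilities are at least \<open>1 / 2\<close> for
      small \<open>h\<close>.\<close>
    define \<eta> where "\<eta> = 4 * (K + 1) * h"
    have \<eta>0: "0 \<le> \<eta>" using K0 h0 by (simp add: \<eta>_def)
    have e2h: "\<epsilon>2 * h \<le> 1 * h" using \<epsilon>2 h0 by (intro mult_right_mono) auto
    have hK: "h * K + h \<le> 1 / 2"
    proof -
      have "h * (2 * (K + 1)) \<le> 1 / (2 * (K + 1)) * (2 * (K + 1))"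
        using hlt(5) K0 unfolding \<delta>5_def by (intro mult_right_mono) auto
      then show ?thesis using K0 by (simp add: algebra_simps)
    qed
    have half: "1 / 2 \<le> a (lab1 z1)" "1 / 2 \<le> b (lab1 z1)"
    proof -
      have "\<bar>h * r1 s z1 (lab1 z1)\<bar> \<le> h * K" "\<bar>h * r2 s z2 (lab1 z1)\<bar> \<le> h * K"
        using KA[OF sI z1] KB[OF sI z2] h0 by (auto simp: abs_mult)
      then show "1 / 2 \<le> a (lab1 z1)" "1 / 2 \<le> b (lab1 z1)"
        using ra[of "lab1 z1"] rb[of "lab1 z1"] e2h hK by auto
    qed
    have dab: "\<bar>a (lab1 z1) - b (lab1 z1)\<bar> \<le> 2 * (K + 1) * h"
    proof -
      have "\<bar>r1 s z1 (lab1 z1) - r2 s z2 (lab1 z1)\<bar> \<le> 2 * K"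
        using KA[OF sI z1, of "lab1 z1" undefined] KB[OF sI z2, of "lab1 z1" undefined] by linarith
      then have "h * \<bar>r1 s z1 (lab1 z1) - r2 s z2 (lab1 z1)\<bar> \<le> h * (2 * K)"
        using h0 by (intro mult_left_mono) auto
      then show ?thesis using ab[of "lab1 z1"] e2h by (simp add: algebra_simps)
    qed
    have dab2: "2 * \<bar>a (lab1 z1) - b (lab1 z1)\<bar> \<le> \<eta>"
      using mult_left_mono[OF dab, of 2] by (simp add: \<eta>_def algebra_simps)
    have ratio: "1 - min x y / x \<le> 2 * \<bar>x - y\<bar>" if "1 / 2 \<le> x" for x y :: real
    proof -
      have "1 - min x y / x = (x - min x y) / x" using that by (simp add: field_simps)
      also have "\<dots> \<le> \<bar>x - y\<bar> / (1 / 2)" using that by (intro frac_le) auto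
      finally show ?thesis by simp
    qed
    have w1: "0 \<le> min (a j) (b j) / a j \<and> min (a j) (b j) / a j \<le> 1" for j
      using nonneg[of j] by (auto simp: divide_le_eq)
    have w2: "0 \<le> min (a j) (b j) / b j \<and> min (a j) (b j) / b j \<le> 1" for j
      using nonneg[of j] by (auto simp: divide_le_eq)
    have w1d: "1 - min (a (lab1 z1)) (b (lab1 z1)) / a (lab1 z1) \<le> \<eta>"
      using ratio[OF half(1), of "b (lab1 z1)"] dab2 by linarith
    have w2d: "1 - min (a (lab2 z2)) (b (lab2 z2)) / b (lab2 z2) \<le> \<eta>"
      using ratio[OF half(2), of "a (lab1 z1)"] dab2
      by (simp add: lab min.commute abs_minus_commute)
    have vb: "\<bar>(?x - ?y) $ l\<bar> \<le> 2" "\<bar>(?y - ?x) $ l\<bar> \<le> 2" for l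
    proof -
      have "norm (?x - ?y) \<le> 2"
        using norm_triangle_ineq4[of ?x ?y] A.pos_bound[OF z1] B.pos_bound[OF z2] by linarith
      then show "\<bar>(?x - ?y) $ l\<bar> \<le> 2" "\<bar>(?y - ?x) $ l\<bar> \<le> 2"
        using component_le_norm_cart[of "?x - ?y" l] by auto
    qed
    have SA: "(\<Sum>j\<in>UNIV. min (a j) (b j) / a j * IA j) \<le>
      h * (\<kappa> * (2 * ((?x - ?y) \<bullet> b1 s z1) + 2 * \<tau>1 s z1) + 4 / \<kappa> * (\<Sum>l\<in>UNIV. b1 s z1 $ l)) + \<epsilon>1 * h + h * (cA * (K + 1)) * \<eta>"
      unfolding IA_def
      using \<delta>1(2)[rule_format, where w="\<lambda>j. min (a j) (b j) / a j" and v="?x - ?y",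
          OF z1 s0 h0 hlt(1) sT vb(1) w1 w1d \<eta>0] .
    have SB: "(\<Sum>j\<in>UNIV. min (a j) (b j) / b j * IB j) \<le>
      h * (\<kappa> * (2 * ((?y - ?x) \<bullet> b2 s z2) + 2 * \<tau>2 s z2) + 0 * (\<Sum>l\<in>UNIV. b2 s z2 $ l)) + \<epsilon>1 * h + h * (cB * (K + 1)) * \<eta>"
      unfolding IB_def
      using \<delta>2(2)[rule_format, where w="\<lambda>j. min (a j) (b j) / b j" and v="?y - ?x",
          OF z2 s0 h0 hlt(2) sT vb(2) w2 w2d \<eta>0] .
    let ?gA = "\<kappa> * (2 * ((?x - ?y) \<bullet> b1 s z1) + 2 * \<tau>1 s z1) + 4 / \<kappa> * (\<Sum>l\<in>UNIV. b1 s z1 $ l)"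
    let ?gB = "\<kappa> * (2 * ((?y - ?x) \<bullet> b2 s z2) + 2 * \<tau>2 s z2) + 0 * (\<Sum>l\<in>UNIV. b2 s z2 $ l)"
    have "?gA + ?gB = \<kappa> * (2 * ((?x - ?y) \<bullet> (b1 s z1 - b2 s z2)) + 2 * \<tau>1 s z1 + 2 * \<tau>2 s z2)
        + 4 / \<kappa> * (\<Sum>l\<in>UNIV. b1 s z1 $ l)"
    proof -
      have "(?y - ?x) \<bullet> b2 s z2 = - ((?x - ?y) \<bullet> b2 s z2)" by (simp add: inner_diff_left)
      then show ?thesis by (simp add: inner_diff_right algebra_simps)
    qed
    then have g: "?gA + ?gB \<le> \<gamma> * ?V" using drift[OF sI z1 z2 lab] by simp
    have "(\<Sum>j\<in>UNIV. min (a j) (b j) / a j * IA j) + (\<Sum>j\<in>UNIV. min (a j) (b j) / b j * IB j)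
       \<le> h * (?gA + ?gB) + 2 * (\<epsilon>1 * h) + h * ((cA + cB) * (K + 1)) * \<eta>"
      using SA SB by (simp add: algebra_simps)
    also have "\<dots> \<le> h * (\<gamma> * ?V) + 2 * (\<epsilon>1 * h) + h * ((cA + cB) * (K + 1)) * \<eta>"
      using g h0 by (intro add_right_mono mult_left_mono) auto
    finally have S: "(\<Sum>j\<in>UNIV. min (a j) (b j) / a j * IA j) + (\<Sum>j\<in>UNIV. min (a j) (b j) / b j * IB j)
       \<le> h * (\<gamma> * ?V) + (2 * (\<epsilon>1 * h) + h * ((cA + cB) * (K + 1)) * \<eta>)" by simp
    have R0: "0 \<le> 2 * (\<epsilon>1 * h) + h * ((cA + cB) * (K + 1)) * \<eta>"
      using \<epsilon>1 h0 c0 K0 \<eta>0 by simp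
    have "\<theta> * ((\<Sum>j\<in>UNIV. min (a j) (b j) / a j * IA j) + (\<Sum>j\<in>UNIV. min (a j) (b j) / b j * IB j))
       \<le> \<theta> * (h * (\<gamma> * ?V)) + \<theta> * (2 * (\<epsilon>1 * h) + h * ((cA + cB) * (K + 1)) * \<eta>)"
      using mult_left_mono[OF S \<theta>(1)] by (simp add: distrib_left)
    also have "\<theta> * (2 * (\<epsilon>1 * h) + h * ((cA + cB) * (K + 1)) * \<eta>) \<le> \<Theta> * (2 * (\<epsilon>1 * h) + h * ((cA + cB) * (K + 1)) * \<eta>)"
      using \<theta>(2) R0 by (rule mult_right_mono)
    also have "\<dots> = h * (\<epsilon> / 2) + h * (Q * h)"
      using \<Theta> by (simp add: \<epsilon>1_def Q_def \<eta>_def algebra_simps)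
    also have "Q * h \<le> \<epsilon> / 4"
    proof -
      have "h * (4 * (Q + 1)) \<le> \<epsilon> / (4 * (Q + 1)) * (4 * (Q + 1))"
        using hlt(6) Q0 unfolding \<delta>6_def by (intro mult_right_mono) auto
      also have "\<dots> = \<epsilon>" using Q0 by simp
      finally show ?thesis using h0 by (simp add: algebra_simps)
    qed
    finally have T1: "\<theta> * ((\<Sum>j\<in>UNIV. min (a j) (b j) / a j * IA j) + (\<Sum>j\<in>UNIV. min (a j) (b j) / b j * IB j))
       \<le> \<theta> * (h * (\<gamma> * ?V)) + (h * (\<epsilon> / 2) + h * (\<epsilon> / 4))" using h0 by simp
    have "(\<Sum>j\<in>UNIV. \<bar>a j - b j\<bar>) \<le> (\<Sum>j\<in>UNIV. h * \<bar>r1 s z1 j - r2 s z2 j\<bar> + 2 * \<epsilon>2 * h)"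
      by (rule sum_mono) (rule ab)
    also have "\<dots> = h * (\<Sum>j\<in>UNIV. \<bar>r1 s z1 j - r2 s z2 j\<bar>) + n * (2 * \<epsilon>2 * h)"
      by (simp add: sum.distrib sum_distrib_left n_def)
    also have "\<dots> \<le> h * (\<rho> * ?V) + n * (2 * \<epsilon>2 * h)"
      using jumps[OF sI z1 z2 lab] h0 by (intro add_right_mono mult_left_mono) auto
    finally have "2 * D * (\<Sum>j\<in>UNIV. \<bar>a j - b j\<bar>) \<le> 2 * D * (h * (\<rho> * ?V) + n * (2 * \<epsilon>2 * h))"
      using D by (intro mult_left_mono) auto
    also have "\<dots> = h * (2 * D * \<rho>) * ?V + h * (4 * D * n * \<epsilon>2)" by (simp add: algebra_simps)
    also have "h * (4 * D * n * \<epsilon>2) \<le> h * (\<epsilon> / 4)" using \<epsilon>2D h0 by (intro mult_left_mono) auto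
    finally have T2: "2 * D * (\<Sum>j\<in>UNIV. \<bar>a j - b j\<bar>) \<le> h * (2 * D * \<rho>) * ?V + h * (\<epsilon> / 4)" by simp
    have "(\<Sum>j\<in>UNIV. min (a j) (b j) / a j * (\<theta> * IA j) + min (a j) (b j) / b j * (\<theta> * IB j))
       = \<theta> * ((\<Sum>j\<in>UNIV. min (a j) (b j) / a j * IA j) + (\<Sum>j\<in>UNIV. min (a j) (b j) / b j * IB j))"
      by (simp add: sum.distrib sum_distrib_left mult_ac distrib_left)
    then have "(\<integral>z. W1 z \<partial>?M1) - (\<integral>z. W2 z \<partial>?M2) \<le> (\<theta> * ?V + e)
       + (\<theta> * (h * (\<gamma> * ?V)) + (h * (\<epsilon> / 2) + h * (\<epsilon> / 4))) + (h * (2 * D * \<rho>) * ?V + h * (\<epsilon> / 4))"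
      using coupled T1 T2 unfolding IAe IBe by linarith
    then show "(\<integral>z. W1 z \<partial>?M1) - (\<integral>z. W2 z \<partial>?M2)
      \<le> (\<theta> * (1 + h * \<gamma>) + h * (2 * D * \<rho>)) * ?V + e + h * \<epsilon>"
      by (simp add: algebra_simps)
  qed
qed

end

context markov
begin

lemma law_same_time:
  fixes F :: "'s \<Rightarrow> real"
  assumes "0 \<le> t" "t \<le> T" "z \<in> topspace X" "F \<in> borel_measurable (borel_top X)"
  shows "(\<integral>z'. F z' \<partial>law t t z) = F z"
proof -
  interpret prob_space "P t z" using P_prob[of t t z] assms by auto
  have "AE \<omega> in P t z. Z t \<omega> = z"
    using process assms by (auto simp: markov_process_def)
  then have ae: "AE \<omega> in P t z. F (Z t \<omega>) = F z" by eventually_elim auto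
  have "(\<lambda>\<omega>. F (Z t \<omega>)) \<in> borel_measurable (P t z)"
    using measurable_compose[OF path_measurable_P[of t t z] assms(4)] assms by simp
  then have "(\<integral>\<omega>. F (Z t \<omega>) \<partial>P t z) = (\<integral>\<omega>. F z \<partial>P t z)"
    by (intro integral_cong_AE ae) auto
  also have "\<dots> = F z" using prob_space by simp
  finally show ?thesis using integral_law[of t t z F] assms by simp
qed

lemma dp_value_zero_step:
  assumes "0 \<le> T" "z \<in> topspace X" "d \<in> borel_measurable (borel_top X)"
    and "\<And>s. s \<in> {0..T} \<Longrightarrow> c s \<in> borel_measurable (borel_top X)"
  shows "dp_value c d 0 m z = d z"
  using assms(2)
proof (induction m arbitrary: z)
  case (Suc m)
  have "dp_value c d 0 m \<in> borel_measurable (borel_top X)"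
    by (rule dp_value_measurable) (use assms in auto)
  then show ?case using law_same_time[of T z "dp_value c d 0 m"] Suc assms(1) by simp
qed simp

end

context coupled_markov
begin

text \<open>
  The exponential growth rate of the estimate. In a step of length \<open>h \<le> 1\<close> the factor \<open>\<theta> \<ge> \<sigma>\<close> becomes at most
  \<open>(\<theta> + h * \<sigma>) * (1 + h * \<gamma>) + 2 * D * \<rho> * h\<close>, where \<open>h * \<sigma>\<close> comes from the running cost, and this is at most
  \<open>\<theta> * (1 + h * (2 * \<gamma> + 1 + 2 * D * \<rho>))\<close>. For \<open>D\<close> the oscillation of the values over the time \<open>T\<close> is taken.
\<close>
definition growth :: "real \<Rightarrow> real" where
  "growth D = 2 * \<gamma> + 1 + 2 * (D * (1 + T)) * \<rho>"

context
  fixes c1 d1 c2 d2 and c0 :: "real \<Rightarrow> real" and d0 D0 \<sigma> :: real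
  assumes c1m: "\<And>s. s \<in> {0..T} \<Longrightarrow> c1 s \<in> borel_measurable (borel_top X1)"
    and d1m: "d1 \<in> borel_measurable (borel_top X1)"
    and c2m: "\<And>s. s \<in> {0..T} \<Longrightarrow> c2 s \<in> borel_measurable (borel_top X2)"
    and d2m: "d2 \<in> borel_measurable (borel_top X2)"
    and c1b: "\<And>s z. s \<in> {0..T} \<Longrightarrow> z \<in> topspace X1 \<Longrightarrow> \<bar>c1 s z - c0 s\<bar> \<le> D0"
    and d1b: "\<And>z. z \<in> topspace X1 \<Longrightarrow> \<bar>d1 z - d0\<bar> \<le> D0"
    and c2b: "\<And>s z. s \<in> {0..T} \<Longrightarrow> z \<in> topspace X2 \<Longrightarrow> \<bar>c2 s z - c0 s\<bar> \<le> D0"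
    and d2b: "\<And>z. z \<in> topspace X2 \<Longrightarrow> \<bar>d2 z - d0\<bar> \<le> D0"
    and cc: "\<And>s z1 z2. s \<in> {0..T} \<Longrightarrow> z1 \<in> topspace X1 \<Longrightarrow> z2 \<in> topspace X2 \<Longrightarrow> lab1 z1 = lab2 z2 \<Longrightarrow>
      \<bar>c1 s z1 - c2 s z2\<bar> \<le> \<sigma> * gap \<kappa> (pos1 z1) (pos2 z2)"
    and dd: "\<And>z1 z2. z1 \<in> topspace X1 \<Longrightarrow> z2 \<in> topspace X2 \<Longrightarrow> lab1 z1 = lab2 z2 \<Longrightarrow>
      \<bar>d1 z1 - d2 z2\<bar> \<le> \<sigma> * gap \<kappa> (pos1 z1) (pos2 z2)"
    and \<sigma>: "1 \<le> \<sigma>" and T0: "0 \<le> T" and D0: "0 \<le> D0"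
begin

lemma growth_pos: "0 \<le> growth D0"
  unfolding growth_def using rho D0 T0 by simp

text \<open>
  Induction over the steps. Both signs of the difference are covered by applying \<open>one_step\<close> also to the negative values.
\<close>
lemma dp_value_comparison:
  assumes \<epsilon>: "0 < \<epsilon>"
  shows "\<exists>\<delta>>0. \<forall>h m. \<forall>z1\<in>topspace X1. \<forall>z2\<in>topspace X2. 0 < h \<longrightarrow> h < \<delta> \<longrightarrow> real m * h \<le> T \<longrightarrow>
    lab1 z1 = lab2 z2 \<longrightarrow>
    \<bar>A.dp_value c1 d1 h m z1 - B.dp_value c2 d2 h m z2\<bar>
      \<le> \<sigma> * (1 + h * growth D0) ^ m * gap \<kappa> (pos1 z1) (pos2 z2) + real m * h * \<epsilon>"
proof -
  define D where "D = D0 * (1 + T)"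
  have D: "0 \<le> D" using D0 T0 by (simp add: D_def)
  define \<Theta> where "\<Theta> = 2 * \<sigma> * exp (growth D0 * T)"
  have \<Theta>: "0 < \<Theta>" using \<sigma> by (simp add: \<Theta>_def)
  obtain \<delta> where \<delta>: "0 < \<delta>" and step: "\<forall>s h \<theta> e \<alpha> W1 W2. \<forall>z1\<in>topspace X1. \<forall>z2\<in>topspace X2.
    0 \<le> s \<longrightarrow> 0 < h \<longrightarrow> h < \<delta> \<longrightarrow> s + h \<le> T \<longrightarrow> 0 \<le> \<theta> \<longrightarrow> \<theta> \<le> \<Theta> \<longrightarrow> 0 \<le> e \<longrightarrow> lab1 z1 = lab2 z2 \<longrightarrow>
    W1 \<in> borel_measurable (borel_top X1) \<longrightarrow> W2 \<in> borel_measurable (borel_top X2) \<longrightarrow>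
    (\<forall>z\<in>topspace X1. \<bar>W1 z - \<alpha>\<bar> \<le> D) \<longrightarrow> (\<forall>z\<in>topspace X2. \<bar>W2 z - \<alpha>\<bar> \<le> D) \<longrightarrow>
    (\<forall>z1'\<in>topspace X1. \<forall>z2'\<in>topspace X2. lab1 z1' = lab2 z2' \<longrightarrow>
       W1 z1' - W2 z2' \<le> \<theta> * gap \<kappa> (pos1 z1') (pos2 z2') + e) \<longrightarrow>
    (\<integral>z. W1 z \<partial>A.law s (s + h) z1) - (\<integral>z. W2 z \<partial>B.law s (s + h) z2)
      \<le> (\<theta> * (1 + h * \<gamma>) + h * (2 * D * \<rho>)) * gap \<kappa> (pos1 z1) (pos2 z2) + e + h * \<epsilon>"
    using one_step[OF \<epsilon> D \<Theta>] by (elim exE conjE) (rule that)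
  have main: "\<bar>A.dp_value c1 d1 h m z1 - B.dp_value c2 d2 h m z2\<bar>
      \<le> \<sigma> * (1 + h * growth D0) ^ m * gap \<kappa> (pos1 z1) (pos2 z2) + real m * h * \<epsilon>"
    if h: "0 < h" "h < \<delta>" "h \<le> 1" "real m * h \<le> T"
      and z: "z1 \<in> topspace X1" "z2 \<in> topspace X2" "lab1 z1 = lab2 z2" for h m z1 z2
    using h(4) z
  proof (induction m arbitrary: z1 z2)
    case 0 then show ?case using dd by simp
  next
    case (Suc m)
    have le: "real m * h \<le> T" "0 \<le> real m * h" using Suc.prems(1) h(1) by (auto simp: algebra_simps)
    define s where "s = T - real (Suc m) * h"
    have s: "0 \<le> s" "s + h \<le> T" "s + h = T - real m * h"
      using Suc.prems(1) le by (auto simp: s_def algebra_simps)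
    have uI: "T - real m * h \<in> {0..T}" using le by auto
    define W1 where "W1 z = h * c1 (T - real m * h) z + A.dp_value c1 d1 h m z" for z
    define W2 where "W2 z = h * c2 (T - real m * h) z + B.dp_value c2 d2 h m z" for z
    have V1: "A.dp_value c1 d1 h (Suc m) z1 = (\<integral>z. W1 z \<partial>A.law s (s + h) z1)"
      and V2: "B.dp_value c2 d2 h (Suc m) z2 = (\<integral>z. W2 z \<partial>B.law s (s + h) z2)"
      unfolding s(3) W1_def W2_def by (simp_all add: s_def)
    have [measurable]: "A.dp_value c1 d1 h m \<in> borel_measurable (borel_top X1)"
      by (rule A.dp_value_measurable) (use h le c1m d1m in auto)
    have [measurable]: "B.dp_value c2 d2 h m \<in> borel_measurable (borel_top X2)"
      by (rule B.dp_value_measurable) (use h le c2m d2m in auto)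
    have [measurable]: "c1 (T - real m * h) \<in> borel_measurable (borel_top X1)"
      "c2 (T - real m * h) \<in> borel_measurable (borel_top X2)"
      using c1m[OF uI] c2m[OF uI] by auto
    have Wm: "W1 \<in> borel_measurable (borel_top X1)" "W2 \<in> borel_measurable (borel_top X2)"
      unfolding W1_def W2_def by measurable
    define \<alpha> where "\<alpha> = h * c0 (T - real m * h) + (d0 + (\<Sum>k<m. h * c0 (T - real k * h)))"
    have DS: "h * D0 + D0 * (1 + real m * h) \<le> D"
    proof -
      have "D0 * (1 + real (Suc m) * h) \<le> D0 * (1 + T)"
        using Suc.prems(1) D0 by (intro mult_left_mono) auto
      then show ?thesis by (simp add: D_def algebra_simps)
    qed
    have hc: "\<bar>h * x - h * y\<bar> \<le> h * w" if "\<bar>x - y\<bar> \<le> w" for x y w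
      using that h(1) by (simp add: abs_mult flip: right_diff_distrib)
    have W1b: "\<bar>W1 z - \<alpha>\<bar> \<le> D" if z: "z \<in> topspace X1" for z
    proof -
      have "\<bar>A.dp_value c1 d1 h m z - (d0 + (\<Sum>k<m. h * c0 (T - real k * h)))\<bar> \<le> D0 * (1 + real m * h)"
        by (rule A.dp_value_bound) (use h le c1m d1m c1b d1b z in auto)
      then show ?thesis using hc[OF c1b[OF uI z]] DS unfolding W1_def \<alpha>_def by linarith
    qed
    have W2b: "\<bar>W2 z - \<alpha>\<bar> \<le> D" if z: "z \<in> topspace X2" for z
    proof -
      have "\<bar>B.dp_value c2 d2 h m z - (d0 + (\<Sum>k<m. h * c0 (T - real k * h)))\<bar> \<le> D0 * (1 + real m * h)"
        by (rule B.dp_value_bound) (use h le c2m d2m c2b d2b z in auto)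
      then show ?thesis using hc[OF c2b[OF uI z]] DS unfolding W2_def \<alpha>_def by linarith
    qed
    define \<phi> where "\<phi> = \<sigma> * (1 + h * growth D0) ^ m"
    define \<theta> where "\<theta> = \<phi> + h * \<sigma>"
    define e where "e = real m * h * \<epsilon>"
    have e0: "0 \<le> e" using le \<epsilon> by (simp add: e_def)
    have \<phi>1: "\<sigma> \<le> \<phi>"
      using \<sigma> h growth_pos by (simp add: \<phi>_def)
    have \<phi>2: "\<phi> \<le> \<sigma> * exp (growth D0 * T)"
    proof -
      have "(1 + h * growth D0) ^ m \<le> exp (h * growth D0) ^ m"
        using h growth_pos by (intro power_mono) auto
      also have "\<dots> = exp (growth D0 * (real m * h))" by (simp add: exp_of_nat_mult[symmetric] mult_ac)
      also have "\<dots> \<le> exp (growth D0 * T)" using growth_pos le by (simp add: mult_left_mono)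
      finally show ?thesis using \<sigma> unfolding \<phi>_def by (intro mult_left_mono) auto
    qed
    have hs: "h * \<sigma> \<le> 1 * \<phi>" using h \<sigma> \<phi>1 by (intro mult_mono) auto
    have \<theta>0: "0 \<le> \<theta>" "\<theta> \<le> \<Theta>"
      using \<sigma> \<phi>1 \<phi>2 h hs by (auto simp: \<theta>_def \<Theta>_def)
    have Wdiff: "\<bar>W1 z1' - W2 z2'\<bar> \<le> \<theta> * gap \<kappa> (pos1 z1') (pos2 z2') + e"
      if z': "z1' \<in> topspace X1" "z2' \<in> topspace X2" "lab1 z1' = lab2 z2'" for z1' z2'
    proof -
      have "\<bar>h * c1 (T - real m * h) z1' - h * c2 (T - real m * h) z2'\<bar>
         \<le> h * (\<sigma> * gap \<kappa> (pos1 z1') (pos2 z2'))"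
        by (rule hc[OF cc[OF uI z']])
      moreover have "\<bar>A.dp_value c1 d1 h m z1' - B.dp_value c2 d2 h m z2'\<bar>
        \<le> \<phi> * gap \<kappa> (pos1 z1') (pos2 z2') + e"
        unfolding \<phi>_def e_def by (rule Suc.IH[OF le(1) z'])
      ultimately have "\<bar>W1 z1' - W2 z2'\<bar> \<le> h * (\<sigma> * gap \<kappa> (pos1 z1') (pos2 z2')) + (\<phi> * gap \<kappa> (pos1 z1') (pos2 z2') + e)"
        unfolding W1_def W2_def by linarith
      then show ?thesis by (simp add: \<theta>_def algebra_simps)
    qed
    let ?V = "gap \<kappa> (pos1 z1) (pos2 z2)"
    have V0: "0 \<le> ?V" using gap_pos[OF Suc.prems(2), of "pos2 z2"] kappa by (smt (verit) divide_nonneg_pos)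
    have up: "(\<integral>z. W1 z \<partial>A.law s (s + h) z1) - (\<integral>z. W2 z \<partial>B.law s (s + h) z2)
      \<le> (\<theta> * (1 + h * \<gamma>) + h * (2 * D * \<rho>)) * ?V + e + h * \<epsilon>"
      by (rule step[rule_format, OF Suc.prems(2,3) s(1) h(1,2) s(2) \<theta>0 e0 Suc.prems(4) Wm W1b W2b])
         (use Wdiff in \<open>auto simp: abs_le_iff\<close>)
    have "(\<integral>z. - W1 z \<partial>A.law s (s + h) z1) - (\<integral>z. - W2 z \<partial>B.law s (s + h) z2)
      \<le> (\<theta> * (1 + h * \<gamma>) + h * (2 * D * \<rho>)) * ?V + e + h * \<epsilon>"
    proof (rule step[rule_format, OF Suc.prems(2,3) s(1) h(1,2) s(2) \<theta>0 e0 Suc.prems(4), where \<alpha>="- \<alpha>"])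
      show "\<bar>- W1 z - - \<alpha>\<bar> \<le> D" if "z \<in> topspace X1" for z using W1b[OF that] by linarith
      show "\<bar>- W2 z - - \<alpha>\<bar> \<le> D" if "z \<in> topspace X2" for z using W2b[OF that] by linarith
      show "- W1 z1' - - W2 z2' \<le> \<theta> * gap \<kappa> (pos1 z1') (pos2 z2') + e"
        if "z1' \<in> topspace X1" "z2' \<in> topspace X2" "lab1 z1' = lab2 z2'" for z1' z2'
        using Wdiff[OF that] by linarith
    qed (use Wm in auto)
    then have "\<bar>(\<integral>z. W1 z \<partial>A.law s (s + h) z1) - (\<integral>z. W2 z \<partial>B.law s (s + h) z2)\<bar>
      \<le> (\<theta> * (1 + h * \<gamma>) + h * (2 * D * \<rho>)) * ?V + e + h * \<epsilon>" using up by simp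
    also have "(\<theta> * (1 + h * \<gamma>) + h * (2 * D * \<rho>)) * ?V \<le> (\<phi> * (1 + h * growth D0)) * ?V"
    proof (rule mult_right_mono[OF _ V0])
      have "h * \<sigma> * (1 + h * \<gamma>) \<le> h * \<phi> * (1 + 1 * \<gamma>)"
        using h \<phi>1 \<sigma> rho by (intro mult_mono add_left_mono mult_right_mono mult_left_mono) auto
      moreover have "h * (2 * D * \<rho>) * 1 \<le> h * (2 * D * \<rho>) * \<phi>"
        using \<phi>1 \<sigma> h D rho by (intro mult_left_mono) auto
      ultimately have "(\<phi> + h * \<sigma>) * (1 + h * \<gamma>) + h * (2 * D * \<rho>)
         \<le> \<phi> * (1 + h * \<gamma>) + h * \<phi> * (1 + \<gamma>) + h * (2 * D * \<rho>) * \<phi>"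
        by (simp add: algebra_simps)
      also have "\<dots> = \<phi> * (1 + h * growth D0)"
        unfolding growth_def D_def[symmetric] by (simp add: algebra_simps)
      finally show "\<theta> * (1 + h * \<gamma>) + h * (2 * D * \<rho>) \<le> \<phi> * (1 + h * growth D0)"
        unfolding \<theta>_def .
    qed
    finally show ?case unfolding V1 V2 by (simp add: \<phi>_def e_def algebra_simps)
  qed
  show ?thesis
    by (rule exI[of _ "min \<delta> 1"]) (use \<delta> main in auto)
qed

lemma expected_cost_comparison:
  assumes t: "0 \<le> t" "t \<le> T"
    and c0b: "\<And>s. s \<in> {0..T} \<Longrightarrow> \<bar>c0 s\<bar> \<le> C0"
    and rc1: "\<And>\<omega> s. \<omega> \<in> space \<Omega>1 \<Longrightarrow> s \<in> {0..<T} \<Longrightarrow>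
      ((\<lambda>r. c1 r (Z1 r \<omega>)) \<longlongrightarrow> c1 s (Z1 s \<omega>)) (at_right s)"
    and rc2: "\<And>\<omega> s. \<omega> \<in> space \<Omega>2 \<Longrightarrow> s \<in> {0..<T} \<Longrightarrow>
      ((\<lambda>r. c2 r (Z2 r \<omega>)) \<longlongrightarrow> c2 s (Z2 s \<omega>)) (at_right s)"
    and z: "z1 \<in> topspace X1" "z2 \<in> topspace X2" "lab1 z1 = lab2 z2"
  shows "\<bar>expected_cost T P1 Z1 c1 d1 t z1 - expected_cost T P2 Z2 c2 d2 t z2\<bar>
    \<le> \<sigma> * exp (growth D0 * T) * gap \<kappa> (pos1 z1) (pos2 z2)"
proof -
  define C where "C = D0 + (max C0 \<bar>d0\<bar>)"
  have b: "\<bar>c1 s z\<bar> \<le> C" if "s \<in> {0..T}" "z \<in> topspace X1" for s z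
    using c1b[OF that] c0b[OF that(1)] unfolding C_def by linarith
  have b': "\<bar>d1 z\<bar> \<le> C" if "z \<in> topspace X1" for z
    using d1b[OF that] unfolding C_def by linarith
  have b2: "\<bar>c2 s z\<bar> \<le> C" if "s \<in> {0..T}" "z \<in> topspace X2" for s z
    using c2b[OF that] c0b[OF that(1)] unfolding C_def by linarith
  have b2': "\<bar>d2 z\<bar> \<le> C" if "z \<in> topspace X2" for z
    using d2b[OF that] unfolding C_def by linarith
  let ?V = "gap \<kappa> (pos1 z1) (pos2 z2)"
  have V0: "0 \<le> ?V" using gap_pos[OF z(1), of "pos2 z2"] kappa by (smt (verit) divide_nonneg_pos)
  have l1: "(\<lambda>n. A.dp_value c1 d1 ((T - t) / Suc n) (Suc n) z1) \<longlonglongrightarrow> expected_cost T P1 Z1 c1 d1 t z1"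
    by (rule A.expected_cost_dp_limit[OF t c1m d1m b b' rc1 z(1)])
  have l2: "(\<lambda>n. B.dp_value c2 d2 ((T - t) / Suc n) (Suc n) z2) \<longlonglongrightarrow> expected_cost T P2 Z2 c2 d2 t z2"
    by (rule B.expected_cost_dp_limit[OF t c2m d2m b2 b2' rc2 z(2)])
  have l: "(\<lambda>n. \<bar>A.dp_value c1 d1 ((T - t) / Suc n) (Suc n) z1 - B.dp_value c2 d2 ((T - t) / Suc n) (Suc n) z2\<bar>)
     \<longlonglongrightarrow> \<bar>expected_cost T P1 Z1 c1 d1 t z1 - expected_cost T P2 Z2 c2 d2 t z2\<bar>"
    by (intro tendsto_intros l1 l2)
  have approx: "\<bar>expected_cost T P1 Z1 c1 d1 t z1 - expected_cost T P2 Z2 c2 d2 t z2\<bar>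
    \<le> \<sigma> * exp (growth D0 * T) * ?V + T * \<epsilon>" if \<epsilon>: "0 < \<epsilon>" for \<epsilon>
  proof (cases "t < T")
    case False
    then have tT: "t = T" using t by simp
    have "(\<lambda>n. \<bar>d1 z1 - d2 z2\<bar>) \<longlonglongrightarrow> \<bar>expected_cost T P1 Z1 c1 d1 t z1 - expected_cost T P2 Z2 c2 d2 t z2\<bar>"
      using l A.dp_value_zero_step[OF T0 z(1) d1m c1m] B.dp_value_zero_step[OF T0 z(2) d2m c2m]
      unfolding tT by (simp del: A.dp_value.simps B.dp_value.simps)
    then have "\<bar>expected_cost T P1 Z1 c1 d1 t z1 - expected_cost T P2 Z2 c2 d2 t z2\<bar> = \<bar>d1 z1 - d2 z2\<bar>"
      using LIMSEQ_unique[OF tendsto_const] by metis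
    also have "\<dots> \<le> \<sigma> * 1 * ?V" using dd[OF z] by simp
    also have "\<dots> \<le> \<sigma> * exp (growth D0 * T) * ?V"
      using \<sigma> V0 growth_pos T0 by (intro mult_right_mono mult_left_mono) auto
    finally show ?thesis using \<epsilon> T0 by (simp add: add_increasing2)
  next
    case True
    obtain \<delta> where \<delta>: "0 < \<delta>" and cmp: "\<forall>h m. \<forall>z1\<in>topspace X1. \<forall>z2\<in>topspace X2. 0 < h \<longrightarrow> h < \<delta> \<longrightarrow> real m * h \<le> T \<longrightarrow>
      lab1 z1 = lab2 z2 \<longrightarrow>
      \<bar>A.dp_value c1 d1 h m z1 - B.dp_value c2 d2 h m z2\<bar>
        \<le> \<sigma> * (1 + h * growth D0) ^ m * gap \<kappa> (pos1 z1) (pos2 z2) + real m * h * \<epsilon>"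
      using dp_value_comparison[OF \<epsilon>] by (elim exE conjE) (rule that)
    have "(\<lambda>n. (T - t) / Suc n) \<longlonglongrightarrow> 0"
      using LIMSEQ_Suc[OF lim_const_over_n[of "T - t"]] by simp
    then have "eventually (\<lambda>n. (T - t) / Suc n < \<delta>) sequentially"
      using \<delta> by (rule order_tendstoD)
    then have ev: "eventually (\<lambda>n. \<bar>A.dp_value c1 d1 ((T - t) / Suc n) (Suc n) z1 - B.dp_value c2 d2 ((T - t) / Suc n) (Suc n) z2\<bar>
      \<le> \<sigma> * exp (growth D0 * T) * ?V + T * \<epsilon>) sequentially"
    proof eventually_elim
      case (elim n)
      define h where "h = (T - t) / Suc n"
      have h: "0 < h" "h < \<delta>" "real (Suc n) * h \<le> T" "real (Suc n) * h = T - t"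
        using True elim t by (auto simp: h_def)
      have "\<bar>A.dp_value c1 d1 h (Suc n) z1 - B.dp_value c2 d2 h (Suc n) z2\<bar>
        \<le> \<sigma> * (1 + h * growth D0) ^ Suc n * ?V + real (Suc n) * h * \<epsilon>"
        by (rule cmp[rule_format, OF z(1,2) h(1-3) z(3)])
      also have "real (Suc n) * h * \<epsilon> \<le> T * \<epsilon>" using h(3) \<epsilon> by (intro mult_right_mono) auto
      also have "(1 + h * growth D0) ^ Suc n \<le> exp (growth D0 * T)"
      proof -
        have "(1 + h * growth D0) ^ Suc n \<le> exp (h * growth D0) ^ Suc n"
          using h growth_pos by (intro power_mono) auto
        also have "\<dots> = exp (real (Suc n) * (h * growth D0))" by (rule exp_of_nat_mult[symmetric])
        also have "\<dots> = exp (growth D0 * (real (Suc n) * h))" by (simp only: mult_ac)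
        also have "\<dots> \<le> exp (growth D0 * T)" using growth_pos h(3) by (simp only: exp_le_cancel_iff mult_left_mono)
        finally show ?thesis .
      qed
      finally show ?case using \<sigma> V0 unfolding h_def by (simp add: mult_left_mono mult_right_mono)
    qed
    show ?thesis by (rule tendsto_upperbound[OF l ev]) simp
  qed
  show ?thesis
  proof (rule field_le_epsilon)
    fix \<epsilon> :: real assume \<epsilon>: "0 < \<epsilon>"
    have "T * (\<epsilon> / (T + 1)) \<le> \<epsilon>" using T0 \<epsilon> by (simp add: field_simps)
    then show "\<bar>expected_cost T P1 Z1 c1 d1 t z1 - expected_cost T P2 Z2 c2 d2 t z2\<bar>
      \<le> \<sigma> * exp (growth D0 * T) * ?V + \<epsilon>"
      using approx[of "\<epsilon> / (T + 1)"] \<epsilon> T0 by simp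
  qed
qed

end

end

section \<open>Short-time moments from jump rates and generators\<close>

lemma sum_UNIV_option: "(\<Sum>k\<in>UNIV. f k) = f None + (\<Sum>l\<in>UNIV. f (Some l))"
  for f :: "'m::finite option \<Rightarrow> 'c::comm_monoid_add"
  by (simp add: UNIV_option_conv sum.reindex)

context markov
begin

lemma rate_of_cong:
  assumes "rate_of \<Gamma> g"
    and "\<And>z z'. z \<in> topspace X \<Longrightarrow> z' \<in> topspace X \<Longrightarrow> \<Gamma> z z' = \<Gamma>' z z'"
    and "\<And>s z. s \<in> {0..T} \<Longrightarrow> z \<in> topspace X \<Longrightarrow> g s z = g' s z"
  shows "rate_of \<Gamma>' g'"
  unfolding rate_of_def
proof (intro allI impI)
  fix \<epsilon> :: real assume "0 < \<epsilon>"
  obtain \<delta> where \<delta>: "0 < \<delta>" "\<forall>s h. \<forall>z\<in>topspace X. 0 \<le> s \<longrightarrow> 0 < h \<longrightarrow> h < \<delta> \<longrightarrow> s + h \<le> T \<longrightarrow>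
     \<bar>(\<integral>z'. \<Gamma> z z' \<partial>law s (s + h) z) - \<Gamma> z z - h * g s z\<bar> \<le> \<epsilon> * h"
    using assms(1)[unfolded rate_of_def, THEN spec, THEN mp, OF \<open>0 < \<epsilon>\<close>] by (elim exE conjE) (rule that)
  show "\<exists>\<delta>>0. \<forall>s h. \<forall>z\<in>topspace X. 0 \<le> s \<longrightarrow> 0 < h \<longrightarrow> h < \<delta> \<longrightarrow> s + h \<le> T \<longrightarrow>
     \<bar>(\<integral>z'. \<Gamma>' z z' \<partial>law s (s + h) z) - \<Gamma>' z z - h * g' s z\<bar> \<le> \<epsilon> * h"
  proof (intro exI[of _ \<delta>] conjI \<delta>(1) allI ballI impI)
    fix s h z assume z: "z \<in> topspace X" "0 \<le> s" "0 < h" "h < \<delta>" "s + h \<le> T"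
    have "(\<integral>z'. \<Gamma>' z z' \<partial>law s (s + h) z) = (\<integral>z'. \<Gamma> z z' \<partial>law s (s + h) z)"
      by (rule Bochner_Integration.integral_cong) (use assms(2) z in auto)
    then show "\<bar>(\<integral>z'. \<Gamma>' z z' \<partial>law s (s + h) z) - \<Gamma>' z z - h * g' s z\<bar> \<le> \<epsilon> * h"
      using \<delta>(2)[rule_format, OF z] z assms(2)[of z z] assms(3)[of s z] by simp
  qed
qed

text \<open>
  A generator acts on test functions that are independent of the starting point. Centred moments are linear
  combinations of these with bounded coefficients that depend on the starting point.
\<close>
lemma rate_of_linear_combination:
  fixes F :: "'i::finite \<Rightarrow> 's \<Rightarrow> real"
  assumes F: "\<And>i. rate_of (\<lambda>_. F i) (g i)"
    and Fm: "\<And>i. F i \<in> borel_measurable (borel_top X)"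
    and Fb: "\<And>i z. z \<in> topspace X \<Longrightarrow> \<bar>F i z\<bar> \<le> C"
    and a: "\<And>i z. z \<in> topspace X \<Longrightarrow> \<bar>a i z\<bar> \<le> K"
  shows "rate_of (\<lambda>z z'. \<Sum>i\<in>UNIV. a i z * F i z') (\<lambda>s z. \<Sum>i\<in>UNIV. a i z * g i s z)"
  unfolding rate_of_def
proof (intro allI impI)
  fix \<epsilon> :: real assume \<epsilon>: "0 < \<epsilon>"
  define K' where "K' = max 0 K"
  define e where "e = \<epsilon> / (CARD('i) * K' + 1)"
  have q: "0 < CARD('i) * K' + 1" by (simp add: K'_def add_nonneg_pos)
  have e: "0 < e" using \<epsilon> q by (simp add: e_def)
  have eK: "CARD('i) * K' * e \<le> \<epsilon>"
    using q \<epsilon> by (simp add: e_def field_simps)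
  obtain \<delta> where \<delta>: "0 < \<delta>" "\<forall>i s h. \<forall>z\<in>topspace X. 0 \<le> s \<longrightarrow> 0 < h \<longrightarrow> h < \<delta> \<longrightarrow> s + h \<le> T \<longrightarrow>
     \<bar>(\<integral>z'. F i z' \<partial>law s (s + h) z) - F i z - h * g i s z\<bar> \<le> e * h"
    using rate_of_family[where \<Gamma>="\<lambda>i _. F i" and g=g, OF F e] by (elim exE conjE) (rule that)
  show "\<exists>\<delta>>0. \<forall>s h. \<forall>z\<in>topspace X. 0 \<le> s \<longrightarrow> 0 < h \<longrightarrow> h < \<delta> \<longrightarrow> s + h \<le> T \<longrightarrow>
     \<bar>(\<integral>z'. (\<Sum>i\<in>UNIV. a i z * F i z') \<partial>law s (s + h) z) - (\<Sum>i\<in>UNIV. a i z * F i z)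
       - h * (\<Sum>i\<in>UNIV. a i z * g i s z)\<bar> \<le> \<epsilon> * h"
  proof (intro exI[of _ \<delta>] conjI \<delta>(1) allI ballI impI)
    fix s h z assume z: "z \<in> topspace X" "0 \<le> s" "0 < h" "h < \<delta>" "s + h \<le> T"
    have i: "integrable (law s (s + h) z) (F i)" for i
      by (rule law_integrable[where C=C]) (use z Fm Fb in auto)
    have "(\<integral>z'. (\<Sum>i\<in>UNIV. a i z * F i z') \<partial>law s (s + h) z) = (\<Sum>i\<in>UNIV. a i z * (\<integral>z'. F i z' \<partial>law s (s + h) z))"
      using i by simp
    then have "\<bar>(\<integral>z'. (\<Sum>i\<in>UNIV. a i z * F i z') \<partial>law s (s + h) z) - (\<Sum>i\<in>UNIV. a i z * F i z)
       - h * (\<Sum>i\<in>UNIV. a i z * g i s z)\<bar>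
      = \<bar>\<Sum>i\<in>UNIV. a i z * ((\<integral>z'. F i z' \<partial>law s (s + h) z) - F i z - h * g i s z)\<bar>"
      by (simp add: sum_subtractf sum_distrib_left right_diff_distrib mult_ac)
    also have "\<dots> \<le> (\<Sum>i\<in>(UNIV::'i set). K' * (e * h))"
    proof (rule order_trans[OF sum_abs sum_mono])
      fix i
      show "\<bar>a i z * ((\<integral>z'. F i z' \<partial>law s (s + h) z) - F i z - h * g i s z)\<bar> \<le> K' * (e * h)"
        unfolding abs_mult
        by (rule mult_mono) (use a[OF z(1), of i] \<delta>(2) z in \<open>auto simp: K'_def\<close>)
    qed
    also have "\<dots> = CARD('i) * K' * e * h" by simp
    also have "\<dots> \<le> \<epsilon> * h" using eK z by (intro mult_right_mono) auto
    finally show "\<bar>(\<integral>z'. (\<Sum>i\<in>UNIV. a i z * F i z') \<partial>law s (s + h) z) - (\<Sum>i\<in>UNIV. a i z * F i z)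
       - h * (\<Sum>i\<in>UNIV. a i z * g i s z)\<bar> \<le> \<epsilon> * h" .
  qed
qed

lemma generator_rate_of:
  assumes "has_generator T X P Z D G" "(\<lambda>_. F) \<in> D"
    and Fm: "F \<in> borel_measurable (borel_top X)"
  shows "rate_of (\<lambda>_. F) (\<lambda>s z. G (\<lambda>_. F) s z)"
  unfolding rate_of_def
proof (intro allI impI)
  fix \<epsilon> :: real assume "0 < \<epsilon>"
  obtain \<delta> where \<delta>: "0 < \<delta>" "\<forall>s h. \<forall>z\<in>topspace X. 0 \<le> s \<and> 0 < h \<and> h < \<delta> \<and> s + h \<le> T \<longrightarrow>
        \<bar>((\<integral>\<omega>. F (Z (s + h) \<omega>) \<partial>P s z) - F z) / h - G (\<lambda>_. F) s z\<bar> < \<epsilon>"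
    using assms(1)[unfolded has_generator_def, rule_format, OF assms(2) \<open>0 < \<epsilon>\<close>]
    by (elim exE conjE) (rule that)
  show "\<exists>\<delta>>0. \<forall>s h. \<forall>z\<in>topspace X. 0 \<le> s \<longrightarrow> 0 < h \<longrightarrow> h < \<delta> \<longrightarrow> s + h \<le> T \<longrightarrow>
     \<bar>(\<integral>z'. F z' \<partial>law s (s + h) z) - F z - h * G (\<lambda>_. F) s z\<bar> \<le> \<epsilon> * h"
  proof (intro exI[of _ \<delta>] conjI \<delta>(1) allI ballI impI)
    fix s h z assume z: "z \<in> topspace X" "0 \<le> s" "0 < h" "h < \<delta>" "s + h \<le> T"
    have "(\<integral>\<omega>. F (Z (s + h) \<omega>) \<partial>P s z) = (\<integral>z'. F z' \<partial>law s (s + h) z)"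
      by (rule integral_law) (use z Fm in auto)
    then have lt: "\<bar>((\<integral>z'. F z' \<partial>law s (s + h) z) - F z) / h - G (\<lambda>_. F) s z\<bar> < \<epsilon>"
      using \<delta>(2)[rule_format, of z s h] z by simp
    have "(\<integral>z'. F z' \<partial>law s (s + h) z) - F z - h * G (\<lambda>_. F) s z
      = (((\<integral>z'. F z' \<partial>law s (s + h) z) - F z) / h - G (\<lambda>_. F) s z) * h"
      using z by (simp add: field_simps)
    then show "\<bar>(\<integral>z'. F z' \<partial>law s (s + h) z) - F z - h * G (\<lambda>_. F) s z\<bar> \<le> \<epsilon> * h"
      using mult_right_mono[OF less_imp_le[OF lt], of h] z by (simp add: abs_mult)
  qed
qed

text \<open>
  On a finite state space the jump rates determine the generator on all functions, since the probability of staying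
  is the complement of the others.
\<close>
lemma jump_rates_rate_of:
  assumes X: "X = discrete_topology E" and fin: "finite E" and rates: "has_jump_rates T E \<Omega> P Z r"
  shows "rate_of \<Gamma> (\<lambda>s z. \<Sum>z'\<in>E. r s z z' * (\<Gamma> z z' - \<Gamma> z z))"
  unfolding rate_of_def
proof (intro allI impI)
  fix \<epsilon> :: real assume \<epsilon>: "0 < \<epsilon>"
  have tX: "topspace X = E" by (simp add: X)
  have sX: "B \<in> sets (borel_top X)" if "B \<subseteq> E" for B
    using that by (auto simp: sets_borel_top X)
  define S where "S = (\<Sum>z\<in>E. \<Sum>z'\<in>E. \<bar>\<Gamma> z z' - \<Gamma> z z\<bar>)"
  have S0: "0 \<le> S" by (auto simp: S_def intro!: sum_nonneg)
  define e where "e = \<epsilon> / (S + 1)"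
  have e: "0 < e" using \<epsilon> S0 by (simp add: e_def)
  have eS: "e * S \<le> \<epsilon>" using S0 \<epsilon> by (simp add: e_def field_simps)
  define Q where "Q p \<delta> \<longleftrightarrow> (0 < \<delta> \<and> (fst p \<in> E \<longrightarrow> snd p \<in> E \<longrightarrow> fst p \<noteq> snd p \<longrightarrow> (\<forall>s h.
        0 \<le> s \<and> 0 < h \<and> h < \<delta> \<and> s + h \<le> T \<longrightarrow>
        \<bar>measure (P s (fst p)) {\<omega> \<in> space \<Omega>. Z (s + h) \<omega> = snd p} / h - r s (fst p) (snd p)\<bar> < e)))" for p \<delta>
  have "\<exists>\<delta>. Q p \<delta>" for p
  proof (cases "fst p \<in> E \<and> snd p \<in> E \<and> fst p \<noteq> snd p")
    case True
    then show ?thesis using rates e unfolding has_jump_rates_def Q_def by blast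
  next
    case False
    then have "Q p 1" by (auto simp: Q_def)
    then show ?thesis by blast
  qed
  then obtain d where d: "\<And>p. Q p (d p)" using choice[of Q] by blast
  define \<delta> where "\<delta> = Min (insert 1 (d ` (E \<times> E)))"
  have finp: "finite (insert 1 (d ` (E \<times> E)))" using fin by simp
  have \<delta>0: "0 < \<delta>" unfolding \<delta>_def using d by (subst Min_gr_iff[OF finp]) (auto simp: Q_def)
  have \<delta>le: "\<delta> \<le> d (z, z')" if "z \<in> E" "z' \<in> E" for z z'
    unfolding \<delta>_def using that by (intro Min_le[OF finp]) auto
  show "\<exists>\<delta>>0. \<forall>s h. \<forall>z\<in>topspace X. 0 \<le> s \<longrightarrow> 0 < h \<longrightarrow> h < \<delta> \<longrightarrow> s + h \<le> T \<longrightarrow>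
     \<bar>(\<integral>z'. \<Gamma> z z' \<partial>law s (s + h) z) - \<Gamma> z z - h * (\<Sum>z'\<in>E. r s z z' * (\<Gamma> z z' - \<Gamma> z z))\<bar> \<le> \<epsilon> * h"
  proof (intro exI[of _ \<delta>] conjI \<delta>0 allI ballI impI)
    fix s h z assume zX: "z \<in> topspace X" and sh: "0 \<le> s" "0 < h" "h < \<delta>" "s + h \<le> T"
    then have z: "z \<in> E" by (simp add: tX)
    interpret prob_space "law s (s + h) z" by (rule prob_space_law) (use zX sh in auto)
    define p where "p z' = measure (law s (s + h) z) {z'}" for z'
    have int: "(\<integral>z'. F z' \<partial>law s (s + h) z) = (\<Sum>w\<in>E. F w * p w)" for F :: "'s \<Rightarrow> real"
    proof -
      have "(\<integral>z'. F z' \<partial>law s (s + h) z) = (\<integral>z'. (\<Sum>w\<in>E. F w * indicator {w} z') \<partial>law s (s + h) z)"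
        by (rule Bochner_Integration.integral_cong) (use fin in \<open>auto simp: tX indicator_def\<close>)
      also have "\<dots> = (\<Sum>w\<in>E. \<integral>z'. F w * indicator {w} z' \<partial>law s (s + h) z)"
        by (rule Bochner_Integration.integral_sum)
           (use sX in \<open>auto intro!: integrable_mult_right integrable_real_indicator simp: emeasure_eq_measure\<close>)
      also have "\<dots> = (\<Sum>w\<in>E. F w * p w)"
        by (rule sum.cong[OF refl]) (use zX in \<open>auto simp: p_def tX Int_absorb2\<close>)
      finally show ?thesis .
    qed
    have "(\<Sum>w\<in>E. p w) = 1" using int[of "\<lambda>_. 1"] prob_space by simp
    then have "(\<integral>z'. \<Gamma> z z' \<partial>law s (s + h) z) - \<Gamma> z z = (\<Sum>w\<in>E. p w * (\<Gamma> z w - \<Gamma> z z))"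
      unfolding int by (simp add: right_diff_distrib sum_subtractf mult.commute[of "\<Gamma> _ _"] flip: sum_distrib_right)
    then have "\<bar>(\<integral>z'. \<Gamma> z z' \<partial>law s (s + h) z) - \<Gamma> z z - h * (\<Sum>z'\<in>E. r s z z' * (\<Gamma> z z' - \<Gamma> z z))\<bar>
      = \<bar>\<Sum>w\<in>E. (p w - h * r s z w) * (\<Gamma> z w - \<Gamma> z z)\<bar>"
      unfolding sum_distrib_left by (simp add: left_diff_distrib[of "p _"] sum_subtractf mult.assoc)
    also have "\<dots> \<le> (\<Sum>w\<in>E. e * h * \<bar>\<Gamma> z w - \<Gamma> z z\<bar>)"
    proof (rule order_trans[OF sum_abs sum_mono])
      fix w assume w: "w \<in> E"
      show "\<bar>(p w - h * r s z w) * (\<Gamma> z w - \<Gamma> z z)\<bar> \<le> e * h * \<bar>\<Gamma> z w - \<Gamma> z z\<bar>"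
      proof (cases "w = z")
        case False
        have "p w = measure (P s z) (Z (s + h) -` {w} \<inter> space \<Omega>)"
          unfolding p_def by (rule measure_law) (use sh zX sX w in auto)
        also have "Z (s + h) -` {w} \<inter> space \<Omega> = {\<omega> \<in> space \<Omega>. Z (s + h) \<omega> = w}" by auto
        finally have "\<bar>p w / h - r s z w\<bar> < e"
          using d[of "(z, w)"] \<delta>le[OF z w] sh z w False unfolding Q_def by auto
        then have "\<bar>p w / h - r s z w\<bar> * h \<le> e * h" using sh by (intro mult_right_mono) auto
        also have "\<bar>p w / h - r s z w\<bar> * h = \<bar>(p w / h - r s z w) * h\<bar>" using sh by (simp add: abs_mult)
        also have "(p w / h - r s z w) * h = p w - h * r s z w" using sh by (simp add: field_simps)
        finally show ?thesis unfolding abs_mult by (rule mult_right_mono) auto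
      qed simp
    qed
    also have "\<dots> = e * h * (\<Sum>w\<in>E. \<bar>\<Gamma> z w - \<Gamma> z z\<bar>)" by (simp add: sum_distrib_left)
    also have "\<dots> \<le> e * h * S"
    proof -
      have "(\<Sum>w\<in>E. \<bar>\<Gamma> z w - \<Gamma> z z\<bar>) \<le> S" unfolding S_def
        using member_le_sum[OF z, of "\<lambda>z. \<Sum>w\<in>E. \<bar>\<Gamma> z w - \<Gamma> z z\<bar>"] fin by (simp add: sum_nonneg)
      then show ?thesis using e sh by (intro mult_left_mono) auto
    qed
    also have "\<dots> \<le> \<epsilon> * h" using mult_right_mono[OF eS, of h] sh by (simp add: mult_ac)
    finally show "\<bar>(\<integral>z'. \<Gamma> z z' \<partial>law s (s + h) z) - \<Gamma> z z - h * (\<Sum>z'\<in>E. r s z z' * (\<Gamma> z z' - \<Gamma> z z))\<bar> \<le> \<epsilon> * h" .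
  qed
qed

text \<open>
  If the generator acts on the test functions \<open>of_bool (lab z = j) * p (pos z)\<close> as jumps of the label plus transport along \<open>b\<close>,
  for \<open>p\<close> among \<open>1\<close>, \<open>x\<^sub>l\<close> and \<open>|x|\<^sup>2\<close>, then the centred second moment has rate \<open>|x|\<^sup>2 r - 2 x\<bullet>x r + |x|\<^sup>2 r = 0\<close> for other labels, and
  \<open>2 x\<bullet>b - 2 x\<bullet>b\<close> is added for the present one: a flow has no quadratic variation.
\<close>
lemma labelled_markov_of_transport:
  fixes lab :: "'s \<Rightarrow> 'd::finite" and pos :: "'s \<Rightarrow> real ^ 'm::finite"
  assumes lab: "continuous_map X (discrete_topology UNIV) lab"
    and pos: "continuous_map X euclidean pos"
    and bound: "\<And>z. z \<in> topspace X \<Longrightarrow> norm (pos z) \<le> 1"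
    and A: "\<And>j. rate_of (\<lambda>_ z. of_bool (lab z = j)) (\<lambda>s z. r s z j)"
    and B: "\<And>j l. rate_of (\<lambda>_ z. of_bool (lab z = j) * pos z $ l)
      (\<lambda>s z. pos z $ l * r s z j + of_bool (lab z = j) * b s z $ l)"
    and Q: "\<And>j. rate_of (\<lambda>_ z. of_bool (lab z = j) * (norm (pos z))\<^sup>2)
      (\<lambda>s z. (norm (pos z))\<^sup>2 * r s z j + of_bool (lab z = j) * (2 * (pos z \<bullet> b s z)))"
    and coeff: "\<forall>s\<in>{0..T}. \<forall>z\<in>topspace X. \<forall>j l. \<bar>r s z j\<bar> \<le> C \<and> \<bar>b s z $ l\<bar> \<le> C"
  shows "labelled_markov T X \<Omega> P Z lab pos r b (\<lambda>_ _. 0)"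
proof -
  have lab_sets: "{z \<in> topspace X. lab z = j} \<in> sets (borel_top X)" for j
  proof -
    have "\<forall>U. openin X {z \<in> topspace X. lab z \<in> U}"
      using lab by (auto simp: continuous_map_def)
    from spec[OF this, of "{j}"] show ?thesis by (auto simp: sets_borel_top)
  qed
  have [measurable]: "(\<lambda>z. of_bool (lab z = j) :: real) \<in> borel_measurable (borel_top X)" for j
  proof -
    have [measurable]: "Measurable.pred (borel_top X) (\<lambda>z. lab z = j)"
      using lab_sets[of j] by (simp add: pred_def)
    show ?thesis unfolding of_bool_def by measurable
  qed
  have [measurable]: "pos \<in> borel_measurable (borel_top X)"
    by (rule borel_top_measurable_euclidean[OF pos])
  have [measurable]: "(\<lambda>z. pos z $ l) \<in> borel_measurable (borel_top X)" for l
    using measurable_compose[OF \<open>pos \<in> borel_measurable (borel_top X)\<close> borel_measurable_nth] .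
  have comp: "\<bar>pos z $ l\<bar> \<le> 1" if "z \<in> topspace X" for z l
    using component_le_norm_cart[of "pos z" l] bound[OF that] by linarith
  have sq: "(norm (pos z))\<^sup>2 \<le> 1" if "z \<in> topspace X" for z
    using power_mono[OF bound[OF that], of 2] by simp
  have pos_rate: "rate_of (\<lambda>z z'. of_bool (lab z' = j) * (pos z' - pos z) $ l)
       (\<lambda>s z. if lab z = j then b s z $ l else 0)" for j l
  proof (rule rate_of_cong)
    let ?F = "\<lambda>i. if i then (\<lambda>z. of_bool (lab z = j) * pos z $ l) else (\<lambda>z. of_bool (lab z = j))"
    let ?g = "\<lambda>i. if i then (\<lambda>s z. pos z $ l * r s z j + of_bool (lab z = j) * b s z $ l) else (\<lambda>s z. r s z j)"
    let ?a = "\<lambda>i z. if i then 1 else - pos z $ l"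
    show "rate_of (\<lambda>z z'. \<Sum>i\<in>UNIV. ?a i z * ?F i z') (\<lambda>s z. \<Sum>i\<in>UNIV. ?a i z * ?g i s z)"
    proof (rule rate_of_linear_combination[where C=1 and K=1])
      show "rate_of (\<lambda>_. ?F i) (?g i)" for i using A B by (cases i) auto
      show "?F i \<in> borel_measurable (borel_top X)" for i by (cases i) auto
      show "\<bar>?F i z\<bar> \<le> 1" "\<bar>?a i z\<bar> \<le> 1" if "z \<in> topspace X" for i z
        using comp[OF that] by (auto simp: of_bool_def)
    qed
    show "(\<Sum>i\<in>UNIV. ?a i z * ?F i z') = of_bool (lab z' = j) * (pos z' - pos z) $ l" for z z'
      by (simp add: UNIV_bool algebra_simps)
    show "(\<Sum>i\<in>UNIV. ?a i z * ?g i s z) = (if lab z = j then b s z $ l else 0)" for s z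
      by (simp add: UNIV_bool algebra_simps)
  qed
  have sq_rate: "rate_of (\<lambda>z z'. of_bool (lab z' = j) * (norm (pos z' - pos z))\<^sup>2)
       (\<lambda>s z. if lab z = j then 0 else 0)" for j
  proof (rule rate_of_cong)
    let ?F = "\<lambda>i :: 'm option option. case i of None \<Rightarrow> (\<lambda>z. of_bool (lab z = j) * (norm (pos z))\<^sup>2)
      | Some None \<Rightarrow> (\<lambda>z. of_bool (lab z = j)) | Some (Some l) \<Rightarrow> (\<lambda>z. of_bool (lab z = j) * pos z $ l)"
    let ?g = "\<lambda>i :: 'm option option. case i of
        None \<Rightarrow> (\<lambda>s z. (norm (pos z))\<^sup>2 * r s z j + of_bool (lab z = j) * (2 * (pos z \<bullet> b s z)))
      | Some None \<Rightarrow> (\<lambda>s z. r s z j)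
      | Some (Some l) \<Rightarrow> (\<lambda>s z. pos z $ l * r s z j + of_bool (lab z = j) * b s z $ l)"
    let ?a = "\<lambda>(i :: 'm option option) z. case i of None \<Rightarrow> 1 | Some None \<Rightarrow> (norm (pos z))\<^sup>2
      | Some (Some l) \<Rightarrow> - 2 * pos z $ l"
    show "rate_of (\<lambda>z z'. \<Sum>i\<in>UNIV. ?a i z * ?F i z') (\<lambda>s z. \<Sum>i\<in>UNIV. ?a i z * ?g i s z)"
    proof (rule rate_of_linear_combination[where C=1 and K=2])
      show "rate_of (\<lambda>_. ?F i) (?g i)" for i using A B Q by (auto split: option.split)
      show "?F i \<in> borel_measurable (borel_top X)" for i by (auto split: option.split)
      show "\<bar>?F i z\<bar> \<le> 1" if "z \<in> topspace X" for i z
        using comp[OF that] sq[OF that] by (auto split: option.split simp: of_bool_def)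
      show "\<bar>?a i z\<bar> \<le> 2" if "z \<in> topspace X" for i z
        using comp[OF that] sq[OF that] by (auto split: option.split simp: abs_mult)
    qed
    show "(\<Sum>i\<in>UNIV. ?a i z * ?F i z') = of_bool (lab z' = j) * (norm (pos z' - pos z))\<^sup>2" for z z'
      unfolding sum_UNIV_option
      by (simp add: power2_norm_eq_inner inner_diff inner_commute inner_vec_def[of "pos z'" "pos z"]
          inner_vec_def[of "pos z" "pos z'"] sum_distrib_left sum_negf algebra_simps)
    show "(\<Sum>i\<in>UNIV. ?a i z * ?g i s z) = (if lab z = j then 0 else 0)" for s z
    proof -
      have "(\<Sum>l\<in>UNIV. - 2 * pos z $ l * (pos z $ l * r s z j + of_bool (lab z = j) * b s z $ l))
        = - 2 * ((norm (pos z))\<^sup>2 * r s z j) - 2 * (of_bool (lab z = j) * (pos z \<bullet> b s z))"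
      proof -
        have "(\<Sum>l\<in>UNIV. - 2 * pos z $ l * (pos z $ l * r s z j + of_bool (lab z = j) * b s z $ l))
          = (\<Sum>l\<in>UNIV. (- 2 * r s z j) * (pos z $ l * pos z $ l)
              + (- 2 * of_bool (lab z = j)) * (pos z $ l * b s z $ l))"
          by (rule sum.cong[OF refl]) (simp add: algebra_simps)
        also have "\<dots> = (- 2 * r s z j) * (pos z \<bullet> pos z) + (- 2 * of_bool (lab z = j)) * (pos z \<bullet> b s z)"
          unfolding inner_vec_def inner_real_def by (simp only: sum.distrib sum_distrib_left)
        finally show ?thesis by (simp add: power2_norm_eq_inner)
      qed
      then show ?thesis unfolding sum_UNIV_option by simp
    qed
  qed
  show ?thesis
  proof
    show "\<exists>C. \<forall>s\<in>{0..T}. \<forall>z\<in>topspace X. \<forall>j l.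
       \<bar>r s z j\<bar> \<le> C \<and> \<bar>b s z $ l\<bar> \<le> C \<and> \<bar>0::real\<bar> \<le> C"
    proof (intro exI[of _ "max 0 C"] ballI allI)
      fix s z j l assume "s \<in> {0..T}" "z \<in> topspace X"
      then have "\<bar>r s z j\<bar> \<le> C \<and> \<bar>b s z $ l\<bar> \<le> C" using coeff by blast
      then show "\<bar>r s z j\<bar> \<le> max 0 C \<and> \<bar>b s z $ l\<bar> \<le> max 0 C \<and> \<bar>0::real\<bar> \<le> max 0 C" by auto
    qed
  qed (use lab pos bound A pos_rate sq_rate in auto)
qed

text \<open>
  The generator of the chain is given in the form \<open>form\<close>: jumps of the label at rates \<open>\<rho>\<close>, and jumps of one of \<open>N * n k\<close>
  particles in state \<open>k\<close> at rates \<open>q k j\<close>. The moments follow by inserting \<open>1\<close>, the centred coordinates and the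
  centred square.
\<close>
lemma labelled_markov_of_jumps:
  fixes lab :: "'s \<Rightarrow> 'd::finite" and pos :: "'s \<Rightarrow> real ^ 'm::finite" and N :: nat
  assumes X: "X = discrete_topology E" and fin: "finite E"
    and rates: "has_jump_rates T E \<Omega> P Z rt" and N: "0 < N"
    and bound: "\<And>z. z \<in> E \<Longrightarrow> norm (pos z) \<le> 1"
    and form: "\<And>s z F. s \<in> {0..T} \<Longrightarrow> z \<in> E \<Longrightarrow>
      (\<Sum>z'\<in>E. rt s z z' * (F (lab z') (pos z') - F (lab z) (pos z) :: real)) =
      (\<Sum>j\<in>UNIV. \<rho> s z j * (F j (pos z) - F (lab z) (pos z)))
      + (\<Sum>k\<in>UNIV. \<Sum>j\<in>UNIV - {k}. real N * n z k * q s z k j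
           * (F (lab z) (pos z + (1 / real N) *\<^sub>R jump_vec k j) - F (lab z) (pos z)))"
    and rows: "\<And>s z. s \<in> {0..T} \<Longrightarrow> z \<in> E \<Longrightarrow> (\<Sum>j\<in>UNIV. \<rho> s z j) = 0"
    and coeff: "\<And>s z k j i. s \<in> {0..T} \<Longrightarrow> z \<in> E \<Longrightarrow> \<bar>\<rho> s z i\<bar> \<le> C \<and> \<bar>q s z k j\<bar> \<le> C \<and> \<bar>n z k\<bar> \<le> 1"
  shows "labelled_markov T X \<Omega> P Z lab pos \<rho>
    (\<lambda>s z. \<Sum>k\<in>UNIV. \<Sum>j\<in>UNIV - {k}. (n z k * q s z k j) *\<^sub>R jump_vec k j)
    (\<lambda>s z. (\<Sum>k\<in>UNIV. \<Sum>j\<in>UNIV - {k}. n z k * q s z k j * (norm (jump_vec k j :: real ^ 'm))\<^sup>2) / real N)"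
proof
  have tX: "topspace X = E" by (simp add: X)
  have r: "rate_of (\<lambda>z z'. F z (lab z') (pos z')) (\<lambda>s z. (\<Sum>j\<in>UNIV. \<rho> s z j * (F z j (pos z) - F z (lab z) (pos z)))
      + (\<Sum>k\<in>UNIV. \<Sum>j\<in>UNIV - {k}. real N * n z k * q s z k j
           * (F z (lab z) (pos z + (1 / real N) *\<^sub>R jump_vec k j) - F z (lab z) (pos z))))" for F :: "'s \<Rightarrow> 'd \<Rightarrow> real ^ 'm \<Rightarrow> real"
    by (rule rate_of_cong[OF jump_rates_rate_of[OF X fin rates]]) (auto simp: form tX)
  show "continuous_map X (discrete_topology UNIV) lab" "continuous_map X euclidean pos"
    by (auto simp: X)
  show "norm (pos z) \<le> 1" if "z \<in> topspace X" for z using bound that by (simp add: tX)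
  show "rate_of (\<lambda>z z'. of_bool (lab z' = j)) (\<lambda>s z. \<rho> s z j)" for j
  proof (rule rate_of_cong[OF r[of "\<lambda>z j' p. of_bool (j' = j)"]])
    fix s z assume sz: "s \<in> {0..T}" "z \<in> topspace X"
    have "(\<Sum>j'\<in>UNIV. \<rho> s z j' * (of_bool (j' = j) - of_bool (lab z = j)))
      = (\<Sum>j'\<in>UNIV. \<rho> s z j' * of_bool (j' = j)) - (\<Sum>j'\<in>UNIV. \<rho> s z j') * of_bool (lab z = j)"
      by (simp add: right_diff_distrib sum_subtractf sum_distrib_right)
    also have "\<dots> = \<rho> s z j" using rows sz by (simp add: tX of_bool_def if_distrib cong: if_cong)
    finally show "(\<Sum>j'\<in>UNIV. \<rho> s z j' * (of_bool (j' = j) - of_bool (lab z = j)))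
      + (\<Sum>k\<in>UNIV. \<Sum>j'\<in>UNIV - {k}. real N * n z k * q s z k j' * (of_bool (lab z = j) - of_bool (lab z = j))) = \<rho> s z j"
      by simp
  qed simp
  show "rate_of (\<lambda>z z'. of_bool (lab z' = j) * (pos z' - pos z) $ l)
       (\<lambda>s z. if lab z = j then (\<Sum>k\<in>UNIV. \<Sum>j\<in>UNIV - {k}. (n z k * q s z k j) *\<^sub>R jump_vec k j) $ l else 0)" for j l
    by (rule rate_of_cong[OF r[of "\<lambda>z j' p. of_bool (j' = j) * (p - pos z) $ l"]])
       (use N in \<open>auto simp: sum_component intro!: sum.cong\<close>)
  show "rate_of (\<lambda>z z'. of_bool (lab z' = j) * (norm (pos z' - pos z))\<^sup>2)
       (\<lambda>s z. if lab z = j then (\<Sum>k\<in>UNIV. \<Sum>j\<in>UNIV - {k}. n z k * q s z k j * (norm (jump_vec k j :: real ^ 'm))\<^sup>2) / real N else 0)" for j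
    by (rule rate_of_cong[OF r[of "\<lambda>z j' p. of_bool (j' = j) * (norm (p - pos z))\<^sup>2"]])
       (use N in \<open>auto simp: sum_divide_distrib power_divide power2_eq_square intro!: sum.cong\<close>)
  show "\<exists>C. \<forall>s\<in>{0..T}. \<forall>z\<in>topspace X. \<forall>j l. \<bar>\<rho> s z j\<bar> \<le> C
     \<and> \<bar>(\<Sum>k\<in>UNIV. \<Sum>j\<in>UNIV - {k}. (n z k * q s z k j) *\<^sub>R jump_vec k j :: real ^ 'm) $ l\<bar> \<le> C
     \<and> \<bar>(\<Sum>k\<in>UNIV. \<Sum>j\<in>UNIV - {k}. n z k * q s z k j * (norm (jump_vec k j :: real ^ 'm))\<^sup>2) / real N\<bar> \<le> C"
  proof -
    have nq: "\<bar>n z k * q s z k j\<bar> \<le> \<bar>C\<bar>" if "s \<in> {0..T}" "z \<in> E" for s z k j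
      using mult_mono[of "\<bar>n z k\<bar>" 1 "\<bar>q s z k j\<bar>" "\<bar>C\<bar>"] coeff[OF that, of undefined k j] by (simp add: abs_mult)
    let ?J = "\<lambda>k j. norm (jump_vec k j :: real ^ 'm)"
    define C1 where "C1 = (\<Sum>k\<in>UNIV. \<Sum>j\<in>UNIV - {k :: 'm option}. \<bar>C\<bar> * ?J k j)"
    define C2 where "C2 = (\<Sum>k\<in>UNIV. \<Sum>j\<in>UNIV - {k :: 'm option}. \<bar>C\<bar> * (?J k j)\<^sup>2)"
    have C12: "0 \<le> C1" "0 \<le> C2" by (auto simp: C1_def C2_def intro!: sum_nonneg)
    show ?thesis
    proof (intro exI[of _ "\<bar>C\<bar> + C1 + C2"] ballI allI conjI)
      fix s z j l assume sz: "s \<in> {0..T}" "z \<in> topspace X"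
      then have z: "z \<in> E" by (simp add: tX)
      show "\<bar>\<rho> s z j\<bar> \<le> \<bar>C\<bar> + C1 + C2" using coeff[OF sz(1) z, of j] C12 by force
      have "\<bar>(\<Sum>k\<in>UNIV. \<Sum>j\<in>UNIV - {k}. (n z k * q s z k j) *\<^sub>R jump_vec k j :: real ^ 'm) $ l\<bar>
        \<le> norm (\<Sum>k\<in>UNIV. \<Sum>j\<in>UNIV - {k}. (n z k * q s z k j) *\<^sub>R jump_vec k j :: real ^ 'm)"
        by (rule component_le_norm_cart)
      also have "\<dots> \<le> C1" unfolding C1_def
      proof (rule sum_norm_le)
        fix k
        show "norm (\<Sum>j\<in>UNIV - {k}. (n z k * q s z k j) *\<^sub>R jump_vec k j :: real ^ 'm)
          \<le> (\<Sum>j\<in>UNIV - {k}. \<bar>C\<bar> * ?J k j)"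
        proof (rule sum_norm_le)
          fix j
          show "norm ((n z k * q s z k j) *\<^sub>R jump_vec k j :: real ^ 'm) \<le> \<bar>C\<bar> * ?J k j"
            unfolding norm_scaleR by (rule mult_right_mono[OF nq[OF sz(1) z]]) simp
        qed
      qed
      finally show "\<bar>(\<Sum>k\<in>UNIV. \<Sum>j\<in>UNIV - {k}. (n z k * q s z k j) *\<^sub>R jump_vec k j :: real ^ 'm) $ l\<bar> \<le> \<bar>C\<bar> + C1 + C2"
        using C12 by linarith
      have "\<bar>(\<Sum>k\<in>UNIV. \<Sum>j\<in>UNIV - {k}. n z k * q s z k j * (?J k j)\<^sup>2) / real N\<bar>
        \<le> \<bar>(\<Sum>k\<in>UNIV. \<Sum>j\<in>UNIV - {k}. n z k * q s z k j * (?J k j)\<^sup>2)\<bar> / 1"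
        unfolding abs_divide by (rule divide_left_mono) (use N in auto)
      also have "\<dots> \<le> C2" unfolding C2_def div_by_1
      proof (intro order_trans[OF sum_abs] sum_mono order_trans[OF sum_abs])
        fix k j
        show "\<bar>n z k * q s z k j * (?J k j)\<^sup>2\<bar> \<le> \<bar>C\<bar> * (?J k j)\<^sup>2"
          using mult_right_mono[OF nq[OF sz(1) z, of k j], of "(?J k j)\<^sup>2"] by (simp add: abs_mult)
      qed
      finally show "\<bar>(\<Sum>k\<in>UNIV. \<Sum>j\<in>UNIV - {k}. n z k * q s z k j * (?J k j)\<^sup>2) / real N\<bar> \<le> \<bar>C\<bar> + C1 + C2"
        using C12 by linarith
    qed
  qed
qed

end

section \<open>Masses on the simplex and on the grid\<close>

lemma mass_simps [simp]: "mass x None = 1 - (\<Sum>l\<in>UNIV. x $ l)" "mass x (Some l) = x $ l"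
  by (simp_all add: mass_def)

lemma sum_mass: "(\<Sum>k\<in>UNIV. mass x k) = 1"
  by (simp add: sum_UNIV_option)

lemma mass_nonneg: "x \<in> simplex_set \<Longrightarrow> 0 \<le> mass x k"
  by (cases k) (auto simp: simplex_set_def)

lemma mass_le_1:
  assumes "x \<in> simplex_set" shows "mass x k \<le> 1"
  using member_le_sum[of k UNIV "mass x"] mass_nonneg[OF assms] sum_mass[of x] by simp

lemma norm_le_1_of_sum_le_1:
  fixes x :: "real ^ 'm::finite"
  assumes "\<And>l. 0 \<le> x $ l" "(\<Sum>l\<in>UNIV. x $ l) \<le> 1"
  shows "norm x \<le> 1"
  using norm_le_l1_cart[of x] assms by simp

lemma simplex_norm: "x \<in> simplex_set \<Longrightarrow> norm x \<le> 1"
  by (rule norm_le_1_of_sum_le_1) (auto simp: simplex_set_def)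

lemma unit_vec_nth: "unit_vec k $ l = of_bool (k = Some l)"
  by (cases k) (auto simp: unit_vec_def axis_def)

lemma jump_vec_nth: "jump_vec k j $ l = of_bool (j = Some l) - of_bool (k = Some l)"
  by (simp add: jump_vec_def unit_vec_nth)

lemma sum_unit_vec: "(\<Sum>l\<in>UNIV. (unit_vec k :: real ^ 'm::finite) $ l) = of_bool (k \<noteq> None)"
  by (cases k) (simp_all add: unit_vec_nth of_bool_def)

lemma norm_unit_vec: "norm (unit_vec k :: real ^ 'm::finite) \<le> 1"
  by (cases k) (simp_all add: unit_vec_def norm_axis_1)

lemma norm_jump_vec: "(norm (jump_vec k j :: real ^ 'm::finite))\<^sup>2 \<le> 2"
proof -
  let ?a = "unit_vec j :: real ^ 'm" and ?b = "unit_vec k :: real ^ 'm"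
  have "0 \<le> ?b \<bullet> ?a" unfolding inner_vec_def by (auto simp: unit_vec_nth intro!: sum_nonneg)
  then have "(norm (?a - ?b))\<^sup>2 \<le> (norm ?a)\<^sup>2 + (norm ?b)\<^sup>2"
    unfolding power2_norm_eq_inner by (simp add: inner_diff inner_commute)
  also have "(norm ?a)\<^sup>2 \<le> 1" using power_mono[OF norm_unit_vec[of j], of 2] by simp
  also have "(norm ?b)\<^sup>2 \<le> 1" using power_mono[OF norm_unit_vec[of k], of 2] by simp
  finally show ?thesis by (simp add: jump_vec_def)
qed

lemma mass_jump: "mass (x + a *\<^sub>R jump_vec k j) i = mass x i + a * (of_bool (i = j) - of_bool (i = k))"
proof (cases i)
  case None
  have "(\<Sum>l\<in>UNIV. jump_vec k j $ l) = of_bool (j \<noteq> None) - (of_bool (k \<noteq> None) :: real)"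
    by (simp add: jump_vec_def sum_subtractf sum_unit_vec)
  then show ?thesis using None
    by (simp add: sum.distrib flip: sum_distrib_left) (auto simp: of_bool_def algebra_simps)
qed (auto simp: jump_vec_nth)

lemma grid_iff_mass:
  fixes x :: "real ^ 'm::finite"
  assumes N: "0 < N"
  shows "x \<in> simplex_grid N \<longleftrightarrow> (\<exists>c :: 'm option \<Rightarrow> nat. \<forall>k. mass x k = real (c k) / real N)"
proof
  assume "x \<in> simplex_grid N"
  then obtain n :: "'m \<Rightarrow> nat" where n: "\<And>l. x $ l = real (n l) / real N" "(\<Sum>l\<in>UNIV. n l) \<le> N"
    by (auto simp: simplex_grid_def)
  have "mass x k = real ((\<lambda>k. case k of None \<Rightarrow> N - (\<Sum>l\<in>UNIV. n l) | Some l \<Rightarrow> n l) k) / real N" for k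
    using n N by (cases k) (auto simp: of_nat_diff field_simps sum_distrib_left)
  then show "\<exists>c. \<forall>k. mass x k = real (c k) / real N" by blast
next
  assume "\<exists>c. \<forall>k. mass x k = real (c k) / real N"
  then obtain c where c: "\<And>k. mass x k = real (c k) / real N" by blast
  have "(\<Sum>l\<in>UNIV. x $ l) \<le> 1" using c[of None] by (simp add: field_simps) (smt (verit) N divide_nonneg_nonneg of_nat_0_le_iff)
  moreover have x: "x $ l = real (c (Some l)) / real N" for l using c[of "Some l"] by simp
  ultimately have "real (\<Sum>l\<in>UNIV. c (Some l)) / real N \<le> 1" by (simp add: sum_divide_distrib)
  then have "real (\<Sum>l\<in>UNIV. c (Some l)) \<le> real N" using N by (simp add: field_simps)
  then have "(\<Sum>l\<in>UNIV. c (Some l)) \<le> N" by linarith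
  then show "x \<in> simplex_grid N" unfolding simplex_grid_def using x by (intro CollectI exI[of _ "\<lambda>l. c (Some l)"]) auto
qed

lemma grid_jump:
  assumes N: "0 < N" and x: "x \<in> simplex_grid N" and k: "mass x k \<noteq> 0" and kj: "k \<noteq> j"
  shows "x + (1 / real N) *\<^sub>R jump_vec k j \<in> simplex_grid N"
proof -
  obtain c where c: "\<And>k. mass x k = real (c k) / real N" using x grid_iff_mass[OF N] by blast
  have "c k \<noteq> 0" using k c[of k] by auto
  then have "mass (x + (1 / real N) *\<^sub>R jump_vec k j) i
      = real ((\<lambda>i. if i = k then c i - 1 else if i = j then c i + 1 else c i) i) / real N" for i
    unfolding mass_jump c using kj by (auto simp: of_nat_diff diff_divide_distrib add_divide_distrib Suc_leI)
  then show ?thesis unfolding grid_iff_mass[OF N]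
    by (intro exI[of _ "\<lambda>i. if i = k then c i - 1 else if i = j then c i + 1 else c i"] allI)
qed

lemma grid_subset_simplex:
  assumes "0 < N" shows "simplex_grid N \<subseteq> simplex_set"
  using assms by (auto simp: simplex_grid_def simplex_set_def simp flip: sum_divide_distrib of_nat_sum)

lemma finite_simplex_grid: "finite (simplex_grid N :: (real ^ 'm::finite) set)"
proof (rule finite_subset)
  show "simplex_grid N \<subseteq> (\<lambda>n :: 'm \<Rightarrow> nat. \<chi> l. real (n l) / real N) ` (UNIV \<rightarrow>\<^sub>E {..N})"
  proof
    fix x :: "real ^ 'm" assume "x \<in> simplex_grid N"
    then obtain n :: "'m \<Rightarrow> nat" where n: "\<And>l. x $ l = real (n l) / real N" "(\<Sum>l\<in>UNIV. n l) \<le> N"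
      by (auto simp: simplex_grid_def)
    have "n l \<le> N" for l using member_le_sum[of l UNIV n] n(2) by simp
    then have "n \<in> UNIV \<rightarrow>\<^sub>E {..N}" by auto
    moreover have "x = (\<chi> l. real (n l) / real N)" using n(1) by (simp add: vec_eq_iff)
    ultimately show "x \<in> (\<lambda>n :: 'm \<Rightarrow> nat. \<chi> l. real (n l) / real N) ` (UNIV \<rightarrow>\<^sub>E {..N})" by blast
  qed
  show "finite ((\<lambda>n :: 'm \<Rightarrow> nat. (\<chi> l. real (n l) / real N) :: real ^ 'm) ` (UNIV \<rightarrow>\<^sub>E {..N}))"
    by (intro finite_imageI finite_PiE) auto
qed

section \<open>Growth of the gap\<close>

definition mass_flow :: "('m::finite option \<Rightarrow> real) \<Rightarrow> ('m option \<Rightarrow> 'm option \<Rightarrow> real) \<Rightarrow> real ^ 'm" where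
  "mass_flow n a = (\<chi> l. \<Sum>k\<in>UNIV. n k * a k (Some l))"

text \<open>
  The zero row sums turn the losses \<open>- n l * (\<Sum>j\<noteq>l. a l j)\<close> of a state into the diagonal term \<open>n l * a l l\<close>.
\<close>
lemma sum_jumps_mass_flow:
  fixes a :: "'m::finite option \<Rightarrow> 'm option \<Rightarrow> real"
  assumes rows: "\<And>k. (\<Sum>j\<in>UNIV. a k j) = 0"
  shows "(\<Sum>k\<in>UNIV. \<Sum>j\<in>UNIV - {k}. (n k * a k j) *\<^sub>R jump_vec k j) = mass_flow n a"
proof -
  have "(\<Sum>j\<in>UNIV - {k}. (n k * a k j) *\<^sub>R jump_vec k j) $ l = n k * a k (Some l)" for k l
  proof -
    have "(\<Sum>j\<in>UNIV - {k}. (n k * a k j) *\<^sub>R jump_vec k j) = (\<Sum>j\<in>UNIV. (n k * a k j) *\<^sub>R (jump_vec k j :: real ^ 'm))"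
      by (rule sum.mono_neutral_left) (auto simp: jump_vec_def)
    then have "(\<Sum>j\<in>UNIV - {k}. (n k * a k j) *\<^sub>R jump_vec k j) $ l
      = (\<Sum>j\<in>UNIV. n k * a k j * of_bool (j = Some l)) - (\<Sum>j\<in>UNIV. a k j) * (n k * of_bool (k = Some l))"
      by (simp add: jump_vec_nth right_diff_distrib sum_subtractf sum_distrib_right sum_distrib_left mult_ac)
    then show ?thesis unfolding rows by (simp add: of_bool_def if_distrib cong: if_cong)
  qed
  then show ?thesis by (simp add: vec_eq_iff mass_flow_def)
qed

lemma Q_matrix_diag: "Q_matrix a \<Longrightarrow> a k k = - (\<Sum>j\<in>UNIV - {k}. a k j)"
  using sum.remove[of UNIV k "a k"] by (simp add: Q_matrix_def)

lemma Q_matrix_diag_nonpos: "Q_matrix a \<Longrightarrow> a k k \<le> 0"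
  using sum_nonneg[of "UNIV - {k}" "a k"] Q_matrix_diag[of a k] by (simp add: Q_matrix_def)

text \<open>
  The generator of the coupled positions applied to the gap, with \<open>a\<close> the rates of the finite game at \<open>x\<close> and \<open>b\<close> those
  of the limit at \<open>y\<close>. The diagonal of \<open>a\<close>, which contains the large rates into the state \<open>None\<close>, appears twice. In
  the drift it gives \<open>a l l * (x - y)\<^sub>l\<^sup>2 \<le> 0\<close>. In the quadratic variation it gives at most
  \<open>(4 / \<kappa>) (\<Sum>k. n k * (- a k k))\<close>, while the sum of the coordinates has the drift \<open>(\<Sum>k. n k * (- a k None))\<close>; in
  \<open>- a k k - a k None\<close> the large rate cancels for \<open>k \<noteq> None\<close>, and for \<open>k = None\<close> there is none. This explains the coefficient \<open>4 / \<kappa>\<close>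
  of the sum in the gap. The term \<open>1 / real N\<close> allows for the distinguished player.
\<close>
lemma gap_drift_bound:
  fixes x y :: "real ^ 'm::finite" and n :: "'m option \<Rightarrow> real"
  assumes N: "0 < N" and \<kappa>: "\<kappa> = sqrt (real N)"
    and Qa: "Q_matrix a" and Qb: "Q_matrix b"
    and ab: "\<And>k j. \<bar>a k j - b k j\<bar> \<le> K * (norm (x - y) + 1 / real N)"
    and R: "\<And>k l. k \<noteq> Some l \<Longrightarrow> \<bar>a k (Some l)\<bar> \<le> R" and R0: "0 \<le> R" and K0: "0 \<le> K"
    and n0: "\<And>k. 0 \<le> n k" and n1: "\<And>k. n k \<le> 1" and nsum: "(\<Sum>k\<in>UNIV. n k) \<le> 1"
    and nx: "\<And>l. n (Some l) = x $ l" and nNone: "\<bar>n None - mass x None\<bar> \<le> 1 / real N"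
    and y: "y \<in> simplex_set"
  defines "p \<equiv> real CARD('m)"
  shows "\<kappa> * (2 * ((x - y) \<bullet> (mass_flow n a - mass_flow (mass y) b))
       + 2 * ((\<Sum>k\<in>UNIV. \<Sum>j\<in>UNIV - {k}. n k * a k j * (norm (jump_vec k j :: real ^ 'm))\<^sup>2) / real N) + 2 * 0)
     + 4 / \<kappa> * (\<Sum>l\<in>UNIV. mass_flow n a $ l)
    \<le> (2 * p * (p + 1) * (p * R + R + 2 * K) + 8 * p * R) * gap \<kappa> x y"
proof -
  define v where "v = norm (x - y)"
  have v0: "0 \<le> v" by (simp add: v_def)
  have p1: "1 \<le> p" unfolding p_def by (simp add: Suc_leI)
  have N1: "1 \<le> real N" using N by simp
  have \<kappa>1: "1 \<le> \<kappa>" using N1 by (simp add: \<kappa>)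
  have \<kappa>N: "\<kappa> * \<kappa> = real N" using N by (simp add: \<kappa>)
  have iN: "1 / real N = 1 / \<kappa> * (1 / \<kappa>)" using \<kappa>N \<kappa>1 by (simp add: field_simps)
  define V where "V = gap \<kappa> x y"
  have x0: "0 \<le> (\<Sum>l\<in>UNIV. x $ l)" using n0[of "Some _"] nx by (auto intro!: sum_nonneg)
  have Vge: "\<kappa> * v\<^sup>2 + 1 / \<kappa> \<le> V"
    unfolding V_def gap_def v_def using x0 \<kappa>1 by simp
  have V1: "\<kappa> * v\<^sup>2 \<le> V" "1 / \<kappa> \<le> V" using Vge \<kappa>1 by (smt (verit) divide_nonneg_nonneg zero_le_power2 mult_nonneg_nonneg)+
  have V0: "0 \<le> V" using V1(2) \<kappa>1 by (smt (verit) divide_nonneg_nonneg)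
  have v2: "2 * v \<le> V"
  proof -
    have "0 \<le> \<kappa> * (v - 1 / \<kappa>)\<^sup>2" using \<kappa>1 by simp
    also have "\<dots> = \<kappa> * v\<^sup>2 + 1 / \<kappa> - 2 * v" using \<kappa>1 by (simp add: field_simps power2_eq_square)
    finally show ?thesis using Vge by linarith
  qed
  have nl: "\<bar>(x - y) $ l\<bar> \<le> v" for l unfolding v_def by (rule component_le_norm_cart)
  have masses: "\<bar>n k - mass y k\<bar> \<le> p * v + 1 / real N" for k
  proof (cases k)
    case None
    have "\<bar>mass x None - mass y None\<bar> = \<bar>\<Sum>l\<in>UNIV. (x - y) $ l\<bar>" by (simp add: sum_subtractf)
    also have "\<dots> \<le> (\<Sum>l\<in>(UNIV :: 'm set). v)" by (rule order_trans[OF sum_abs sum_mono]) (rule nl)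
    finally show ?thesis using nNone None by (simp add: p_def)
  next
    case (Some l)
    have "\<bar>n k - mass y k\<bar> \<le> 1 * v" using nl[of l] Some nx[of l] by simp
    also have "\<dots> \<le> p * v" using p1 v0 by (rule mult_right_mono)
    finally show ?thesis using N1 by (simp add: add_increasing2)
  qed
  define S where "S = (p * R + K) * v + (R + K) / real N"
  have S0: "0 \<le> S" using p1 R0 K0 v0 N1 by (simp add: S_def)
  have summand: "(x - y) $ l * (n k * a k (Some l) - mass y k * b k (Some l)) \<le> v * S" for l k
  proof -
    have e1: "(x - y) $ l * (n k * a k (Some l) - mass y k * b k (Some l))
       = (x - y) $ l * ((n k - mass y k) * a k (Some l)) + (x - y) $ l * (mass y k * (a k (Some l) - b k (Some l)))"
      by (simp add: algebra_simps)
    have t2: "(x - y) $ l * (mass y k * (a k (Some l) - b k (Some l))) \<le> v * (1 * (K * (v + 1 / real N)))"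
    proof -
      have "\<bar>(x - y) $ l * (mass y k * (a k (Some l) - b k (Some l)))\<bar> \<le> v * (1 * (K * (v + 1 / real N)))"
        unfolding abs_mult
        by (intro mult_mono nl) (use ab[of k "Some l"] mass_nonneg[OF y, of k] mass_le_1[OF y, of k] v0 in \<open>auto simp: v_def\<close>)
      then show ?thesis by linarith
    qed
    have t1: "(x - y) $ l * ((n k - mass y k) * a k (Some l)) \<le> v * ((p * v + 1 / real N) * R)"
    proof (cases "k = Some l")
      case True
      have "(x - y) $ l * ((n k - mass y k) * a k (Some l)) = a k k * ((x - y) $ l)\<^sup>2"
        using True nx[of l] by (simp add: power2_eq_square)
      also have "\<dots> \<le> 0" using Q_matrix_diag_nonpos[OF Qa, of k] by (simp add: mult_nonpos_nonneg)
      also have "0 \<le> v * ((p * v + 1 / real N) * R)" using v0 p1 R0 N1 by simp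
      finally show ?thesis .
    next
      case False
      have "\<bar>(x - y) $ l * ((n k - mass y k) * a k (Some l))\<bar> \<le> v * ((p * v + 1 / real N) * R)"
        unfolding abs_mult by (intro mult_mono nl masses R False) (use v0 p1 N1 in auto)
      then show ?thesis by linarith
    qed
    show ?thesis unfolding e1 using t1 t2 by (simp add: S_def algebra_simps add_divide_distrib)
  qed
  have "(x - y) \<bullet> (mass_flow n a - mass_flow (mass y) b)
     = (\<Sum>l\<in>UNIV. \<Sum>k\<in>UNIV. (x - y) $ l * (n k * a k (Some l) - mass y k * b k (Some l)))"
    unfolding inner_vec_def inner_real_def mass_flow_def
    by (simp add: sum_distrib_left sum_subtractf right_diff_distrib)
  also have "\<dots> \<le> (\<Sum>l\<in>(UNIV :: 'm set). \<Sum>k\<in>(UNIV :: 'm option set). v * S)"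
    by (intro sum_mono summand)
  also have "\<dots> = p * ((p + 1) * (v * S))" by (simp add: p_def card_option)
  finally have ip: "(x - y) \<bullet> (mass_flow n a - mass_flow (mass y) b) \<le> p * ((p + 1) * (v * S))" .
  have kS: "\<kappa> * (v * S) \<le> (p * R + R + 2 * K) * V"
  proof -
    have "\<kappa> * (v * S) = (p * R + K) * (\<kappa> * v\<^sup>2) + (R + K) * (\<kappa> * v * (1 / real N))"
      by (simp add: S_def algebra_simps power2_eq_square add_divide_distrib)
    also have "\<kappa> * v * (1 / real N) = v * (1 / \<kappa>)" using \<kappa>1 unfolding iN by simp
    also have "v * (1 / \<kappa>) \<le> v * 1" using \<kappa>1 v0 by (intro mult_left_mono) auto
    also have "v * 1 \<le> V" using v2 v0 by linarith
    finally have "\<kappa> * (v * S) \<le> (p * R + K) * (\<kappa> * v\<^sup>2) + (R + K) * V" using R0 K0 by (simp add: mult_left_mono)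
    also have "(p * R + K) * (\<kappa> * v\<^sup>2) \<le> (p * R + K) * V" using V1(1) p1 R0 K0 by (intro mult_left_mono) auto
    finally show ?thesis by (simp add: algebra_simps)
  qed
  have "\<kappa> * (2 * ((x - y) \<bullet> (mass_flow n a - mass_flow (mass y) b))) \<le> \<kappa> * (2 * (p * ((p + 1) * (v * S))))"
    using ip \<kappa>1 by (intro mult_left_mono) auto
  also have "\<dots> = 2 * p * (p + 1) * (\<kappa> * (v * S))" by (simp add: algebra_simps)
  also have "\<dots> \<le> 2 * p * (p + 1) * ((p * R + R + 2 * K) * V)"
    using kS p1 by (intro mult_left_mono) auto
  finally have part1: "\<kappa> * (2 * ((x - y) \<bullet> (mass_flow n a - mass_flow (mass y) b)))
     \<le> 2 * p * (p + 1) * (p * R + R + 2 * K) * V" by (simp add: mult.assoc)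
  have apos: "0 \<le> a k j" if "j \<noteq> k" for k j using Qa that by (auto simp: Q_matrix_def)
  have "(\<Sum>k\<in>UNIV. \<Sum>j\<in>UNIV - {k}. n k * a k j * (norm (jump_vec k j :: real ^ 'm))\<^sup>2)
     \<le> (\<Sum>k\<in>UNIV. \<Sum>j\<in>UNIV - {k}. n k * a k j * 2)"
    by (intro sum_mono mult_left_mono norm_jump_vec mult_nonneg_nonneg n0 apos) auto
  also have "\<dots> = 2 * (\<Sum>k\<in>UNIV. n k * (\<Sum>j\<in>UNIV - {k}. a k j))"
    by (simp add: sum_distrib_left mult_ac)
  also have "\<dots> = 2 * (\<Sum>k\<in>UNIV. n k * (- a k k))" using Q_matrix_diag[OF Qa] by simp
  finally have quad: "(\<Sum>k\<in>UNIV. \<Sum>j\<in>UNIV - {k}. n k * a k j * (norm (jump_vec k j :: real ^ 'm))\<^sup>2)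
     \<le> 2 * (\<Sum>k\<in>UNIV. n k * (- a k k))" .
  have rowNone: "(\<Sum>l\<in>UNIV. a k (Some l)) = - a k None" for k
    using Qa by (simp add: Q_matrix_def sum_UNIV_option eq_neg_iff_add_eq_0 add.commute)
  have flow: "(\<Sum>l\<in>UNIV. mass_flow n a $ l) = (\<Sum>k\<in>UNIV. n k * (- a k None))"
    unfolding mass_flow_def by (simp add: sum.swap[of _ UNIV] rowNone flip: sum_distrib_left)
  have diag: "- a k k - a k None \<le> 2 * p * R" for k
  proof (cases k)
    case None
    have "(\<Sum>l\<in>UNIV. a None (Some l)) \<le> (\<Sum>l\<in>(UNIV::'m set). R)"
      by (rule sum_mono) (use R[of None] in \<open>auto simp: abs_le_iff\<close>)
    then show ?thesis using None rowNone[of None] by (simp add: p_def mult.commute)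
  next
    case (Some m)
    have "- a k k - a k None = (\<Sum>l\<in>UNIV. a k (Some l)) - a k (Some m)" using rowNone[of k] Some by simp
    also have "\<dots> = (\<Sum>l\<in>UNIV - {m}. a k (Some l))" by (simp add: sum.remove[of UNIV m])
    also have "\<dots> \<le> (\<Sum>l\<in>UNIV - {m}. R)"
      by (rule sum_mono) (use R[of k] Some in \<open>auto simp: abs_le_iff\<close>)
    also have "\<dots> \<le> (\<Sum>l\<in>(UNIV::'m set). R)" by (rule sum_mono2) (use R0 in auto)
    also have "\<dots> \<le> 2 * p * R" using R0 by (simp add: p_def)
    finally show ?thesis .
  qed
  have "\<kappa> * (2 * ((\<Sum>k\<in>UNIV. \<Sum>j\<in>UNIV - {k}. n k * a k j * (norm (jump_vec k j :: real ^ 'm))\<^sup>2) / real N))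
     \<le> \<kappa> * (2 * (2 * (\<Sum>k\<in>UNIV. n k * (- a k k)) / real N))"
    using quad \<kappa>1 N1 by (intro mult_left_mono divide_right_mono) auto
  also have "\<dots> = 4 / \<kappa> * (\<Sum>k\<in>UNIV. n k * (- a k k))"
    unfolding \<kappa>N[symmetric] using \<kappa>1 by simp
  finally have "\<kappa> * (2 * ((\<Sum>k\<in>UNIV. \<Sum>j\<in>UNIV - {k}. n k * a k j * (norm (jump_vec k j :: real ^ 'm))\<^sup>2) / real N))
     + 4 / \<kappa> * (\<Sum>l\<in>UNIV. mass_flow n a $ l) \<le> 4 / \<kappa> * (\<Sum>k\<in>UNIV. n k * (- a k k)) + 4 / \<kappa> * (\<Sum>k\<in>UNIV. n k * (- a k None))"
    unfolding flow by simp
  also have "\<dots> = 4 / \<kappa> * (\<Sum>k\<in>UNIV. n k * (- a k k - a k None))"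
    by (simp add: sum_subtractf right_diff_distrib sum_negf)
  also have "\<dots> \<le> 4 / \<kappa> * (\<Sum>k\<in>UNIV. n k * (2 * p * R))"
    using \<kappa>1 by (intro mult_left_mono sum_mono diag n0) auto
  also have "\<dots> = 4 / \<kappa> * ((\<Sum>k\<in>UNIV. n k) * (2 * p * R))" by (simp only: sum_distrib_right)
  also have "\<dots> \<le> 4 / \<kappa> * (1 * (2 * p * R))"
    using \<kappa>1 nsum p1 R0 by (intro mult_left_mono mult_right_mono) auto
  also have "\<dots> = 8 * p * R * (1 / \<kappa>)" by simp
  also have "\<dots> \<le> 8 * p * R * V" using V1(2) p1 R0 by (intro mult_left_mono) auto
  finally have part2: "\<kappa> * (2 * ((\<Sum>k\<in>UNIV. \<Sum>j\<in>UNIV - {k}. n k * a k j * (norm (jump_vec k j :: real ^ 'm))\<^sup>2) / real N))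
     + 4 / \<kappa> * (\<Sum>l\<in>UNIV. mass_flow n a $ l) \<le> 8 * p * R * V" .
  have split: "\<kappa> * (2 * u + 2 * w + 2 * 0) + c = \<kappa> * (2 * u) + (\<kappa> * (2 * w) + c)" for u w c
    by (simp add: algebra_simps)
  show ?thesis unfolding V_def[symmetric] split distrib_right[where c=V]
    using part1 part2 by (rule add_mono)
qed

section \<open>The limit game as a process with label and position\<close>

lemma C1_fun_const: "C1_fun (\<lambda>t (x :: real ^ 'm::finite). c)"
  unfolding C1_fun_def
  by (rule exI[of _ "\<lambda>_. 0"]) (auto intro!: derivative_eq_intros simp: case_prod_unfold)

lemma C1_fun_coordinate: "C1_fun (\<lambda>t (x :: real ^ 'm::finite). c * x $ l)"
proof -
  have bl: "bounded_linear (\<lambda>p :: real \<times> (real ^ 'm). c * snd p $ l)"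
    by (intro bounded_linear_const_mult bounded_linear_compose[OF bounded_linear_vec_nth bounded_linear_snd])
  show ?thesis unfolding C1_fun_def
  proof (intro exI[of _ "\<lambda>_. Blinfun (\<lambda>p. c * snd p $ l)"] conjI allI)
    show "((\<lambda>(t, x). c * x $ l) has_derivative blinfun_apply (Blinfun (\<lambda>p. c * snd p $ l))) (at p)"
      for p :: "real \<times> (real ^ 'm)"
      unfolding bounded_linear_Blinfun_apply[OF bl] case_prod_unfold
      by (rule bounded_linear.has_derivative[OF bl has_derivative_ident])
  qed auto
qed

lemma C1_fun_square: "C1_fun (\<lambda>t (x :: real ^ 'm::finite). c * (norm x)\<^sup>2)"
proof -
  have bl: "bounded_linear (\<lambda>p :: real \<times> (real ^ 'm). snd p $ l)" for l
    by (rule bounded_linear_compose[OF bounded_linear_vec_nth bounded_linear_snd])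
  let ?E = "\<lambda>l. Blinfun (\<lambda>p :: real \<times> (real ^ 'm). snd p $ l)"
  have E: "blinfun_apply (?E l) p = snd p $ l" for l p
    unfolding bounded_linear_Blinfun_apply[OF bl] by (rule refl)
  let ?F = "\<lambda>p. (\<Sum>l\<in>UNIV. (2 * c * snd p $ l) *\<^sub>R ?E l)"
  show ?thesis unfolding C1_fun_def
  proof (intro exI[of _ ?F] conjI allI)
    show "continuous_on UNIV ?F" by (intro continuous_intros)
    fix p :: "real \<times> (real ^ 'm)"
    have "((\<lambda>p. c * (snd p \<bullet> snd p)) has_derivative (\<lambda>h. c * (snd p \<bullet> snd h + snd h \<bullet> snd p))) (at p)"
      by (auto intro!: derivative_eq_intros)
    moreover have "(\<lambda>h. c * (snd p \<bullet> snd h + snd h \<bullet> snd p)) = blinfun_apply (?F p)"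
    proof
      fix h :: "real \<times> (real ^ 'm)"
      have "blinfun_apply (?F p) h = (\<Sum>l\<in>UNIV. 2 * c * snd p $ l * snd h $ l)"
        by (simp add: blinfun.sum_left blinfun.scaleR_left E)
      also have "\<dots> = 2 * c * (snd p \<bullet> snd h)"
        unfolding inner_vec_def inner_real_def by (simp add: sum_distrib_left mult.assoc)
      finally show "c * (snd p \<bullet> snd h + snd h \<bullet> snd p) = blinfun_apply (?F p) h"
        by (simp add: inner_commute)
    qed
    ultimately show "((\<lambda>(t, x). c * (norm x)\<^sup>2) has_derivative blinfun_apply (?F p)) (at p)"
      by (simp add: case_prod_unfold power2_norm_eq_inner)
  qed
qed

lemma partial_x_const: "partial_x l (\<lambda>y. c) x = 0"
  by (simp add: partial_x_def)

lemma partial_x_coordinate: "partial_x l (\<lambda>y. c * y $ m) x = c * of_bool (l = m)"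
  unfolding partial_x_def
  by (rule DERIV_imp_deriv) (auto intro!: derivative_eq_intros simp: axis_def)

lemma partial_x_square: "partial_x l (\<lambda>y. c * (norm y)\<^sup>2) x = c * (2 * x $ l)"
proof -
  have "(\<lambda>r. c * (norm (x + r *\<^sub>R axis l 1))\<^sup>2) = (\<lambda>r. c * ((norm x)\<^sup>2 + 2 * r * x $ l + r * r))"
    by (auto simp: power2_norm_eq_inner inner_add inner_commute inner_axis algebra_simps)
  then show ?thesis unfolding partial_x_def
    by (simp, intro DERIV_imp_deriv) (auto intro!: derivative_eq_intros)
qed

lemma mf_transport_mass_flow:
  "mf_transport q h t i0 x = (\<Sum>l\<in>UNIV. partial_x l h x * mass_flow (mass x) (\<lambda>k j. q t k j i0 x) $ l)"
proof -
  have "mf_transport q h t i0 x =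
     (\<Sum>l\<in>UNIV. \<Sum>k\<in>UNIV. partial_x l h x * (x $ k) * q t (Some k) (Some l) i0 x)
     + (\<Sum>l\<in>UNIV. partial_x l h x * ((1 - (\<Sum>k\<in>UNIV. x $ k)) * q t None (Some l) i0 x))"
    unfolding mf_transport_def sum_distrib_left by (subst sum.swap) (simp add: mult_ac)
  also have "\<dots> = (\<Sum>l\<in>UNIV. partial_x l h x * mass_flow (mass x) (\<lambda>k j. q t k j i0 x) $ l)"
    unfolding sum.distrib[symmetric] mass_flow_def
    by (rule sum.cong[OF refl]) (simp add: sum_UNIV_option distrib_left sum_distrib_left mult_ac)
  finally show ?thesis .
qed

lemma mf_transport_const: "mf_transport q (\<lambda>y. c) t i0 x = 0"
  and mf_transport_coordinate:
    "mf_transport q (\<lambda>y. c * y $ m) t i0 x = c * mass_flow (mass x) (\<lambda>k j. q t k j i0 x) $ m"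
  and mf_transport_square:
    "mf_transport q (\<lambda>y. c * (norm y)\<^sup>2) t i0 x = c * (2 * (x \<bullet> mass_flow (mass x) (\<lambda>k j. q t k j i0 x)))"
proof -
  show "mf_transport q (\<lambda>y. c) t i0 x = 0"
    by (simp add: mf_transport_mass_flow partial_x_const)
  show "mf_transport q (\<lambda>y. c * y $ m) t i0 x = c * mass_flow (mass x) (\<lambda>k j. q t k j i0 x) $ m"
    unfolding mf_transport_mass_flow partial_x_coordinate
    by (simp add: of_bool_def if_distrib if_distribR cong: if_cong)
  show "mf_transport q (\<lambda>y. c * (norm y)\<^sup>2) t i0 x = c * (2 * (x \<bullet> mass_flow (mass x) (\<lambda>k j. q t k j i0 x)))"
    unfolding mf_transport_mass_flow partial_x_square inner_vec_def inner_real_def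
    by (simp add: sum_distrib_left mult_ac)
qed

lemma sum_jumps_zero_row:
  fixes a \<phi> :: "'k::finite \<Rightarrow> real"
  assumes "(\<Sum>j\<in>UNIV. a j) = 0"
  shows "(\<Sum>j\<in>UNIV - {i}. (\<phi> j - \<phi> i) * a j) = (\<Sum>j\<in>UNIV. \<phi> j * a j)"
proof -
  have "(\<Sum>j\<in>UNIV - {i}. (\<phi> j - \<phi> i) * a j) = (\<Sum>j\<in>UNIV. (\<phi> j - \<phi> i) * a j)"
    by (rule sum.mono_neutral_left) auto
  also have "\<dots> = (\<Sum>j\<in>UNIV. \<phi> j * a j) - \<phi> i * (\<Sum>j\<in>UNIV. a j)"
    by (simp add: left_diff_distrib sum_subtractf sum_distrib_left)
  finally show ?thesis using assms by simp
qed

lemma mass_flow_bound: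
  fixes a :: "'m::finite option \<Rightarrow> 'm option \<Rightarrow> real" and C :: real
  assumes "x \<in> simplex_set" "\<And>k j. \<bar>a k j\<bar> \<le> C"
  shows "\<bar>mass_flow (mass x) a $ l\<bar> \<le> CARD('m option) * C"
proof -
  have "\<bar>mass_flow (mass x) a $ l\<bar> \<le> (\<Sum>k\<in>(UNIV :: 'm option set). 1 * C)"
    unfolding mass_flow_def vec_lambda_beta
  proof (rule order_trans[OF sum_abs sum_mono])
    fix k show "\<bar>mass x k * a k (Some l)\<bar> \<le> 1 * C" unfolding abs_mult
      by (rule mult_mono) (use mass_nonneg[OF assms(1)] mass_le_1[OF assms(1)] assms(2) in auto)
  qed
  then show ?thesis by simp
qed

definition major_top :: "('k \<times> (real ^ 'm::finite)) topology" where
  "major_top = prod_topology (discrete_topology UNIV) (top_of_set simplex_set)"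

definition minor_top :: "('m::finite option \<times> 'k \<times> (real ^ 'm)) topology" where
  "minor_top = prod_topology (discrete_topology UNIV)
     (prod_topology (discrete_topology UNIV) (top_of_set simplex_set))"

lemma topspace_major_top: "topspace major_top = UNIV \<times> simplex_set"
  and topspace_minor_top: "topspace minor_top = UNIV \<times> UNIV \<times> simplex_set"
  by (simp_all add: major_top_def minor_top_def)

lemma major_top_continuous:
  "continuous_map major_top (discrete_topology UNIV) fst"
  "continuous_map major_top (top_of_set simplex_set) snd"
  unfolding major_top_def by (rule continuous_map_fst continuous_map_snd)+

abbreviation minor_label :: "'i \<times> 'k \<times> 'x \<Rightarrow> 'i \<times> 'k" where
  "minor_label z \<equiv> (fst z, fst (snd z))"

lemma minor_top_continuous:
  "continuous_map minor_top (discrete_topology UNIV) minor_label"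
  "continuous_map minor_top (top_of_set simplex_set) (\<lambda>z. snd (snd z))"
proof -
  have "continuous_map minor_top (prod_topology (discrete_topology UNIV) (discrete_topology UNIV)) minor_label"
    unfolding minor_top_def
    by (intro continuous_map_pairedI continuous_map_fst continuous_map_compose[OF continuous_map_snd continuous_map_fst, unfolded comp_def])
  then show "continuous_map minor_top (discrete_topology UNIV) minor_label"
    by (simp only: prod_topology_discrete_topology[symmetric] UNIV_Times_UNIV)
  show "continuous_map minor_top (top_of_set simplex_set) (\<lambda>z. snd (snd z))"
    unfolding minor_top_def
    by (rule continuous_map_compose[OF continuous_map_snd continuous_map_snd, unfolded comp_def])
qed

lemma continuous_map_simplex_euclidean:
  "continuous_map X (top_of_set simplex_set) f \<Longrightarrow> continuous_map X euclidean f"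
  by (simp add: continuous_map_in_subtopology)

text \<open>
  The label of the second game is a pair of which either the major or the minor component jumps. On the diagonal the
  two diagonal entries add up, so that the rows have sum zero.
\<close>
definition minor_label_rate ::
  "('k \<Rightarrow> 'k \<Rightarrow> real) \<Rightarrow> ('i \<Rightarrow> 'i \<Rightarrow> real) \<Rightarrow> 'i \<times> 'k \<Rightarrow> 'i \<times> 'k \<Rightarrow> real" where
  "minor_label_rate a b d e = of_bool (fst e = fst d) * a (snd d) (snd e) + of_bool (snd e = snd d) * b (fst d) (fst e)"

lemma sum_minor_label_rate:
  fixes a :: "'k::finite \<Rightarrow> 'k \<Rightarrow> real" and b :: "'i::finite \<Rightarrow> 'i \<Rightarrow> real"
  shows "(\<Sum>e\<in>UNIV. \<phi> e * minor_label_rate a b (i, i0) e)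
    = (\<Sum>j0\<in>UNIV. \<phi> (i, j0) * a i0 j0) + (\<Sum>j\<in>UNIV. \<phi> (j, i0) * b i j)"
proof -
  have "(\<Sum>e\<in>UNIV. \<phi> e * minor_label_rate a b (i, i0) e)
     = (\<Sum>j\<in>UNIV. \<Sum>j0\<in>UNIV. \<phi> (j, j0) * (of_bool (j = i) * a i0 j0 + of_bool (j0 = i0) * b i j))"
    unfolding minor_label_rate_def UNIV_Times_UNIV[symmetric] sum.cartesian_product
    by (rule sum.cong) auto
  also have "\<dots> = (\<Sum>j\<in>UNIV. \<Sum>j0\<in>UNIV. of_bool (j = i) * (\<phi> (j, j0) * a i0 j0))
      + (\<Sum>j\<in>UNIV. \<Sum>j0\<in>UNIV. of_bool (j0 = i0) * (\<phi> (j, j0) * b i j))"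
    by (simp add: distrib_left sum.distrib mult_ac)
  also have "(\<Sum>j\<in>UNIV. \<Sum>j0\<in>UNIV. of_bool (j = i) * (\<phi> (j, j0) * a i0 j0)) = (\<Sum>j0\<in>UNIV. \<phi> (i, j0) * a i0 j0)"
    by (subst sum.swap) (simp add: of_bool_def if_distrib if_distribR cong: if_cong)
  also have "(\<Sum>j\<in>UNIV. \<Sum>j0\<in>UNIV. of_bool (j0 = i0) * (\<phi> (j, j0) * b i j)) = (\<Sum>j\<in>UNIV. \<phi> (j, i0) * b i j)"
    by (simp add: of_bool_def if_distrib if_distribR cong: if_cong)
  finally show ?thesis .
qed

lemma mf_major_labelled:
  fixes q0 :: "real \<Rightarrow> 'k::finite \<Rightarrow> 'k \<Rightarrow> real ^ 'm::finite \<Rightarrow> real"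
  assumes proc: "mf_major_process T q0 q \<Omega> P Z"
    and rows: "\<And>s i0 x. s \<in> {0..T} \<Longrightarrow> x \<in> simplex_set \<Longrightarrow> (\<Sum>j0\<in>UNIV. q0 s i0 j0 x) = 0"
    and b0: "\<And>s i0 j0 x. s \<in> {0..T} \<Longrightarrow> x \<in> simplex_set \<Longrightarrow> \<bar>q0 s i0 j0 x\<bar> \<le> C"
    and b: "\<And>s k j i0 x. s \<in> {0..T} \<Longrightarrow> x \<in> simplex_set \<Longrightarrow> \<bar>q s k j i0 x\<bar> \<le> C"
  shows "labelled_markov T major_top \<Omega> P Z fst snd (\<lambda>s z j. q0 s (fst z) j (snd z))
    (\<lambda>s z. mass_flow (mass (snd z)) (\<lambda>k j. q s k j (fst z) (snd z))) (\<lambda>_ _. 0)"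
proof -
  interpret markov T major_top \<Omega> P Z
    using proc by unfold_locales (simp add: mf_major_process_def Let_def major_top_def)
  have gen: "has_generator T major_top P Z {F. \<forall>i0. C1_fun (\<lambda>t x. F t (i0, x))} (mf_major_generator q0 q)"
    using proc by (simp add: mf_major_process_def Let_def major_top_def)
  have pos: "continuous_map major_top euclidean snd"
    by (rule continuous_map_simplex_euclidean[OF major_top_continuous(2)])
  have rate: "rate_of (\<lambda>_ z. of_bool (fst z = j) * p (snd z))
      (\<lambda>s z. p (snd z) * q0 s (fst z) j (snd z) + mf_transport q (\<lambda>y. of_bool (fst z = j) * p y) s (fst z) (snd z))"
    if C1: "\<And>c. C1_fun (\<lambda>t x. c * p x)" and p: "continuous_on UNIV p" for j :: 'k and p :: "real ^ 'm \<Rightarrow> real"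
  proof (rule rate_of_cong[OF generator_rate_of[OF gen]])
    let ?F = "\<lambda>z :: 'k \<times> (real ^ 'm). of_bool (fst z = j) * p (snd z)"
    show "(\<lambda>_. ?F) \<in> {F. \<forall>i0. C1_fun (\<lambda>t x. F t (i0, x))}" using C1 by simp
    have "continuous_map major_top euclidean (\<lambda>z. p (snd z))"
      using continuous_map_compose[OF pos, of euclidean p] p by (simp add: comp_def)
    moreover have "continuous_map major_top euclidean (\<lambda>z. of_bool (fst z = j) :: real)"
      using continuous_map_compose[OF major_top_continuous(1), of euclidean "\<lambda>i. of_bool (i = j) :: real"]
      by (simp add: comp_def)
    ultimately have "continuous_map major_top euclideanreal ?F" by (intro continuous_map_real_mult)
    then show "?F \<in> borel_measurable (borel_top major_top)" by (rule borel_top_measurable_euclidean)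
    fix s z assume s: "s \<in> {0..T}" and z: "z \<in> topspace (major_top :: ('k \<times> (real ^ 'm)) topology)"
    obtain i0 x where zx: "z = (i0, x)" "x \<in> simplex_set" using z by (auto simp: topspace_major_top)
    have "(\<Sum>j0\<in>UNIV - {i0}. (of_bool (j0 = j) * p x - of_bool (i0 = j) * p x) * q0 s i0 j0 x)
      = (\<Sum>j0\<in>UNIV. of_bool (j0 = j) * p x * q0 s i0 j0 x)"
      by (rule sum_jumps_zero_row) (rule rows[OF s zx(2)])
    also have "\<dots> = p x * q0 s i0 j x" by (simp add: of_bool_def if_distrib if_distribR cong: if_cong)
    finally show "mf_major_generator q0 q (\<lambda>_. ?F) s z =
      p (snd z) * q0 s (fst z) j (snd z) + mf_transport q (\<lambda>y. of_bool (fst z = j) * p y) s (fst z) (snd z)"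
      by (simp add: mf_major_generator_def zx)
  qed simp
  let ?b = "\<lambda>s z. mass_flow (mass (snd z)) (\<lambda>k j. q s k j (fst z) (snd z))"
  show ?thesis
  proof (rule labelled_markov_of_transport[OF major_top_continuous(1) pos])
    show "norm (snd z) \<le> 1" if "z \<in> topspace (major_top :: ('k \<times> (real ^ 'm)) topology)" for z :: "'k \<times> (real ^ 'm)"
      using that simplex_norm by (auto simp: topspace_major_top)
    show "rate_of (\<lambda>_ z. of_bool (fst z = j)) (\<lambda>s z. q0 s (fst z) j (snd z))" for j
      using rate[of "\<lambda>_. 1" j] by (simp add: C1_fun_const mf_transport_const)
    show "rate_of (\<lambda>_ z. of_bool (fst z = j) * snd z $ l)
      (\<lambda>s z. snd z $ l * q0 s (fst z) j (snd z) + of_bool (fst z = j) * ?b s z $ l)" for j l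
      using rate[of "\<lambda>x. x $ l" j] by (simp add: C1_fun_coordinate mf_transport_coordinate continuous_intros)
    show "rate_of (\<lambda>_ z. of_bool (fst z = j) * (norm (snd z))\<^sup>2)
      (\<lambda>s z. (norm (snd z))\<^sup>2 * q0 s (fst z) j (snd z) + of_bool (fst z = j) * (2 * (snd z \<bullet> ?b s z)))" for j
      using rate[of "\<lambda>x. (norm x)\<^sup>2" j] by (simp add: C1_fun_square mf_transport_square continuous_intros)
    show "\<forall>s\<in>{0..T}. \<forall>z\<in>topspace major_top. \<forall>j l. \<bar>q0 s (fst z) j (snd z)\<bar> \<le> max C (CARD('m option) * C) \<and> \<bar>?b s z $ l\<bar> \<le> max C (CARD('m option) * C)"
    proof (intro ballI allI conjI)
      fix s and z :: "'k \<times> (real ^ 'm)" and j l assume s: "s \<in> {0..T}" and z: "z \<in> topspace major_top"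
      have x: "snd z \<in> simplex_set" using z by (auto simp: topspace_major_top)
      show "\<bar>q0 s (fst z) j (snd z)\<bar> \<le> max C (CARD('m option) * C)"
        using b0[OF s x, of "fst z" j] by linarith
      show "\<bar>?b s z $ l\<bar> \<le> max C (CARD('m option) * C)"
        using mass_flow_bound[OF x, of "\<lambda>k j. q s k j (fst z) (snd z)" C l, OF b[OF s x]] by linarith
    qed
  qed
qed

lemma mf_minor_labelled:
  fixes q0 :: "real \<Rightarrow> 'k::finite \<Rightarrow> 'k \<Rightarrow> real ^ 'm::finite \<Rightarrow> real"
  assumes proc: "mf_minor_process T q0 q q' \<Omega> P Z"
    and rows: "\<And>s i0 x. s \<in> {0..T} \<Longrightarrow> x \<in> simplex_set \<Longrightarrow> (\<Sum>j0\<in>UNIV. q0 s i0 j0 x) = 0"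
    and rows': "\<And>s i i0 x. s \<in> {0..T} \<Longrightarrow> x \<in> simplex_set \<Longrightarrow> (\<Sum>j\<in>UNIV. q' s i j i0 x) = 0"
    and b0: "\<And>s i0 j0 x. s \<in> {0..T} \<Longrightarrow> x \<in> simplex_set \<Longrightarrow> \<bar>q0 s i0 j0 x\<bar> \<le> C"
    and b: "\<And>s k j i0 x. s \<in> {0..T} \<Longrightarrow> x \<in> simplex_set \<Longrightarrow> \<bar>q s k j i0 x\<bar> \<le> C"
    and b': "\<And>s k j i0 x. s \<in> {0..T} \<Longrightarrow> x \<in> simplex_set \<Longrightarrow> \<bar>q' s k j i0 x\<bar> \<le> C"
  shows "labelled_markov T minor_top \<Omega> P Z minor_label (\<lambda>z. snd (snd z))
    (\<lambda>s z. minor_label_rate (\<lambda>i0 j0. q0 s i0 j0 (snd (snd z))) (\<lambda>i j. q' s i j (fst (snd z)) (snd (snd z))) (minor_label z))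
    (\<lambda>s z. mass_flow (mass (snd (snd z))) (\<lambda>k j. q s k j (fst (snd z)) (snd (snd z)))) (\<lambda>_ _. 0)"
proof -
  interpret markov T minor_top \<Omega> P Z
    using proc by unfold_locales (simp add: mf_minor_process_def Let_def minor_top_def)
  have gen: "has_generator T minor_top P Z {F. \<forall>i i0. C1_fun (\<lambda>t x. F t (i, i0, x))} (mf_minor_generator q0 q q')"
    using proc by (simp add: mf_minor_process_def Let_def minor_top_def)
  let ?pos = "\<lambda>z :: 'm option \<times> 'k \<times> (real ^ 'm). snd (snd z)"
  let ?r = "\<lambda>s z. minor_label_rate (\<lambda>i0 j0. q0 s i0 j0 (?pos z)) (\<lambda>i j. q' s i j (fst (snd z)) (?pos z)) (minor_label z)"
  have pos: "continuous_map minor_top euclidean ?pos"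
    by (rule continuous_map_simplex_euclidean[OF minor_top_continuous(2)])
  have rate: "rate_of (\<lambda>_ z. of_bool (minor_label z = d) * p (?pos z))
      (\<lambda>s z. p (?pos z) * ?r s z d + mf_transport q (\<lambda>y. of_bool (minor_label z = d) * p y) s (fst (snd z)) (?pos z))"
    if C1: "\<And>c. C1_fun (\<lambda>t x. c * p x)" and p: "continuous_on UNIV p" for d :: "'m option \<times> 'k" and p :: "real ^ 'm \<Rightarrow> real"
  proof (rule rate_of_cong[OF generator_rate_of[OF gen]])
    let ?F = "\<lambda>z :: 'm option \<times> 'k \<times> (real ^ 'm). of_bool (minor_label z = d) * p (?pos z)"
    show "(\<lambda>_. ?F) \<in> {F. \<forall>i i0. C1_fun (\<lambda>t x. F t (i, i0, x))}" using C1 by simp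
    have "continuous_map minor_top euclidean (\<lambda>z. p (?pos z))"
      using continuous_map_compose[OF pos, of euclidean p] p by (simp add: comp_def)
    moreover have "continuous_map minor_top euclidean (\<lambda>z. of_bool (minor_label z = d) :: real)"
      using continuous_map_compose[OF minor_top_continuous(1), of euclidean "\<lambda>i. of_bool (i = d) :: real"]
      by (simp add: comp_def)
    ultimately have "continuous_map minor_top euclideanreal ?F" by (intro continuous_map_real_mult)
    then show "?F \<in> borel_measurable (borel_top minor_top)" by (rule borel_top_measurable_euclidean)
    fix s z assume s: "s \<in> {0..T}" and z: "z \<in> topspace (minor_top :: ('m option \<times> 'k \<times> (real ^ 'm)) topology)"
    obtain i i0 x where zx: "z = (i, i0, x)" "x \<in> simplex_set" using z by (auto simp: topspace_minor_top)
    let ?\<phi> = "\<lambda>e. of_bool (e = d) * p x"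
    have "(\<Sum>j0\<in>UNIV - {i0}. (?\<phi> (i, j0) - ?\<phi> (i, i0)) * q0 s i0 j0 x)
        + (\<Sum>j\<in>UNIV - {i}. (?\<phi> (j, i0) - ?\<phi> (i, i0)) * q' s i j i0 x)
      = (\<Sum>j0\<in>UNIV. ?\<phi> (i, j0) * q0 s i0 j0 x) + (\<Sum>j\<in>UNIV. ?\<phi> (j, i0) * q' s i j i0 x)"
      using sum_jumps_zero_row[OF rows[OF s zx(2), of i0], where \<phi>="\<lambda>j0. ?\<phi> (i, j0)" and i=i0]
        sum_jumps_zero_row[OF rows'[OF s zx(2), of i i0], where \<phi>="\<lambda>j. ?\<phi> (j, i0)" and i=i] by simp
    also have "\<dots> = (\<Sum>e\<in>UNIV. ?\<phi> e * minor_label_rate (\<lambda>i0 j0. q0 s i0 j0 x) (\<lambda>i j. q' s i j i0 x) (i, i0) e)"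
      by (rule sum_minor_label_rate[symmetric])
    also have "\<dots> = p x * ?r s z d"
      by (simp add: of_bool_def if_distrib if_distribR zx(1) cong: if_cong)
    finally show "mf_minor_generator q0 q q' (\<lambda>_. ?F) s z =
      p (?pos z) * ?r s z d + mf_transport q (\<lambda>y. of_bool (minor_label z = d) * p y) s (fst (snd z)) (?pos z)"
      by (simp add: mf_minor_generator_def zx(1))
  qed simp
  let ?b = "\<lambda>s z. mass_flow (mass (?pos z)) (\<lambda>k j. q s k j (fst (snd z)) (?pos z))"
  show ?thesis
  proof (rule labelled_markov_of_transport[OF minor_top_continuous(1) pos])
    show "norm (?pos z) \<le> 1" if "z \<in> topspace (minor_top :: ('m option \<times> 'k \<times> (real ^ 'm)) topology)" for z
      using that simplex_norm by (auto simp: topspace_minor_top)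
    show "rate_of (\<lambda>_ z. of_bool (minor_label z = d)) (\<lambda>s z. ?r s z d)" for d
      using rate[of "\<lambda>_. 1" d] by (simp add: C1_fun_const mf_transport_const)
    show "rate_of (\<lambda>_ z. of_bool (minor_label z = d) * ?pos z $ l)
      (\<lambda>s z. ?pos z $ l * ?r s z d + of_bool (minor_label z = d) * ?b s z $ l)" for d l
      using rate[of "\<lambda>x. x $ l" d] by (simp add: C1_fun_coordinate mf_transport_coordinate continuous_intros)
    show "rate_of (\<lambda>_ z. of_bool (minor_label z = d) * (norm (?pos z))\<^sup>2)
      (\<lambda>s z. (norm (?pos z))\<^sup>2 * ?r s z d + of_bool (minor_label z = d) * (2 * (?pos z \<bullet> ?b s z)))" for d
      using rate[of "\<lambda>x. (norm x)\<^sup>2" d] by (simp add: C1_fun_square mf_transport_square continuous_intros)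
    show "\<forall>s\<in>{0..T}. \<forall>z\<in>topspace minor_top. \<forall>d l. \<bar>?r s z d\<bar> \<le> max (2 * C) (CARD('m option) * C) \<and> \<bar>?b s z $ l\<bar> \<le> max (2 * C) (CARD('m option) * C)"
    proof (intro ballI allI conjI)
      fix s and z :: "'m option \<times> 'k \<times> (real ^ 'm)" and d l assume s: "s \<in> {0..T}" and z: "z \<in> topspace minor_top"
      have x: "?pos z \<in> simplex_set" using z by (auto simp: topspace_minor_top)
      have "\<bar>?r s z d\<bar> \<le> 2 * C"
        using b0[OF s x, of "fst (snd z)" "snd d"] b'[OF s x, of "fst z" "fst d" "fst (snd z)"]
        by (auto simp: minor_label_rate_def of_bool_def)
      then show "\<bar>?r s z d\<bar> \<le> max (2 * C) (CARD('m option) * C)" by linarith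
      show "\<bar>?b s z $ l\<bar> \<le> max (2 * C) (CARD('m option) * C)"
        using mass_flow_bound[OF x, of "\<lambda>k j. q s k j (fst (snd z)) (?pos z)" C l, OF b[OF s x]] by linarith
    qed
  qed
qed

section \<open>The finite game as a process with label and position\<close>

text \<open>
  The jump rates of the chains are sums over kinds of jumps, each with a single target. A target may lie outside
  of the state space, but only if the rate is zero.
\<close>
lemma sum_over_targets:
  fixes c :: "'a \<Rightarrow> real"
  assumes "finite E" "finite A" "\<And>a. a \<in> A \<Longrightarrow> c a \<noteq> 0 \<Longrightarrow> g a \<in> E"
  shows "(\<Sum>z\<in>E. (\<Sum>a\<in>A. of_bool (z = g a) * c a) * W z) = (\<Sum>a\<in>A. c a * W (g a))"
proof -
  have "(\<Sum>z\<in>E. (\<Sum>a\<in>A. of_bool (z = g a) * c a) * W z) = (\<Sum>a\<in>A. \<Sum>z\<in>E. of_bool (z = g a) * (c a * W (g a)))"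
    unfolding sum_distrib_right by (subst sum.swap) (auto intro!: sum.cong)
  also have "\<dots> = (\<Sum>a\<in>A. c a * W (g a))"
  proof (rule sum.cong[OF refl])
    fix a assume a: "a \<in> A"
    show "(\<Sum>z\<in>E. of_bool (z = g a) * (c a * W (g a))) = c a * W (g a)"
      using assms(1) assms(3)[OF a] by (cases "c a = 0") (auto simp: of_bool_def if_distrib if_distribR cong: if_cong)
  qed
  finally show ?thesis .
qed

lemma sum_weighted_swap:
  fixes W :: "'a \<Rightarrow> real"
  shows "(\<Sum>z\<in>E. (\<Sum>k\<in>K. S k z) * W z) = (\<Sum>k\<in>K. \<Sum>z\<in>E. S k z * W z)"
  unfolding sum_distrib_right by (rule sum.swap)

lemma major_jump_form:
  fixes q0 :: "real \<Rightarrow> 'k::finite \<Rightarrow> 'k \<Rightarrow> real ^ 'm::finite \<Rightarrow> real"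
    and F :: "'k \<Rightarrow> real ^ 'm \<Rightarrow> real"
  assumes N: "0 < N" and z: "z \<in> UNIV \<times> simplex_grid N"
  shows "(\<Sum>z'\<in>UNIV \<times> simplex_grid N. N_major_rate N q0 q s z z' * (F (fst z') (snd z') - F (fst z) (snd z)))
    = (\<Sum>j\<in>UNIV. q0 s (fst z) j (snd z) * (F j (snd z) - F (fst z) (snd z)))
    + (\<Sum>k\<in>UNIV. \<Sum>j\<in>UNIV - {k}. real N * mass (snd z) k * q s k j (fst z) (snd z)
        * (F (fst z) (snd z + (1 / real N) *\<^sub>R jump_vec k j) - F (fst z) (snd z)))"
proof -
  obtain i0 x where zx: "z = (i0, x)" "x \<in> simplex_grid N" using z by auto
  let ?E = "(UNIV :: 'k set) \<times> (simplex_grid N :: (real ^ 'm) set)"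
  let ?W = "\<lambda>z'. F (fst z') (snd z') - F (fst z) (snd z)"
  let ?c = "\<lambda>k j. real N * mass x k * q s k j i0 x"
  let ?g = "\<lambda>k j. (i0, x + (1 / real N) *\<^sub>R jump_vec k j)"
  have fin: "finite ?E" by (rule finite_SigmaI) (auto simp: finite_simplex_grid)
  have rate: "N_major_rate N q0 q s z z' = (\<Sum>j\<in>UNIV. of_bool (z' = (j, x)) * q0 s i0 j x)
      + (\<Sum>k\<in>UNIV. \<Sum>j\<in>UNIV - {k}. of_bool (z' = ?g k j) * ?c k j)" for z'
  proof -
    obtain j0 y where z': "z' = (j0, y)" by (cases z')
    have "(\<Sum>j\<in>UNIV. of_bool (z' = (j, x)) * q0 s i0 j x) = of_bool (y = x) * q0 s i0 j0 x"
      unfolding z' by (cases "y = x") (simp_all add: of_bool_def if_distrib if_distribR cong: if_cong)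
    then show ?thesis unfolding zx(1) z' N_major_rate_def
      by (auto simp: sum_distrib_left intro!: sum.cong)
  qed
  have "(\<Sum>z'\<in>?E. N_major_rate N q0 q s z z' * ?W z') =
     (\<Sum>z'\<in>?E. (\<Sum>j\<in>UNIV. of_bool (z' = (j, x)) * q0 s i0 j x) * ?W z')
    + (\<Sum>k\<in>UNIV. \<Sum>z'\<in>?E. (\<Sum>j\<in>UNIV - {k}. of_bool (z' = ?g k j) * ?c k j) * ?W z')"
    unfolding rate distrib_right sum.distrib 
    by (simp only: sum_weighted_swap[where S="\<lambda>k z'. \<Sum>j\<in>UNIV - {k}. of_bool (z' = ?g k j) * ?c k j"])
  also have "(\<Sum>z'\<in>?E. (\<Sum>j\<in>UNIV. of_bool (z' = (j, x)) * q0 s i0 j x) * ?W z')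
     = (\<Sum>j\<in>UNIV. q0 s i0 j x * ?W (j, x))"
    by (rule sum_over_targets[OF fin]) (use zx in auto)
  also have "(\<Sum>k\<in>UNIV. \<Sum>z'\<in>?E. (\<Sum>j\<in>UNIV - {k}. of_bool (z' = ?g k j) * ?c k j) * ?W z')
     = (\<Sum>k\<in>UNIV. \<Sum>j\<in>UNIV - {k}. ?c k j * ?W (?g k j))"
  proof (rule sum.cong[OF refl], rule sum_over_targets[OF fin])
    fix k j assume "j \<in> UNIV - {k}" "?c k j \<noteq> 0"
    then show "?g k j \<in> ?E" using grid_jump[OF N zx(2), of k j] by auto
  qed simp
  finally show ?thesis by (simp add: zx(1))
qed

definition minor_states :: "nat \<Rightarrow> ('m::finite option \<times> 'k \<times> (real ^ 'm)) set" where
  "minor_states N = {(i, i0, x). x \<in> simplex_grid N \<and> 1 / real N \<le> mass x i}"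

text \<open>
  The distribution of the players other than the distinguished one, still normalised by \<open>N\<close>, so that the total mass is \<open>1 - 1 / real N\<close>. If
  the distinguished player jumps, \<open>others_pos\<close> does not change.
\<close>
definition others_mass :: "nat \<Rightarrow> 'm::finite option \<times> 'k \<times> (real ^ 'm) \<Rightarrow> 'm option \<Rightarrow> real" where
  "others_mass N z k = mass (snd (snd z)) k - of_bool (k = fst z) / real N"

definition others_pos :: "nat \<Rightarrow> 'm::finite option \<times> 'k \<times> (real ^ 'm) \<Rightarrow> real ^ 'm" where
  "others_pos N z = snd (snd z) - (1 / real N) *\<^sub>R unit_vec (fst z)"

lemma finite_minor_states: "finite (minor_states N :: ('m::finite option \<times> 'k::finite \<times> (real ^ 'm)) set)"
  by (rule finite_subset[of _ "UNIV \<times> UNIV \<times> simplex_grid N"])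
     (auto simp: minor_states_def finite_simplex_grid)

lemma minor_jump_form:
  fixes q0 :: "real \<Rightarrow> 'k::finite \<Rightarrow> 'k \<Rightarrow> real ^ 'm::finite \<Rightarrow> real"
    and F :: "'m option \<times> 'k \<Rightarrow> real ^ 'm \<Rightarrow> real"
  assumes N: "0 < N" and z: "z \<in> minor_states N"
  shows "(\<Sum>z'\<in>minor_states N. N_minor_rate N q0 q q' s z z' * (F (minor_label z') (others_pos N z') - F (minor_label z) (others_pos N z)))
    = (\<Sum>d\<in>UNIV. minor_label_rate (\<lambda>i0 j0. q0 s i0 j0 (snd (snd z))) (\<lambda>i j. q' s i j (fst (snd z)) (snd (snd z))) (minor_label z) d
         * (F d (others_pos N z) - F (minor_label z) (others_pos N z)))
    + (\<Sum>k\<in>UNIV. \<Sum>j\<in>UNIV - {k}. real N * others_mass N z k * q s k j (fst (snd z)) (snd (snd z))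
        * (F (minor_label z) (others_pos N z + (1 / real N) *\<^sub>R jump_vec k j) - F (minor_label z) (others_pos N z)))"
proof -
  obtain i i0 x where zx: "z = (i, i0, x)" "x \<in> simplex_grid N" "1 / real N \<le> mass x i"
    using z by (auto simp: minor_states_def)
  let ?E = "minor_states N :: ('m option \<times> 'k \<times> (real ^ 'm)) set"
  let ?W = "\<lambda>z'. F (minor_label z') (others_pos N z') - F (minor_label z) (others_pos N z)"
  let ?c = "\<lambda>k j. (real N * mass x k - of_bool (k = i)) * q s k j i0 x"
  let ?g = "\<lambda>k j. (i, i0, x + (1 / real N) *\<^sub>R jump_vec k j)"
  let ?h = "\<lambda>j. (j, i0, x + (1 / real N) *\<^sub>R jump_vec i j)"
  have rate: "N_minor_rate N q0 q q' s z z' = (\<Sum>j\<in>UNIV. of_bool (z' = (i, j, x)) * q0 s i0 j x)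
      + (\<Sum>j\<in>UNIV - {i}. of_bool (z' = ?h j) * q' s i j i0 x)
      + (\<Sum>k\<in>UNIV. \<Sum>j\<in>UNIV - {k}. of_bool (z' = ?g k j) * ?c k j)" for z'
  proof -
    obtain i' j0 y where z': "z' = (i', j0, y)" by (cases z')
    have 1: "(\<Sum>j\<in>UNIV. of_bool (z' = (i, j, x)) * q0 s i0 j x) = of_bool (i' = i \<and> y = x) * q0 s i0 j0 x"
      unfolding z' by (cases "i' = i \<and> y = x") (auto simp: of_bool_def if_distrib if_distribR cong: if_cong)
    have "(\<Sum>j\<in>UNIV - {i}. of_bool (z' = ?h j) * q' s i j i0 x)
       = (\<Sum>j\<in>UNIV - {i}. if j = i' then of_bool (j0 = i0 \<and> y = x + (1 / real N) *\<^sub>R jump_vec i i') * q' s i i' i0 x else 0)"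
      unfolding z' by (rule sum.cong) auto
    also have "\<dots> = of_bool (i' \<noteq> i \<and> j0 = i0 \<and> y = x + (1 / real N) *\<^sub>R jump_vec i i') * q' s i i' i0 x"
      by (subst sum.delta) auto
    finally have 2: "(\<Sum>j\<in>UNIV - {i}. of_bool (z' = ?h j) * q' s i j i0 x)
       = of_bool (i' \<noteq> i \<and> j0 = i0 \<and> y = x + (1 / real N) *\<^sub>R jump_vec i i') * q' s i i' i0 x" .
    show ?thesis unfolding 1 2 unfolding zx(1) z' N_minor_rate_def
      by (auto simp: sum_distrib_left intro!: sum.cong)
  qed
  have "(\<Sum>z'\<in>?E. N_minor_rate N q0 q q' s z z' * ?W z') =
     (\<Sum>z'\<in>?E. (\<Sum>j\<in>UNIV. of_bool (z' = (i, j, x)) * q0 s i0 j x) * ?W z')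
    + (\<Sum>z'\<in>?E. (\<Sum>j\<in>UNIV - {i}. of_bool (z' = ?h j) * q' s i j i0 x) * ?W z')
    + (\<Sum>k\<in>UNIV. \<Sum>z'\<in>?E. (\<Sum>j\<in>UNIV - {k}. of_bool (z' = ?g k j) * ?c k j) * ?W z')"
    unfolding rate distrib_right sum.distrib 
    by (simp only: sum_weighted_swap[where S="\<lambda>k z'. \<Sum>j\<in>UNIV - {k}. of_bool (z' = ?g k j) * ?c k j"])
  also have "(\<Sum>z'\<in>?E. (\<Sum>j\<in>UNIV. of_bool (z' = (i, j, x)) * q0 s i0 j x) * ?W z')
     = (\<Sum>j\<in>UNIV. q0 s i0 j x * ?W (i, j, x))"
    by (rule sum_over_targets[OF finite_minor_states]) (use zx in \<open>auto simp: minor_states_def\<close>)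
  also have "(\<Sum>z'\<in>?E. (\<Sum>j\<in>UNIV - {i}. of_bool (z' = ?h j) * q' s i j i0 x) * ?W z')
     = (\<Sum>j\<in>UNIV - {i}. q' s i j i0 x * ?W (?h j))"
  proof (rule sum_over_targets[OF finite_minor_states])
    fix j assume j: "j \<in> UNIV - {i}"
    have "mass x i \<noteq> 0" using zx(3) N by auto
    moreover have "0 \<le> mass x j" using zx(2) grid_subset_simplex[OF N] mass_nonneg by blast
    ultimately show "?h j \<in> ?E" using grid_jump[OF N zx(2), of i j] j by (auto simp: minor_states_def mass_jump)
  qed simp
  also have "(\<Sum>k\<in>UNIV. \<Sum>z'\<in>?E. (\<Sum>j\<in>UNIV - {k}. of_bool (z' = ?g k j) * ?c k j) * ?W z')
     = (\<Sum>k\<in>UNIV. \<Sum>j\<in>UNIV - {k}. ?c k j * ?W (?g k j))"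
  proof (rule sum.cong[OF refl], rule sum_over_targets[OF finite_minor_states])
    \<comment> \<open>If another player leaves the state \<open>i\<close> of the distinguished player, there were at least two players
      in it, so one remains.\<close>
    fix k j assume j: "j \<in> UNIV - {k}" and c: "?c k j \<noteq> 0"
    obtain c where c': "\<And>k. mass x k = real (c k) / real N" using zx(2) grid_iff_mass[OF N] by blast
    have xs: "x \<in> simplex_set" using zx(2) grid_subset_simplex[OF N] by blast
    have k0: "mass x k \<noteq> 0" using c zx(3) N by (cases "k = i") auto
    have "1 / real N \<le> mass (x + (1 / real N) *\<^sub>R jump_vec k j) i"
    proof (cases "k = i")
      case True
      then have "real (c i) \<noteq> 1" using c c'[of i] N by auto
      moreover have "1 \<le> real (c i)" using zx(3) c'[of i] N by (simp add: divide_le_cancel)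
      ultimately have "c i \<noteq> 1" "1 \<le> c i" by auto
      then have "2 \<le> real (c i)" by linarith
      then have "2 / real N \<le> mass x i" using c'[of i] N by (simp add: divide_le_cancel)
      then show ?thesis using True j by (simp add: mass_jump)
    next
      case False
      then show ?thesis using zx(3) N by (simp add: mass_jump add_increasing2)
    qed
    then show "?g k j \<in> ?E" using grid_jump[OF N zx(2) k0, of j] j by (auto simp: minor_states_def)
  qed simp
  also have "(\<Sum>j\<in>UNIV. q0 s i0 j x * ?W (i, j, x)) + (\<Sum>j\<in>UNIV - {i}. q' s i j i0 x * ?W (?h j))
    = (\<Sum>d\<in>UNIV. minor_label_rate (\<lambda>i0 j0. q0 s i0 j0 x) (\<lambda>i j. q' s i j i0 x) (i, i0) d
         * (F d (others_pos N z) - F (minor_label z) (others_pos N z)))"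
  proof -
    have h: "others_pos N (?h j) = others_pos N z" for j
      by (simp add: others_pos_def zx(1) jump_vec_def algebra_simps)
    have g: "others_pos N (i, j, x) = others_pos N z" for j
      by (simp add: others_pos_def zx(1))
    have "(\<Sum>j\<in>UNIV - {i}. q' s i j i0 x * ?W (?h j))
       = (\<Sum>j\<in>UNIV. (F (j, i0) (others_pos N z) - F (minor_label z) (others_pos N z)) * q' s i j i0 x)"
      unfolding h by (rule sum.mono_neutral_cong_left) (auto simp: zx(1) mult.commute)
    moreover have "(\<Sum>j\<in>UNIV. q0 s i0 j x * ?W (i, j, x))
       = (\<Sum>j\<in>UNIV. (F (i, j) (others_pos N z) - F (minor_label z) (others_pos N z)) * q0 s i0 j x)"
      unfolding g by (simp add: mult.commute)
    ultimately show ?thesis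
      using sum_minor_label_rate[of "\<lambda>d. F d (others_pos N z) - F (minor_label z) (others_pos N z)"
          "\<lambda>i0 j0. q0 s i0 j0 x" "\<lambda>i j. q' s i j i0 x" i i0]
      by (simp add: mult.commute)
  qed
  also have "(\<Sum>k\<in>UNIV. \<Sum>j\<in>UNIV - {k}. ?c k j * ?W (?g k j))
     = (\<Sum>k\<in>UNIV. \<Sum>j\<in>UNIV - {k}. real N * others_mass N z k * q s k j i0 x
        * (F (minor_label z) (others_pos N z + (1 / real N) *\<^sub>R jump_vec k j) - F (minor_label z) (others_pos N z)))"
  proof (intro sum.cong refl)
    fix k j
    have "others_pos N (?g k j) = others_pos N z + (1 / real N) *\<^sub>R jump_vec k j"
      by (simp add: others_pos_def zx(1) algebra_simps)
    moreover have "real N * others_mass N z k = real N * mass x k - of_bool (k = i)"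
      using N by (simp add: others_mass_def zx(1) right_diff_distrib)
    ultimately show "?c k j * ?W (?g k j) = real N * others_mass N z k * q s k j i0 x
        * (F (minor_label z) (others_pos N z + (1 / real N) *\<^sub>R jump_vec k j) - F (minor_label z) (others_pos N z))"
      by (simp add: zx(1))
  qed
  finally show ?thesis by (simp add: zx(1))
qed

lemma others_mass_props:
  fixes z :: "'m::finite option \<times> 'k \<times> (real ^ 'm)"
  assumes N: "0 < N" and z: "z \<in> minor_states N"
  shows "0 \<le> others_mass N z k" "others_mass N z k \<le> 1" "(\<Sum>k\<in>UNIV. others_mass N z k) \<le> 1"
    "others_mass N z (Some l) = others_pos N z $ l"
    "\<bar>others_mass N z None - mass (others_pos N z) None\<bar> \<le> 1 / real N"
    "norm (others_pos N z) \<le> 1" "norm (snd (snd z) - others_pos N z) \<le> 1 / real N"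
    "snd (snd z) \<in> simplex_set"
proof -
  obtain i i0 x where zx: "z = (i, i0, x)" "x \<in> simplex_grid N" "1 / real N \<le> mass x i"
    using z by (auto simp: minor_states_def)
  have xs: "x \<in> simplex_set" using zx(2) grid_subset_simplex[OF N] by blast
  then show "snd (snd z) \<in> simplex_set" by (simp add: zx(1))
  show nn: "0 \<le> others_mass N z k" for k
    using zx(3) mass_nonneg[OF xs, of k] by (auto simp: others_mass_def zx(1) of_bool_def)
  show "others_mass N z k \<le> 1"
    using mass_le_1[OF xs, of k] by (auto simp: others_mass_def zx(1) of_bool_def intro: order_trans[of _ "mass x i"])
  have s: "(\<Sum>k\<in>UNIV. others_mass N z k) = 1 - 1 / real N"
    using sum_mass[of x] by (simp add: others_mass_def zx(1) sum_subtractf of_bool_def flip: sum_divide_distrib)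
  then show "(\<Sum>k\<in>UNIV. others_mass N z k) \<le> 1" by simp
  show S: "others_mass N z (Some l) = others_pos N z $ l" for l
    by (auto simp: others_mass_def others_pos_def zx(1) unit_vec_nth)
  have "others_mass N z None = 1 - 1 / real N - (\<Sum>l\<in>UNIV. others_pos N z $ l)"
    using s by (simp add: sum_UNIV_option S)
  then show "\<bar>others_mass N z None - mass (others_pos N z) None\<bar> \<le> 1 / real N" by simp
  show "norm (others_pos N z) \<le> 1"
  proof (rule norm_le_1_of_sum_le_1)
    show "0 \<le> others_pos N z $ l" for l using nn[of "Some l"] by (simp add: S)
    have "(\<Sum>l\<in>UNIV. others_mass N z (Some l)) = 1 - 1 / real N - others_mass N z None"
      using s by (simp add: sum_UNIV_option)
    then have "(\<Sum>l\<in>UNIV. others_mass N z (Some l)) \<le> 1"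
      using nn[of None] divide_nonneg_nonneg[of 1 "real N"] by linarith
    then show "(\<Sum>l\<in>UNIV. others_pos N z $ l) \<le> 1" by (simp add: S)
  qed
  show "norm (snd (snd z) - others_pos N z) \<le> 1 / real N"
    using norm_unit_vec[of i] N by (simp add: others_pos_def zx(1) divide_right_mono)
qed

section \<open>Comparison of a finite game with its limit\<close>

lemma (in markov) cost_right_continuous:
  fixes lab :: "'s \<Rightarrow> 'd" and C :: "real \<Rightarrow> 'd \<Rightarrow> real ^ 'm::finite \<Rightarrow> real"
  assumes lab: "continuous_map X (discrete_topology UNIV) lab"
    and act: "continuous_map X (top_of_set simplex_set) act"
    and C: "\<And>s s' d x x'. s \<in> {0..T} \<Longrightarrow> s' \<in> {0..T} \<Longrightarrow> x \<in> simplex_set \<Longrightarrow> x' \<in> simplex_set \<Longrightarrow>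
      \<bar>C s d x - C s' d x'\<bar> \<le> K * (\<bar>s - s'\<bar> + norm (x - x'))"
    and w: "\<omega> \<in> space \<Omega>" and s: "s \<in> {0..<T}"
  shows "((\<lambda>r. C r (lab (Z r \<omega>)) (act (Z r \<omega>))) \<longlongrightarrow> C s (lab (Z s \<omega>)) (act (Z s \<omega>))) (at_right s)"
proof -
  have lim: "limitin X (\<lambda>r. Z r \<omega>) (Z s \<omega>) (at_right s)"
    using process w s by (auto simp: markov_process_def)
  have "limitin (discrete_topology UNIV) (lab \<circ> (\<lambda>r. Z r \<omega>)) (lab (Z s \<omega>)) (at_right s)"
    by (rule continuous_map_limit[OF lab lim])
  then have ev1: "eventually (\<lambda>r. lab (Z r \<omega>) \<in> {lab (Z s \<omega>)}) (at_right s)"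
    unfolding limitin_def by (auto simp: comp_def dest: spec[of _ "{lab (Z s \<omega>)}"])
  have Zin: "Z r \<omega> \<in> topspace X" if "r \<in> {0..T}" for r
    using path_measurable[of r r] that w by (auto simp: measurable_def)
  have actin: "act z \<in> simplex_set" if "z \<in> topspace X" for z
    using act that by (auto simp: continuous_map_def)
  have "limitin (top_of_set simplex_set) (act \<circ> (\<lambda>r. Z r \<omega>)) (act (Z s \<omega>)) (at_right s)"
    by (rule continuous_map_limit[OF act lim])
  then have act_lim: "((\<lambda>r. act (Z r \<omega>)) \<longlongrightarrow> act (Z s \<omega>)) (at_right s)"
    by (simp add: limitin_subtopology limitin_canonical_iff comp_def)
  have ev2: "eventually (\<lambda>r. r \<in> {0..T}) (at_right s)"
    using s by (auto simp: eventually_at_right_field intro!: exI[of _ T])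
  have "((\<lambda>r. C r (lab (Z r \<omega>)) (act (Z r \<omega>)) - C s (lab (Z s \<omega>)) (act (Z s \<omega>))) \<longlongrightarrow> 0) (at_right s)"
  proof (rule Lim_null_comparison)
    show "eventually (\<lambda>r. norm (C r (lab (Z r \<omega>)) (act (Z r \<omega>)) - C s (lab (Z s \<omega>)) (act (Z s \<omega>)))
       \<le> K * (\<bar>r - s\<bar> + norm (act (Z r \<omega>) - act (Z s \<omega>)))) (at_right s)"
      using ev1 ev2
    proof eventually_elim
      case (elim r)
      then show ?case using C[of r s "act (Z r \<omega>)" "act (Z s \<omega>)" "lab (Z s \<omega>)"] s Zin actin by auto
    qed
    have "((\<lambda>r. K * (\<bar>r - s\<bar> + norm (act (Z r \<omega>) - act (Z s \<omega>)))) \<longlongrightarrow>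
       K * (\<bar>s - s\<bar> + norm (act (Z s \<omega>) - act (Z s \<omega>)))) (at_right s)"
      by (intro tendsto_intros act_lim)
    then show "((\<lambda>r. K * (\<bar>r - s\<bar> + norm (act (Z r \<omega>) - act (Z s \<omega>)))) \<longlongrightarrow> 0) (at_right s)" by simp
  qed
  then show ?thesis by (rule LIM_zero_cancel)
qed

lemma labelled_cost_measurable:
  fixes lab :: "'s \<Rightarrow> 'd::finite" and G :: "'d \<Rightarrow> real ^ 'm::finite \<Rightarrow> real"
  assumes lab: "continuous_map X (discrete_topology UNIV) lab"
    and act: "continuous_map X (top_of_set simplex_set) act"
    and G: "\<And>d x x'. x \<in> simplex_set \<Longrightarrow> x' \<in> simplex_set \<Longrightarrow> \<bar>G d x - G d x'\<bar> \<le> K * norm (x - x')"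
    and K: "0 \<le> K"
  shows "(\<lambda>z. G (lab z) (act z)) \<in> borel_measurable (borel_top X)"
proof -
  have "continuous_on simplex_set (G d)" for d
    by (rule lipschitz_on_continuous_on[of K]) (auto intro!: lipschitz_onI G K simp: dist_norm)
  then have "continuous_map X euclideanreal (\<lambda>z. G d (act z))" for d
    using continuous_map_compose[OF act, of euclideanreal "G d"] by (simp add: comp_def)
  moreover have "continuous_map X euclideanreal (\<lambda>z. of_bool (lab z = d))" for d
    using continuous_map_compose[OF lab, of euclideanreal "\<lambda>i. of_bool (i = d)"] by (simp add: comp_def)
  ultimately have "continuous_map X euclideanreal (\<lambda>z. \<Sum>d\<in>UNIV. of_bool (lab z = d) * G d (act z))"
    by (intro continuous_map_sum continuous_map_real_mult) auto
  moreover have "(\<Sum>d\<in>UNIV. of_bool (lab z = d) * G d (act z)) = G (lab z) (act z)" for z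
    by (simp add: of_bool_def if_distrib if_distribR cong: if_cong)
  ultimately show ?thesis by (intro borel_top_measurable_euclidean) simp
qed

text \<open>
  \<open>p\<close> is the dimension of the simplex, \<open>R\<close> a bound of the rates into the states \<open>Some l\<close>, and \<open>K\<close> the Lipschitz constant of the
  rates in the position.
\<close>
definition drift_const :: "real \<Rightarrow> real \<Rightarrow> real \<Rightarrow> real" where
  "drift_const p R K = 2 * p * (p + 1) * (p * R + R + 2 * K) + 8 * p * R"

text \<open>
  The common form of both inequalities: \<open>rl\<close> are the rates of the label and \<open>q\<close> those of the players that make up the position.
  In the finite game, rates and costs depend on the empirical distribution \<open>act1\<close> of all players, which differs
  from the position \<open>pos1\<close> by at most \<open>1 / real N\<close> if a player is distinguished.
\<close>
lemma labelled_game_comparison: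
  fixes q :: "real \<Rightarrow> 'd::finite \<Rightarrow> 'm::finite option \<Rightarrow> 'm option \<Rightarrow> real ^ 'm \<Rightarrow> real"
    and rl :: "real \<Rightarrow> 'd \<Rightarrow> 'd \<Rightarrow> real ^ 'm \<Rightarrow> real"
    and lab1 :: "'s1 \<Rightarrow> 'd" and lab2 :: "'s2 \<Rightarrow> 'd"
    and C :: "real \<Rightarrow> 'd \<Rightarrow> real ^ 'm \<Rightarrow> real" and G :: "'d \<Rightarrow> real ^ 'm \<Rightarrow> real"
    and R K K0 Kc B B0 :: real
  assumes T: "0 \<le> T" and N: "0 < N"
    and Q: "\<And>s d x. s \<in> {0..T} \<Longrightarrow> x \<in> simplex_set \<Longrightarrow> Q_matrix (\<lambda>k j. q s d k j x)"
    and R: "\<And>s d x k l. s \<in> {0..T} \<Longrightarrow> x \<in> simplex_set \<Longrightarrow> k \<noteq> Some l \<Longrightarrow> \<bar>q s d k (Some l) x\<bar> \<le> R"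
    and K: "\<And>s d x y k j. s \<in> {0..T} \<Longrightarrow> x \<in> simplex_set \<Longrightarrow> y \<in> simplex_set \<Longrightarrow>
      \<bar>q s d k j x - q s d k j y\<bar> \<le> K * norm (x - y)"
    and K0: "\<And>s d j x y. s \<in> {0..T} \<Longrightarrow> x \<in> simplex_set \<Longrightarrow> y \<in> simplex_set \<Longrightarrow>
      \<bar>rl s d j x - rl s d j y\<bar> \<le> K0 * norm (x - y)"
    and rows: "\<And>s d x. s \<in> {0..T} \<Longrightarrow> x \<in> simplex_set \<Longrightarrow> (\<Sum>j\<in>UNIV. rl s d j x) = 0"
    and bound: "\<And>s d x i k j. s \<in> {0..T} \<Longrightarrow> x \<in> simplex_set \<Longrightarrow> \<bar>rl s d i x\<bar> \<le> B0 \<and> \<bar>q s d k j x\<bar> \<le> B0"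
    and nonneg: "0 \<le> R" "0 \<le> K" "0 \<le> K0" "0 \<le> Kc" "0 \<le> B"
    and C: "\<And>s s' d x x'. s \<in> {0..T} \<Longrightarrow> s' \<in> {0..T} \<Longrightarrow> x \<in> simplex_set \<Longrightarrow> x' \<in> simplex_set \<Longrightarrow>
      \<bar>C s d x - C s' d x'\<bar> \<le> Kc * (\<bar>s - s'\<bar> + norm (x - x'))"
    and CB: "\<And>s d d' x. s \<in> {0..T} \<Longrightarrow> x \<in> simplex_set \<Longrightarrow> \<bar>C s d x - C s d' x\<bar> \<le> B"
    and G: "\<And>d x x'. x \<in> simplex_set \<Longrightarrow> x' \<in> simplex_set \<Longrightarrow> \<bar>G d x - G d x'\<bar> \<le> Kc * norm (x - x')"
    and GB: "\<And>d d' x. x \<in> simplex_set \<Longrightarrow> \<bar>G d x - G d' x\<bar> \<le> B"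
    and chain: "markov_chain T E rt \<Omega>1 P1 Z1" and fin: "finite E"
    and act1: "\<And>z. z \<in> E \<Longrightarrow> act1 z \<in> simplex_set" "\<And>z. z \<in> E \<Longrightarrow> norm (act1 z - pos1 z) \<le> 1 / real N"
    and pos1: "\<And>z. z \<in> E \<Longrightarrow> norm (pos1 z) \<le> 1"
    and n: "\<And>z k. z \<in> E \<Longrightarrow> 0 \<le> n z k" "\<And>z k. z \<in> E \<Longrightarrow> n z k \<le> 1" "\<And>z. z \<in> E \<Longrightarrow> (\<Sum>k\<in>UNIV. n z k) \<le> 1"
      "\<And>z l. z \<in> E \<Longrightarrow> n z (Some l) = pos1 z $ l"
      "\<And>z. z \<in> E \<Longrightarrow> \<bar>n z None - mass (pos1 z) None\<bar> \<le> 1 / real N"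
    and form: "\<And>s z F. s \<in> {0..T} \<Longrightarrow> z \<in> E \<Longrightarrow>
      (\<Sum>z'\<in>E. rt s z z' * (F (lab1 z') (pos1 z') - F (lab1 z) (pos1 z) :: real)) =
      (\<Sum>j\<in>UNIV. rl s (lab1 z) j (act1 z) * (F j (pos1 z) - F (lab1 z) (pos1 z)))
      + (\<Sum>k\<in>UNIV. \<Sum>j\<in>UNIV - {k}. real N * n z k * q s (lab1 z) k j (act1 z)
           * (F (lab1 z) (pos1 z + (1 / real N) *\<^sub>R jump_vec k j) - F (lab1 z) (pos1 z)))"
    and limit: "labelled_markov T X2 \<Omega>2 P2 Z2 lab2 pos2 (\<lambda>s z j. rl s (lab2 z) j (pos2 z))
      (\<lambda>s z. mass_flow (mass (pos2 z)) (\<lambda>k j. q s (lab2 z) k j (pos2 z))) (\<lambda>_ _. 0)"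
    and pos2: "continuous_map X2 (top_of_set simplex_set) pos2"
    and t: "0 \<le> t" "t \<le> T"
    and z: "z1 \<in> E" "z2 \<in> topspace X2" "lab1 z1 = lab2 z2"
  defines "\<sigma> \<equiv> 1 + 2 * Kc"
    and "growth \<equiv> 2 * drift_const (CARD('m)) R K + 1 + 2 * ((2 * Kc + B) * (1 + T)) * (2 * CARD('d) * K0)"
  shows "\<bar>expected_cost T P1 Z1 (\<lambda>s z. C s (lab1 z) (act1 z)) (\<lambda>z. G (lab1 z) (act1 z)) t z1
      - expected_cost T P2 Z2 (\<lambda>s z. C s (lab2 z) (pos2 z)) (\<lambda>z. G (lab2 z) (pos2 z)) t z2\<bar>
    \<le> \<sigma> * exp (growth * T) * gap (sqrt (real N)) (pos1 z1) (pos2 z2)"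
proof -
  let ?X1 = "discrete_topology E"
  let ?\<kappa> = "sqrt (real N)"
  have m1: "markov T ?X1 \<Omega>1 P1 Z1" and rates: "has_jump_rates T E \<Omega>1 P1 Z1 rt"
    using chain by (auto simp: markov_chain_def markov_def)
  interpret M1: markov T ?X1 \<Omega>1 P1 Z1 by (rule m1)
  interpret M2: labelled_markov T X2 \<Omega>2 P2 Z2 lab2 pos2 "\<lambda>s z j. rl s (lab2 z) j (pos2 z)"
    "\<lambda>s z. mass_flow (mass (pos2 z)) (\<lambda>k j. q s (lab2 z) k j (pos2 z))" "\<lambda>_ _. 0" by (rule limit)
  have N1: "1 \<le> real N" using N by simp
  have \<kappa>1: "1 \<le> ?\<kappa>" using N1 by simp
  have pos2in: "pos2 z \<in> simplex_set" if "z \<in> topspace X2" for z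
    using pos2 that by (auto simp: continuous_map_def)
  have rowsQ: "(\<Sum>j\<in>UNIV. q s d k j x) = 0" if "s \<in> {0..T}" "x \<in> simplex_set" for s d k x
    using Q[OF that, of d] by (simp add: Q_matrix_def)
  interpret M1: labelled_markov T ?X1 \<Omega>1 P1 Z1 lab1 pos1 "\<lambda>s z j. rl s (lab1 z) j (act1 z)"
    "\<lambda>s z. \<Sum>k\<in>UNIV. \<Sum>j\<in>UNIV - {k}. (n z k * q s (lab1 z) k j (act1 z)) *\<^sub>R jump_vec k j"
    "\<lambda>s z. (\<Sum>k\<in>UNIV. \<Sum>j\<in>UNIV - {k}. n z k * q s (lab1 z) k j (act1 z) * (norm (jump_vec k j :: real ^ 'm))\<^sup>2) / real N"
    by (rule M1.labelled_markov_of_jumps[OF refl fin rates N pos1 form, where C=B0])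
       (use rows act1 bound n in auto)
  have apart: "norm (act1 z - pos2 z') \<le> norm (pos1 z - pos2 z') + 1 / real N" if "z \<in> E" for z z'
    using act1(2)[OF that] norm_triangle_ineq[of "act1 z - pos1 z" "pos1 z - pos2 z'"] by simp
  have pos1_nonneg: "0 \<le> pos1 z $ l" if "z \<in> E" for z l
    using n(1)[OF that, of "Some l"] n(4)[OF that] by simp
  have gap_ge: "?\<kappa> * (norm (pos1 z - y))\<^sup>2 + 1 / ?\<kappa> \<le> gap ?\<kappa> (pos1 z) y" if "z \<in> E" for z y
    using sum_nonneg[of UNIV "\<lambda>l. pos1 z $ l"] pos1_nonneg[OF that] by (simp add: gap_def)
  have apart_gap: "norm (act1 z - pos2 z') \<le> 2 * gap ?\<kappa> (pos1 z) (pos2 z')" if zE: "z \<in> E" for z z'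
  proof -
    define v where "v = norm (pos1 z - pos2 z')"
    have "0 \<le> ?\<kappa> * (v - 1 / ?\<kappa>)\<^sup>2" by simp
    also have "\<dots> = ?\<kappa> * v\<^sup>2 + 1 / ?\<kappa> - 2 * v" using \<kappa>1 by (simp add: field_simps power2_eq_square)
    finally have v: "2 * v \<le> gap ?\<kappa> (pos1 z) (pos2 z')" using gap_ge[OF zE, of "pos2 z'"] by (simp add: v_def)
    have "1 / real N = 1 / ?\<kappa> * (1 / ?\<kappa>)" using N by simp
    also have "\<dots> \<le> 1 / ?\<kappa> * 1" using \<kappa>1 by (intro mult_left_mono) auto
    also have "\<dots> \<le> gap ?\<kappa> (pos1 z) (pos2 z')"
    proof -
      have "0 \<le> ?\<kappa> * (norm (pos1 z - pos2 z'))\<^sup>2" by simp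
      then show ?thesis using gap_ge[OF zE, of "pos2 z'"] by linarith
    qed
    finally show ?thesis using apart[OF zE, of z'] v norm_ge_zero[of "pos1 z - pos2 z'"]
      unfolding v_def by linarith
  qed
  let ?p = "real CARD('m)"
  have \<gamma>0: "0 \<le> drift_const ?p R K" using nonneg by (simp add: drift_const_def)
  interpret cm: coupled_markov T ?X1 \<Omega>1 P1 Z1 lab1 pos1 "\<lambda>s z j. rl s (lab1 z) j (act1 z)"
    "\<lambda>s z. \<Sum>k\<in>UNIV. \<Sum>j\<in>UNIV - {k}. (n z k * q s (lab1 z) k j (act1 z)) *\<^sub>R jump_vec k j"
    "\<lambda>s z. (\<Sum>k\<in>UNIV. \<Sum>j\<in>UNIV - {k}. n z k * q s (lab1 z) k j (act1 z) * (norm (jump_vec k j :: real ^ 'm))\<^sup>2) / real N"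
    X2 \<Omega>2 P2 Z2 lab2 pos2 "\<lambda>s z j. rl s (lab2 z) j (pos2 z)"
    "\<lambda>s z. mass_flow (mass (pos2 z)) (\<lambda>k j. q s (lab2 z) k j (pos2 z))" "\<lambda>_ _. 0"
    ?\<kappa> "drift_const ?p R K" "2 * CARD('d) * K0"
  proof unfold_locales
    show "1 \<le> ?\<kappa>" by (rule \<kappa>1)
    show "0 \<le> drift_const ?p R K" by (rule \<gamma>0)
    show "0 \<le> 2 * CARD('d) * K0" using nonneg by simp
    show "0 \<le> pos1 z $ l" if "z \<in> topspace ?X1" for z l using pos1_nonneg that by simp
  next
    fix s y1 y2 assume s: "s \<in> {0..T}" and y: "y1 \<in> topspace ?X1" "y2 \<in> topspace X2" and l: "lab1 y1 = lab2 y2"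
    have y1: "y1 \<in> E" using y by simp
    have "(\<Sum>j\<in>UNIV. \<bar>rl s (lab1 y1) j (act1 y1) - rl s (lab2 y2) j (pos2 y2)\<bar>)
      \<le> (\<Sum>j\<in>(UNIV :: 'd set). K0 * (2 * gap ?\<kappa> (pos1 y1) (pos2 y2)))"
    proof (rule sum_mono)
      fix j
      have "\<bar>rl s (lab1 y1) j (act1 y1) - rl s (lab2 y2) j (pos2 y2)\<bar> \<le> K0 * norm (act1 y1 - pos2 y2)"
        unfolding l by (rule K0[OF s act1(1)[OF y1] pos2in[OF y(2)]])
      also have "\<dots> \<le> K0 * (2 * gap ?\<kappa> (pos1 y1) (pos2 y2))"
        by (rule mult_left_mono[OF apart_gap[OF y1] nonneg(3)])
      finally show "\<bar>rl s (lab1 y1) j (act1 y1) - rl s (lab2 y2) j (pos2 y2)\<bar> \<le> K0 * (2 * gap ?\<kappa> (pos1 y1) (pos2 y2))" .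
    qed
    then show "(\<Sum>j\<in>UNIV. \<bar>rl s (lab1 y1) j (act1 y1) - rl s (lab2 y2) j (pos2 y2)\<bar>)
      \<le> 2 * CARD('d) * K0 * gap ?\<kappa> (pos1 y1) (pos2 y2)" by (simp add: mult_ac)
    have flow: "(\<Sum>k\<in>UNIV. \<Sum>j\<in>UNIV - {k}. (n y1 k * q s (lab1 y1) k j (act1 y1)) *\<^sub>R jump_vec k j)
      = mass_flow (n y1) (\<lambda>k j. q s (lab1 y1) k j (act1 y1))"
      by (rule sum_jumps_mass_flow) (rule rowsQ[OF s act1(1)[OF y1]])
    show "?\<kappa> * (2 * ((pos1 y1 - pos2 y2) \<bullet> ((\<Sum>k\<in>UNIV. \<Sum>j\<in>UNIV - {k}. (n y1 k * q s (lab1 y1) k j (act1 y1)) *\<^sub>R jump_vec k j)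
          - mass_flow (mass (pos2 y2)) (\<lambda>k j. q s (lab2 y2) k j (pos2 y2))))
        + 2 * ((\<Sum>k\<in>UNIV. \<Sum>j\<in>UNIV - {k}. n y1 k * q s (lab1 y1) k j (act1 y1) * (norm (jump_vec k j :: real ^ 'm))\<^sup>2) / real N) + 2 * 0)
        + 4 / ?\<kappa> * (\<Sum>l\<in>UNIV. (\<Sum>k\<in>UNIV. \<Sum>j\<in>UNIV - {k}. (n y1 k * q s (lab1 y1) k j (act1 y1)) *\<^sub>R jump_vec k j) $ l)
       \<le> drift_const ?p R K * gap ?\<kappa> (pos1 y1) (pos2 y2)"
      unfolding flow drift_const_def
    proof (rule gap_drift_bound[OF N refl])
      show "Q_matrix (\<lambda>k j. q s (lab1 y1) k j (act1 y1))" by (rule Q[OF s act1(1)[OF y1]])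
      show "Q_matrix (\<lambda>k j. q s (lab2 y2) k j (pos2 y2))" by (rule Q[OF s pos2in[OF y(2)]])
      fix k j
      have "\<bar>q s (lab1 y1) k j (act1 y1) - q s (lab2 y2) k j (pos2 y2)\<bar> \<le> K * norm (act1 y1 - pos2 y2)"
        unfolding l by (rule K[OF s act1(1)[OF y1] pos2in[OF y(2)]])
      also have "\<dots> \<le> K * (norm (pos1 y1 - pos2 y2) + 1 / real N)"
        by (rule mult_left_mono[OF apart[OF y1] nonneg(2)])
      finally show "\<bar>q s (lab1 y1) k j (act1 y1) - q s (lab2 y2) k j (pos2 y2)\<bar> \<le> K * (norm (pos1 y1 - pos2 y2) + 1 / real N)" .
    next
      fix k :: "'m option" and l assume "k \<noteq> Some l"
      then show "\<bar>q s (lab1 y1) k (Some l) (act1 y1)\<bar> \<le> R" by (rule R[OF s act1(1)[OF y1]])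
    qed (use nonneg n y1 pos2in[OF y(2)] in auto)
  qed
  have lab1c: "continuous_map ?X1 (discrete_topology UNIV) lab1" by simp
  have act1c: "continuous_map ?X1 (top_of_set simplex_set) act1" using act1(1) by auto
  have Cx: "\<bar>C s d x - C s d x'\<bar> \<le> Kc * norm (x - x')" if "s \<in> {0..T}" "x \<in> simplex_set" "x' \<in> simplex_set" for s d x x'
    using C[OF that(1) that(1) that(2,3), of d] by simp
  have x0: "(0 :: real ^ 'm) \<in> simplex_set" by (simp add: simplex_set_def)
  let ?d = "undefined :: 'd"
  have Cr: "\<bar>C s d x - C s ?d 0\<bar> \<le> 2 * Kc + B" if "s \<in> {0..T}" "x \<in> simplex_set" for s d x
  proof -
    have "Kc * norm (x - 0) \<le> Kc * 1" using simplex_norm[OF that(2)] nonneg by (intro mult_left_mono) auto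
    then show ?thesis using Cx[OF that x0, of d] CB[OF that(1) x0, of d ?d] nonneg by linarith
  qed
  have Gr: "\<bar>G d x - G ?d 0\<bar> \<le> 2 * Kc + B" if "x \<in> simplex_set" for d x
  proof -
    have "Kc * norm (x - 0) \<le> Kc * 1" using simplex_norm[OF that] nonneg by (intro mult_left_mono) auto
    then show ?thesis using G[OF that x0, of d] GB[OF x0, of d ?d] nonneg by linarith
  qed
  have gap0: "0 \<le> gap ?\<kappa> (pos1 z) (pos2 z')" if "z \<in> E" for z z'
    using apart_gap[OF that, of z'] norm_ge_zero[of "act1 z - pos2 z'"] by linarith
  have le: "Kc * norm (act1 z - pos2 z') \<le> \<sigma> * gap ?\<kappa> (pos1 z) (pos2 z')" if "z \<in> E" for z z'
  proof -
    have "Kc * norm (act1 z - pos2 z') \<le> Kc * (2 * gap ?\<kappa> (pos1 z) (pos2 z'))"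
      by (rule mult_left_mono[OF apart_gap[OF that] nonneg(4)])
    then show ?thesis using gap0[OF that, of z'] by (simp add: \<sigma>_def algebra_simps)
  qed
  have C0b: "\<bar>C s ?d 0\<bar> \<le> \<bar>C 0 ?d 0\<bar> + Kc * T" if s: "s \<in> {0..T}" for s
  proof -
    have "\<bar>C s ?d 0 - C 0 ?d 0\<bar> \<le> Kc * \<bar>s\<bar>" using C[OF s _ x0 x0, of 0 ?d] T by simp
    also have "\<dots> \<le> Kc * T" using s nonneg by (intro mult_left_mono) auto
    finally show ?thesis by linarith
  qed
  have "\<bar>expected_cost T P1 Z1 (\<lambda>s z. C s (lab1 z) (act1 z)) (\<lambda>z. G (lab1 z) (act1 z)) t z1
      - expected_cost T P2 Z2 (\<lambda>s z. C s (lab2 z) (pos2 z)) (\<lambda>z. G (lab2 z) (pos2 z)) t z2\<bar>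
    \<le> \<sigma> * exp (cm.growth (2 * Kc + B) * T) * gap ?\<kappa> (pos1 z1) (pos2 z2)"
  proof (rule cm.expected_cost_comparison[where ?c0.0="\<lambda>s. C s ?d 0" and ?d0.0="G ?d 0" and ?C0.0="\<bar>C 0 ?d 0\<bar> + Kc * T"])
    show "(\<lambda>z. C s (lab1 z) (act1 z)) \<in> borel_measurable (borel_top ?X1)" if "s \<in> {0..T}" for s
      by (rule labelled_cost_measurable[OF lab1c act1c Cx nonneg(4)]) (use that in auto)
    show "(\<lambda>z. C s (lab2 z) (pos2 z)) \<in> borel_measurable (borel_top X2)" if "s \<in> {0..T}" for s
      by (rule labelled_cost_measurable[OF M2.lab_cont pos2 Cx nonneg(4)]) (use that in auto)
    show "(\<lambda>z. G (lab1 z) (act1 z)) \<in> borel_measurable (borel_top ?X1)"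
      by (rule labelled_cost_measurable[OF lab1c act1c G nonneg(4)])
    show "(\<lambda>z. G (lab2 z) (pos2 z)) \<in> borel_measurable (borel_top X2)"
      by (rule labelled_cost_measurable[OF M2.lab_cont pos2 G nonneg(4)])
    show "\<bar>C s (lab1 z) (act1 z) - C s ?d 0\<bar> \<le> 2 * Kc + B" if "s \<in> {0..T}" "z \<in> topspace ?X1" for s z
      using Cr that act1(1) by simp
    show "\<bar>C s (lab2 z) (pos2 z) - C s ?d 0\<bar> \<le> 2 * Kc + B" if "s \<in> {0..T}" "z \<in> topspace X2" for s z
      using Cr that pos2in by simp
    show "\<bar>G (lab1 z) (act1 z) - G ?d 0\<bar> \<le> 2 * Kc + B" if "z \<in> topspace ?X1" for z
      using Gr that act1(1) by simp
    show "\<bar>G (lab2 z) (pos2 z) - G ?d 0\<bar> \<le> 2 * Kc + B" if "z \<in> topspace X2" for z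
      using Gr that pos2in by simp
    show "\<bar>C s (lab1 y1) (act1 y1) - C s (lab2 y2) (pos2 y2)\<bar> \<le> \<sigma> * gap ?\<kappa> (pos1 y1) (pos2 y2)"
      if "s \<in> {0..T}" "y1 \<in> topspace ?X1" "y2 \<in> topspace X2" "lab1 y1 = lab2 y2" for s y1 y2
      using Cx[OF that(1) act1(1) pos2in[OF that(3)], of y1 "lab2 y2"] le[of y1 y2] that by simp
    show "\<bar>G (lab1 y1) (act1 y1) - G (lab2 y2) (pos2 y2)\<bar> \<le> \<sigma> * gap ?\<kappa> (pos1 y1) (pos2 y2)"
      if "y1 \<in> topspace ?X1" "y2 \<in> topspace X2" "lab1 y1 = lab2 y2" for y1 y2
      using G[OF act1(1) pos2in[OF that(2)], of y1 "lab2 y2"] le[of y1 y2] that by simp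
    show "1 \<le> \<sigma>" "0 \<le> 2 * Kc + B" using nonneg by (auto simp: \<sigma>_def)
    show "((\<lambda>r. C r (lab1 (Z1 r \<omega>)) (act1 (Z1 r \<omega>))) \<longlongrightarrow> C s (lab1 (Z1 s \<omega>)) (act1 (Z1 s \<omega>))) (at_right s)"
      if "\<omega> \<in> space \<Omega>1" "s \<in> {0..<T}" for \<omega> s
      by (rule M1.cost_right_continuous[OF lab1c act1c C that])
    show "((\<lambda>r. C r (lab2 (Z2 r \<omega>)) (pos2 (Z2 r \<omega>))) \<longlongrightarrow> C s (lab2 (Z2 s \<omega>)) (pos2 (Z2 s \<omega>))) (at_right s)"
      if "\<omega> \<in> space \<Omega>2" "s \<in> {0..<T}" for \<omega> s
      by (rule M2.cost_right_continuous[OF M2.lab_cont pos2 C that])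
    show "\<bar>C s ?d 0\<bar> \<le> \<bar>C 0 ?d 0\<bar> + Kc * T" if "s \<in> {0..T}" for s using C0b[OF that] .
  qed (use T t z in auto)
  moreover have "cm.growth (2 * Kc + B) = growth"
    unfolding cm.growth_def by (simp add: growth_def)
  ultimately show ?thesis by simp
qed

section \<open>The model\<close>

lemma lipschitz_along_feedback:
  fixes F :: "real \<Rightarrow> 'a::real_normed_vector \<Rightarrow> real ^ 'm::finite \<Rightarrow> real"
  assumes F: "lipschitz_on K ({0..T} \<times> A \<times> simplex_set) (\<lambda>(t, \<alpha>, x). F t \<alpha> x)"
    and fb: "lipschitz_feedback T A K' \<phi>"
    and s: "s \<in> {0..T}" "s' \<in> {0..T}" and x: "x \<in> simplex_set" "x' \<in> simplex_set"
  shows "\<bar>F s (\<phi> s x) x - F s' (\<phi> s' x') x'\<bar> \<le> K * (1 + K') * (\<bar>s - s'\<bar> + norm (x - x'))"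
proof -
  have K: "0 \<le> K" "0 \<le> K'"
    using lipschitz_on_nonneg[OF F] fb by (auto simp: lipschitz_feedback_def dest: lipschitz_on_nonneg)
  have in_A: "\<phi> s x \<in> A" "\<phi> s' x' \<in> A" using fb s x by (auto simp: lipschitz_feedback_def)
  have pair: "norm ((s, x) - (s', x')) \<le> \<bar>s - s'\<bar> + norm (x - x')"
    using norm_Pair_le[of "s - s'" "x - x'"] by simp
  have "norm (\<phi> s x - \<phi> s' x') \<le> K' * norm ((s, x) - (s', x'))"
    using fb lipschitz_on_normD[of K' "{0..T} \<times> simplex_set" "\<lambda>(t, x). \<phi> t x" "(s, x)" "(s', x')"] s x
    by (simp add: lipschitz_feedback_def)
  also have "\<dots> \<le> K' * (\<bar>s - s'\<bar> + norm (x - x'))" by (rule mult_left_mono[OF pair K(2)])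
  finally have \<phi>: "norm (\<phi> s x - \<phi> s' x') \<le> K' * (\<bar>s - s'\<bar> + norm (x - x'))" .
  have "\<bar>F s (\<phi> s x) x - F s' (\<phi> s' x') x'\<bar> \<le> K * norm ((s, \<phi> s x, x) - (s', \<phi> s' x', x'))"
    using lipschitz_on_normD[OF F, of "(s, \<phi> s x, x)" "(s', \<phi> s' x', x')"] s x in_A by simp
  also have "norm ((s, \<phi> s x, x) - (s', \<phi> s' x', x')) \<le> \<bar>s - s'\<bar> + (norm (\<phi> s x - \<phi> s' x') + norm (x - x'))"
    using norm_Pair_le[of "s - s'" "(\<phi> s x - \<phi> s' x', x - x')"] norm_Pair_le[of "\<phi> s x - \<phi> s' x'" "x - x'"] by simp
  also have "\<dots> \<le> (1 + K') * (\<bar>s - s'\<bar> + norm (x - x'))" using \<phi> by (simp add: algebra_simps)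
  finally show ?thesis using K by (simp add: mult_left_mono mult.assoc)
qed

text \<open>
  \<open>p\<close> is the dimension of the simplex and \<open>c\<close> the number of labels. The last factor bounds the initial gap, multiplied by
  \<open>sqrt (real N)\<close>.
\<close>
definition cost_const :: "real \<Rightarrow> real \<Rightarrow> real \<Rightarrow> real \<Rightarrow> real \<Rightarrow> real \<Rightarrow> real \<Rightarrow> real \<Rightarrow> real" where
  "cost_const T p c R K K0 Kc B = (1 + 2 * Kc)
     * exp ((2 * drift_const p R K + 1 + 2 * ((2 * Kc + B) * (1 + T)) * (2 * c * K0)) * T) * 6"

lemma gap_initial:
  fixes x y :: "real ^ 'm::finite"
  assumes N: "0 < N" and xy: "norm (x - y) \<le> 1 / real N" and x: "(\<Sum>l\<in>UNIV. x $ l) \<le> 1"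
  shows "gap (sqrt (real N)) x y \<le> 6 / sqrt (real N)"
proof -
  let ?\<kappa> = "sqrt (real N)"
  have N1: "1 \<le> real N" using N by simp
  have \<kappa>: "1 \<le> ?\<kappa>" using N1 by simp
  have "?\<kappa> * (norm (x - y))\<^sup>2 \<le> ?\<kappa> * (1 / real N)\<^sup>2"
    using xy \<kappa> by (intro mult_left_mono power_mono) auto
  also have "\<dots> = 1 / ?\<kappa> * (1 / real N)"
    using N by (simp add: power2_eq_square field_simps)
  also have "\<dots> \<le> 1 / ?\<kappa> * 1" using N1 \<kappa> by (intro mult_left_mono) auto
  finally have 1: "?\<kappa> * (norm (x - y))\<^sup>2 \<le> 1 / ?\<kappa>" by simp
  have "4 / ?\<kappa> * (\<Sum>l\<in>UNIV. x $ l) \<le> 4 / ?\<kappa> * 1" using x \<kappa> by (intro mult_left_mono) auto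
  then show ?thesis using 1 unfolding gap_def by simp
qed

locale game =
  fixes T :: real and A0 :: "'b::real_normed_vector set" and A :: "'a::real_normed_vector set"
    and q :: "real \<Rightarrow> 'm::finite option \<Rightarrow> 'm option \<Rightarrow> 'a \<Rightarrow> 'k::finite \<Rightarrow> real ^ 'm \<Rightarrow> real"
    and q0 :: "real \<Rightarrow> 'k \<Rightarrow> 'k \<Rightarrow> 'b \<Rightarrow> real ^ 'm \<Rightarrow> real"
    and f :: "real \<Rightarrow> 'm option \<Rightarrow> 'a \<Rightarrow> 'k \<Rightarrow> real ^ 'm \<Rightarrow> real"
    and f0 :: "real \<Rightarrow> 'k \<Rightarrow> 'b \<Rightarrow> real ^ 'm \<Rightarrow> real"
    and g :: "'m option \<Rightarrow> 'k \<Rightarrow> real ^ 'm \<Rightarrow> real"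
    and g0 :: "'k \<Rightarrow> real ^ 'm \<Rightarrow> real"
    and Kq Kq0 Kf Kf0 Kg Kg0 :: real
    and \<phi>0 :: "real \<Rightarrow> 'k \<Rightarrow> real ^ 'm \<Rightarrow> 'b"
    and \<phi> :: "real \<Rightarrow> 'm option \<Rightarrow> 'k \<Rightarrow> real ^ 'm \<Rightarrow> 'a"
    and \<psi> :: "real \<Rightarrow> 'm option \<Rightarrow> 'k \<Rightarrow> real ^ 'm \<Rightarrow> 'a"
    and K\<phi>0 K\<phi> K\<psi> B :: real
  assumes T: "0 < T"
    and model: "game_model T A0 A q q0 f f0 g g0 Kq Kq0 Kf Kf0 Kg Kg0"
    and fb0: "\<And>i0. lipschitz_feedback T A0 K\<phi>0 (\<lambda>t x. \<phi>0 t i0 x)"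
    and fb: "\<And>i i0. lipschitz_feedback T A K\<phi> (\<lambda>t x. \<phi> t i i0 x)"
    and fb': "\<And>i i0. lipschitz_feedback T A K\<psi> (\<lambda>t x. \<psi> t i i0 x)"
    and osc: "\<And>t x i j i0 j0. t \<in> {0..T} \<Longrightarrow> x \<in> simplex_set \<Longrightarrow>
       \<bar>f0_fb f0 \<phi>0 t i0 x - f0_fb f0 \<phi>0 t j0 x\<bar> \<le> B \<and>
       \<bar>g0 i0 x - g0 j0 x\<bar> \<le> B \<and>
       \<bar>f_fb f \<psi> t i i0 x - f_fb f \<psi> t j j0 x\<bar> \<le> B \<and>
       \<bar>g i i0 x - g j j0 x\<bar> \<le> B"
begin

lemma zero_simplex: "(0 :: real ^ 'm) \<in> simplex_set"
  by (simp add: simplex_set_def)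

lemma model_lipschitz:
  "lipschitz_on Kq ({0..T} \<times> A \<times> simplex_set) (\<lambda>(t, \<alpha>, x). q t i j \<alpha> i0 x)"
  "lipschitz_on Kq0 ({0..T} \<times> A0 \<times> simplex_set) (\<lambda>(t, \<alpha>0, x). q0 t i0 j0 \<alpha>0 x)"
  "lipschitz_on Kf ({0..T} \<times> A \<times> simplex_set) (\<lambda>(t, \<alpha>, x). f t i \<alpha> i0 x)"
  "lipschitz_on Kf0 ({0..T} \<times> A0 \<times> simplex_set) (\<lambda>(t, \<alpha>0, x). f0 t i0 \<alpha>0 x)"
  "lipschitz_on Kg simplex_set (\<lambda>x. g i i0 x)"
  "lipschitz_on Kg0 simplex_set (\<lambda>x. g0 i0 x)"
  using model by (simp_all add: game_model_def)

lemma nonneg: "0 \<le> Kq" "0 \<le> Kq0" "0 \<le> Kf" "0 \<le> Kf0" "0 \<le> Kg" "0 \<le> Kg0"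
    "0 \<le> K\<phi>0" "0 \<le> K\<phi>" "0 \<le> K\<psi>" "0 \<le> B"
proof -
  show "0 \<le> K\<phi>0" "0 \<le> K\<phi>" "0 \<le> K\<psi>"
    using fb0 fb fb' lipschitz_on_nonneg unfolding lipschitz_feedback_def by blast+
  show "0 \<le> B" using osc[OF _ zero_simplex, of 0 undefined undefined undefined undefined] T by simp
qed (rule lipschitz_on_nonneg, rule model_lipschitz)+

lemma feedback_in:
  assumes "s \<in> {0..T}" "x \<in> simplex_set"
  shows "\<phi>0 s i0 x \<in> A0" "\<phi> s i i0 x \<in> A" "\<psi> s i i0 x \<in> A"
  using fb0 fb fb' assms unfolding lipschitz_feedback_def by blast+

lemma Q_matrix_q:
  assumes "s \<in> {0..T}" "\<alpha> \<in> A" "x \<in> simplex_set"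
  shows "Q_matrix (\<lambda>i j. q s i j \<alpha> i0 x)"
  using model assms by (simp add: game_model_def)

lemma Q_matrix_feedback:
  assumes "s \<in> {0..T}" "x \<in> simplex_set"
  shows "Q_matrix (\<lambda>k j. q_fb q \<phi> s k j i0 x)" "Q_matrix (\<lambda>k j. q_fb q \<psi> s k j i0 x)"
    "Q_matrix (\<lambda>i0 j0. q0_fb q0 \<phi>0 s i0 j0 x)"
proof -
  show "Q_matrix (\<lambda>k j. q_fb q \<phi> s k j i0 x)" "Q_matrix (\<lambda>k j. q_fb q \<psi> s k j i0 x)"
    using Q_matrix_q[OF assms(1) feedback_in(2)[OF assms] assms(2)]
      Q_matrix_q[OF assms(1) feedback_in(3)[OF assms] assms(2)]
    unfolding Q_matrix_def q_fb_def by blast+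
  have "Q_matrix (\<lambda>i0 j0. q0 s i0 j0 \<alpha> x)" if "\<alpha> \<in> A0" for \<alpha>
    using model assms that by (simp add: game_model_def)
  then show "Q_matrix (\<lambda>i0 j0. q0_fb q0 \<phi>0 s i0 j0 x)"
    using feedback_in(1)[OF assms] unfolding Q_matrix_def q0_fb_def by blast
qed

text \<open>
  Moving the mass of state \<open>k\<close> away (for \<open>k = None\<close>, moving it to \<open>l\<close>) leads to a point of the simplex at distance at most 1
  where the rate vanishes. The control \<open>\<alpha>\<close> is kept fixed meanwhile, which is why the bound is needed for \<open>q\<close> and not
  only for its composition with a feedback function.
\<close>
lemma q_into_minor_state_bound:
  assumes s: "s \<in> {0..T}" and \<alpha>: "\<alpha> \<in> A" and x: "x \<in> simplex_set" and kl: "k \<noteq> Some l"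
  shows "\<bar>q s k (Some l) \<alpha> i0 x\<bar> \<le> Kq"
proof -
  have "\<exists>\<epsilon>>0. \<forall>t\<in>{0..T}. \<forall>\<alpha>\<in>A. \<forall>i0. \<forall>x\<in>simplex_set.
        (\<forall>i j. i \<noteq> j \<longrightarrow> x $ i < \<epsilon> \<longrightarrow> q t (Some i) (Some j) \<alpha> i0 x = 0) \<and>
        (\<forall>i. 1 - (\<Sum>k\<in>UNIV. x $ k) < \<epsilon> \<longrightarrow> q t None (Some i) \<alpha> i0 x = 0)"
    using model unfolding game_model_def by (elim conjE)
  then obtain \<epsilon> where \<epsilon>: "0 < \<epsilon>" "\<forall>t\<in>{0..T}. \<forall>\<alpha>\<in>A. \<forall>i0. \<forall>x\<in>simplex_set.
        (\<forall>i j. i \<noteq> j \<longrightarrow> x $ i < \<epsilon> \<longrightarrow> q t (Some i) (Some j) \<alpha> i0 x = 0) \<and>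
        (\<forall>i. 1 - (\<Sum>k\<in>UNIV. x $ k) < \<epsilon> \<longrightarrow> q t None (Some i) \<alpha> i0 x = 0)"
    by (elim exE conjE) (rule that)
  have far: "\<bar>q s k (Some l) \<alpha> i0 x\<bar> \<le> Kq" if x': "x' \<in> simplex_set" "norm (x - x') \<le> 1" "q s k (Some l) \<alpha> i0 x' = 0" for x'
  proof -
    have "\<bar>q s k (Some l) \<alpha> i0 x - q s k (Some l) \<alpha> i0 x'\<bar> \<le> Kq * norm ((s, \<alpha>, x) - (s, \<alpha>, x'))"
      using lipschitz_on_normD[OF model_lipschitz(1)[of k "Some l" i0], of "(s, \<alpha>, x)" "(s, \<alpha>, x')"] s \<alpha> x x' by simp
    also have "norm ((s, \<alpha>, x) - (s, \<alpha>, x')) = norm (x - x')" by (simp add: norm_Pair)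
    also have "Kq * norm (x - x') \<le> Kq * 1" using x'(2) nonneg(1) by (rule mult_left_mono)
    finally show ?thesis using x'(3) by simp
  qed
  have x0: "0 \<le> x $ m" "x $ m \<le> 1" for m
    using mass_nonneg[OF x, of "Some m"] mass_le_1[OF x, of "Some m"] by auto
  show ?thesis
  proof (cases k)
    case (Some m)
    let ?x' = "x - (x $ m) *\<^sub>R axis m 1"
    have c: "?x' $ i = (if i = m then 0 else x $ i)" for i by (simp add: axis_def)
    have "(\<Sum>i\<in>UNIV. ?x' $ i) \<le> (\<Sum>i\<in>UNIV. x $ i)" unfolding c by (rule sum_mono) (use x0 in auto)
    then have "?x' \<in> simplex_set" using x x0 c by (auto simp: simplex_set_def)
    moreover have "norm (x - ?x') \<le> 1" using x0[of m] by (simp add: norm_axis_1)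
    moreover have "q s k (Some l) \<alpha> i0 ?x' = 0"
      using \<epsilon>(2)[rule_format, OF s \<alpha> calculation(1), THEN conjunct1, rule_format, of m l i0] kl Some \<epsilon>(1) c[of m] by simp
    ultimately show ?thesis by (rule far)
  next
    case None
    let ?x' = "x + mass x None *\<^sub>R axis l 1"
    have m: "0 \<le> mass x None" "mass x None \<le> 1" by (rule mass_nonneg[OF x], rule mass_le_1[OF x])
    have "(\<Sum>i\<in>UNIV. ?x' $ i) = (\<Sum>i\<in>UNIV. x $ i) + mass x None * (\<Sum>i\<in>UNIV. axis l 1 $ i)"
      by (simp add: sum.distrib sum_distrib_left del: mass_simps)
    also have "(\<Sum>i\<in>UNIV. axis l 1 $ i) = (1 :: real)" by (simp add: axis_def)
    finally have S: "(\<Sum>i\<in>UNIV. ?x' $ i) = 1" by simp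
    have "?x' \<in> simplex_set"
      unfolding simplex_set_def using S m x0 by (auto simp: axis_def simp del: mass_simps)
    moreover have "norm (x - ?x') \<le> 1" using m by (simp add: norm_axis_1 del: mass_simps)
    moreover have "q s k (Some l) \<alpha> i0 ?x' = 0"
      using \<epsilon>(2)[rule_format, OF s \<alpha> calculation(1), THEN conjunct2, rule_format, of l i0] None \<epsilon>(1) S by simp
    ultimately show ?thesis by (rule far)
  qed
qed

text \<open>
  Unlike the other constants, this bound depends on more than the Lipschitz constants. It enters only the size of the time steps.
\<close>
lemma rates_bounded:
  obtains C where "\<And>s k j i0 x. s \<in> {0..T} \<Longrightarrow> x \<in> simplex_set \<Longrightarrow> \<bar>q_fb q \<phi> s k j i0 x\<bar> \<le> C"
    "\<And>s k j i0 x. s \<in> {0..T} \<Longrightarrow> x \<in> simplex_set \<Longrightarrow> \<bar>q_fb q \<psi> s k j i0 x\<bar> \<le> C"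
    "\<And>s i0 j0 x. s \<in> {0..T} \<Longrightarrow> x \<in> simplex_set \<Longrightarrow> \<bar>q0_fb q0 \<phi>0 s i0 j0 x\<bar> \<le> C"
proof -
  have "\<exists>C. \<forall>t\<in>{0..T}. \<forall>\<alpha>\<in>A. \<forall>x\<in>simplex_set. \<forall>i j i0. \<bar>q t i j \<alpha> i0 x\<bar> \<le> C"
    using model unfolding game_model_def by (elim conjE)
  then obtain C1 where C1: "\<forall>t\<in>{0..T}. \<forall>\<alpha>\<in>A. \<forall>x\<in>simplex_set. \<forall>i j i0. \<bar>q t i j \<alpha> i0 x\<bar> \<le> C1"
    by (elim exE) (rule that)
  define S where "S = (\<Sum>p\<in>UNIV. \<bar>q0_fb q0 \<phi>0 0 (fst p) (snd p) 0\<bar>)"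
  have S: "\<bar>q0_fb q0 \<phi>0 0 i0 j0 0\<bar> \<le> S" for i0 j0
    unfolding S_def using member_le_sum[of "(i0, j0)" UNIV "\<lambda>p. \<bar>q0_fb q0 \<phi>0 0 (fst p) (snd p) 0\<bar>"] by simp
  define C2 where "C2 = S + Kq0 * (1 + K\<phi>0) * (T + 1)"
  show thesis
  proof (rule that[of "max C1 C2"])
    fix s k j i0 and x :: "real ^ 'm" assume sx: "s \<in> {0..T}" "x \<in> simplex_set"
    show "\<bar>q_fb q \<phi> s k j i0 x\<bar> \<le> max C1 C2" "\<bar>q_fb q \<psi> s k j i0 x\<bar> \<le> max C1 C2"
      using C1[rule_format, OF sx(1) feedback_in(2)[OF sx] sx(2)] C1[rule_format, OF sx(1) feedback_in(3)[OF sx] sx(2)]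
      unfolding q_fb_def by (auto simp: le_max_iff_disj)
  next
    fix s i0 j0 and x :: "real ^ 'm" assume sx: "s \<in> {0..T}" "x \<in> simplex_set"
    have "\<bar>q0_fb q0 \<phi>0 s i0 j0 x - q0_fb q0 \<phi>0 0 i0 j0 0\<bar> \<le> Kq0 * (1 + K\<phi>0) * (\<bar>s - 0\<bar> + norm (x - 0))"
      unfolding q0_fb_def
      by (rule lipschitz_along_feedback[OF model_lipschitz(2) fb0]) (use sx T zero_simplex in auto)
    also have "\<dots> \<le> Kq0 * (1 + K\<phi>0) * (T + 1)"
      using sx simplex_norm[OF sx(2)] nonneg by (intro mult_left_mono) auto
    finally have "\<bar>q0_fb q0 \<phi>0 s i0 j0 x\<bar> \<le> C2" using S[of i0 j0] by (simp add: C2_def)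
    then show "\<bar>q0_fb q0 \<phi>0 s i0 j0 x\<bar> \<le> max C1 C2" by simp
  qed
qed

lemma feedback_lipschitz_x:
  assumes "s \<in> {0..T}" "x \<in> simplex_set" "y \<in> simplex_set"
  shows "\<bar>q_fb q \<phi> s k j i0 x - q_fb q \<phi> s k j i0 y\<bar> \<le> Kq * (1 + K\<phi>) * norm (x - y)"
    "\<bar>q_fb q \<psi> s k j i0 x - q_fb q \<psi> s k j i0 y\<bar> \<le> Kq * (1 + K\<psi>) * norm (x - y)"
    "\<bar>q0_fb q0 \<phi>0 s i0 j0 x - q0_fb q0 \<phi>0 s i0 j0 y\<bar> \<le> Kq0 * (1 + K\<phi>0) * norm (x - y)"
  using lipschitz_along_feedback[OF model_lipschitz(1) fb assms(1,1,2,3)]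
    lipschitz_along_feedback[OF model_lipschitz(1) fb' assms(1,1,2,3)]
    lipschitz_along_feedback[OF model_lipschitz(2) fb0 assms(1,1,2,3)]
  by (simp_all add: q_fb_def q0_fb_def)

lemma major_cost_comparison:
  assumes N: "0 < N" and chain: "N_major_process T N (q0_fb q0 \<phi>0) (q_fb q \<phi>) \<Omega>N PN ZN"
    and limit: "mf_major_process T (q0_fb q0 \<phi>0) (q_fb q \<phi>) \<Omega> P Z"
    and t: "t \<in> {0..T}" and x: "x \<in> simplex_grid N"
  shows "\<bar>major_cost T f0 g0 \<phi>0 PN ZN t i0 x - major_cost T f0 g0 \<phi>0 P Z t i0 x\<bar>
    \<le> cost_const T (CARD('m)) (CARD('k)) Kq (Kq * (1 + K\<phi>)) (Kq0 * (1 + K\<phi>0)) (Kf0 * (1 + K\<phi>0) + Kg0) B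
      / sqrt (real N)"
proof -
  obtain C where C: "\<And>s k j i0 x. s \<in> {0..T} \<Longrightarrow> x \<in> simplex_set \<Longrightarrow> \<bar>q_fb q \<phi> s k j i0 x\<bar> \<le> C"
    "\<And>s i0 j0 x. s \<in> {0..T} \<Longrightarrow> x \<in> simplex_set \<Longrightarrow> \<bar>q0_fb q0 \<phi>0 s i0 j0 x\<bar> \<le> C"
    using rates_bounded by metis
  have rows: "(\<Sum>j0\<in>UNIV. q0_fb q0 \<phi>0 s i0 j0 x) = 0" if "s \<in> {0..T}" "x \<in> simplex_set" for s i0 x
    using Q_matrix_feedback(3)[OF that] by (simp add: Q_matrix_def)
  let ?E = "UNIV \<times> simplex_grid N :: ('k \<times> (real ^ 'm)) set"
  let ?Kc = "Kf0 * (1 + K\<phi>0) + Kg0"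
  have grid: "y \<in> simplex_set" if "y \<in> simplex_grid N" for y :: "real ^ 'm"
    using grid_subset_simplex[OF N] that by blast
  have "\<bar>expected_cost T PN ZN (\<lambda>s z. f0_fb f0 \<phi>0 s (fst z) (snd z)) (\<lambda>z. g0 (fst z) (snd z)) t (i0, x)
      - expected_cost T P Z (\<lambda>s z. f0_fb f0 \<phi>0 s (fst z) (snd z)) (\<lambda>z. g0 (fst z) (snd z)) t (i0, x)\<bar>
    \<le> (1 + 2 * ?Kc) * exp ((2 * drift_const (CARD('m)) Kq (Kq * (1 + K\<phi>)) + 1
         + 2 * ((2 * ?Kc + B) * (1 + T)) * (2 * CARD('k) * (Kq0 * (1 + K\<phi>0)))) * T)
      * gap (sqrt (real N)) (snd (i0, x)) (snd (i0, x))"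
  proof (rule labelled_game_comparison[where E="?E" and q="\<lambda>s d k j x. q_fb q \<phi> s k j d x"
        and rl="\<lambda>s d j x. q0_fb q0 \<phi>0 s d j x" and ?lab1.0=fst and ?lab2.0=fst
        and C="f0_fb f0 \<phi>0" and G=g0 and n="\<lambda>z. mass (snd z)" and T=T and R=Kq and K="Kq * (1 + K\<phi>)"
        and ?K0.0="Kq0 * (1 + K\<phi>0)" and Kc="?Kc" and B=B and ?B0.0=C and ?act1.0=snd and ?pos1.0=snd and ?pos2.0=snd])
    show "markov_chain T ?E (N_major_rate N (q0_fb q0 \<phi>0) (q_fb q \<phi>)) \<Omega>N PN ZN"
      using chain by (simp add: N_major_process_def)
    show "labelled_markov T major_top \<Omega> P Z fst snd (\<lambda>s z j. q0_fb q0 \<phi>0 s (fst z) j (snd z))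
      (\<lambda>s z. mass_flow (mass (snd z)) (\<lambda>k j. q_fb q \<phi> s k j (fst z) (snd z))) (\<lambda>_ _. 0)"
      by (rule mf_major_labelled[OF limit rows C(2,1)])
    show "continuous_map (major_top :: ('k \<times> (real ^ 'm)) topology) (top_of_set simplex_set) snd"
      by (rule major_top_continuous(2))
    show "finite ?E" by (rule finite_SigmaI) (auto simp: finite_simplex_grid)
    show "\<bar>q_fb q \<phi> s k (Some l) d x\<bar> \<le> Kq" if "s \<in> {0..T}" "x \<in> simplex_set" "k \<noteq> Some l" for s d x k l
      unfolding q_fb_def by (rule q_into_minor_state_bound[OF that(1) feedback_in(2)[OF that(1,2)] that(2,3)])
    show "\<bar>f0_fb f0 \<phi>0 s d x - f0_fb f0 \<phi>0 s' d x'\<bar> \<le> ?Kc * (\<bar>s - s'\<bar> + norm (x - x'))"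
      if "s \<in> {0..T}" "s' \<in> {0..T}" "x \<in> simplex_set" "x' \<in> simplex_set" for s s' d x x'
    proof -
      have "\<bar>f0_fb f0 \<phi>0 s d x - f0_fb f0 \<phi>0 s' d x'\<bar> \<le> Kf0 * (1 + K\<phi>0) * (\<bar>s - s'\<bar> + norm (x - x'))"
        unfolding f0_fb_def by (rule lipschitz_along_feedback[OF model_lipschitz(4) fb0 that])
      also have "\<dots> \<le> ?Kc * (\<bar>s - s'\<bar> + norm (x - x'))" using nonneg by (intro mult_right_mono) auto
      finally show ?thesis .
    qed
    show "\<bar>g0 d x - g0 d x'\<bar> \<le> ?Kc * norm (x - x')" if "x \<in> simplex_set" "x' \<in> simplex_set" for d x x'
    proof -
      have "\<bar>g0 d x - g0 d x'\<bar> \<le> Kg0 * norm (x - x')"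
        using lipschitz_on_normD[OF model_lipschitz(6)[of d] that] by simp
      also have "\<dots> \<le> ?Kc * norm (x - x')" using nonneg by (intro mult_right_mono) auto
      finally show ?thesis .
    qed
    show "\<bar>q0_fb q0 \<phi>0 s d i x\<bar> \<le> C \<and> \<bar>q_fb q \<phi> s k j d x\<bar> \<le> C"
      if "s \<in> {0..T}" "x \<in> simplex_set" for s d x i k j using C[OF that] by blast
    show "\<bar>g0 d x - g0 d' x\<bar> \<le> B" if "x \<in> simplex_set" for d d' x
      using osc[OF _ that, of 0 d d' undefined undefined] T by simp
    show "\<bar>f0_fb f0 \<phi>0 s d x - f0_fb f0 \<phi>0 s d' x\<bar> \<le> B" if "s \<in> {0..T}" "x \<in> simplex_set" for s d d' x
      using osc[OF that, of d d' undefined undefined] by simp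
    show "(\<Sum>z'\<in>?E. N_major_rate N (q0_fb q0 \<phi>0) (q_fb q \<phi>) s z z' * (F (fst z') (snd z') - F (fst z) (snd z))) =
      (\<Sum>j\<in>UNIV. q0_fb q0 \<phi>0 s (fst z) j (snd z) * (F j (snd z) - F (fst z) (snd z)))
      + (\<Sum>k\<in>UNIV. \<Sum>j\<in>UNIV - {k}. real N * mass (snd z) k * q_fb q \<phi> s k j (fst z) (snd z)
           * (F (fst z) (snd z + (1 / real N) *\<^sub>R jump_vec k j) - F (fst z) (snd z)))"
      if "z \<in> ?E" for s z F by (rule major_jump_form[OF N that])
    show "norm (snd z) \<le> 1" "snd z \<in> simplex_set" if "z \<in> ?E" for z
      using that by (auto intro!: grid simplex_norm)
    show "0 \<le> mass (snd z) k" "mass (snd z) k \<le> 1" if "z \<in> ?E" for z k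
      using that by (auto intro!: grid mass_nonneg mass_le_1)
    show "(\<Sum>k\<in>UNIV. mass (snd z) k) \<le> 1" for z :: "'k \<times> (real ^ 'm)" by (simp only: sum_mass)
  qed (use N T t x nonneg rows grid Q_matrix_feedback feedback_lipschitz_x in \<open>auto simp: topspace_major_top\<close>)
  also have "\<dots> \<le> (1 + 2 * ?Kc) * exp ((2 * drift_const (CARD('m)) Kq (Kq * (1 + K\<phi>)) + 1
         + 2 * ((2 * ?Kc + B) * (1 + T)) * (2 * CARD('k) * (Kq0 * (1 + K\<phi>0)))) * T)
      * (6 / sqrt (real N))"
  proof (rule mult_left_mono)
    show "gap (sqrt (real N)) (snd (i0, x)) (snd (i0, x)) \<le> 6 / sqrt (real N)"
      by (rule gap_initial[OF N]) (use grid[OF x] in \<open>auto simp: simplex_set_def\<close>)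
  qed (use nonneg in auto)
  finally show ?thesis by (simp add: major_cost_def cost_const_def case_prod_unfold)
qed

lemma minor_cost_comparison:
  assumes N: "0 < N" and chain: "N_minor_process T N (q0_fb q0 \<phi>0) (q_fb q \<phi>) (q_fb q \<psi>) \<Omega>N PN ZN"
    and limit: "mf_minor_process T (q0_fb q0 \<phi>0) (q_fb q \<phi>) (q_fb q \<psi>) \<Omega> P Z"
    and t: "t \<in> {0..T}" and x: "x \<in> simplex_grid N" "1 / real N \<le> mass x i"
  shows "\<bar>minor_cost T f g \<psi> PN ZN t i i0 x - minor_cost T f g \<psi> P Z t i i0 x\<bar>
    \<le> cost_const T (CARD('m)) (CARD('m option \<times> 'k)) Kq (Kq * (1 + K\<phi>))
        (Kq0 * (1 + K\<phi>0) + Kq * (1 + K\<psi>)) (Kf * (1 + K\<psi>) + Kg) B / sqrt (real N)"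
proof -
  obtain C where C: "\<And>s k j i0 x. s \<in> {0..T} \<Longrightarrow> x \<in> simplex_set \<Longrightarrow> \<bar>q_fb q \<phi> s k j i0 x\<bar> \<le> C"
    "\<And>s k j i0 x. s \<in> {0..T} \<Longrightarrow> x \<in> simplex_set \<Longrightarrow> \<bar>q_fb q \<psi> s k j i0 x\<bar> \<le> C"
    "\<And>s i0 j0 x. s \<in> {0..T} \<Longrightarrow> x \<in> simplex_set \<Longrightarrow> \<bar>q0_fb q0 \<phi>0 s i0 j0 x\<bar> \<le> C"
    using rates_bounded by metis
  have rows: "(\<Sum>j0\<in>UNIV. q0_fb q0 \<phi>0 s i0 j0 x) = 0" "(\<Sum>j\<in>UNIV. q_fb q \<psi> s i j i0 x) = 0"
    if "s \<in> {0..T}" "x \<in> simplex_set" for s i i0 x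
    using Q_matrix_feedback(2,3)[OF that] by (simp_all add: Q_matrix_def)
  let ?E = "minor_states N :: ('m option \<times> 'k \<times> (real ^ 'm)) set"
  let ?Kc = "Kf * (1 + K\<psi>) + Kg"
  let ?K0 = "Kq0 * (1 + K\<phi>0) + Kq * (1 + K\<psi>)"
  let ?rl = "\<lambda>s d e x. minor_label_rate (\<lambda>i0 j0. q0_fb q0 \<phi>0 s i0 j0 x) (\<lambda>i j. q_fb q \<psi> s i j (snd d) x) d e"
  have z: "(i, i0, x) \<in> ?E" using x by (simp add: minor_states_def)
  have "\<bar>expected_cost T PN ZN (\<lambda>s z. (\<lambda>s d. f_fb f \<psi> s (fst d) (snd d)) s (minor_label z) (snd (snd z)))
         (\<lambda>z. (\<lambda>d. g (fst d) (snd d)) (minor_label z) (snd (snd z))) t (i, i0, x)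
      - expected_cost T P Z (\<lambda>s z. (\<lambda>s d. f_fb f \<psi> s (fst d) (snd d)) s (minor_label z) (snd (snd z)))
         (\<lambda>z. (\<lambda>d. g (fst d) (snd d)) (minor_label z) (snd (snd z))) t (i, i0, x)\<bar>
    \<le> (1 + 2 * ?Kc) * exp ((2 * drift_const (CARD('m)) Kq (Kq * (1 + K\<phi>)) + 1
         + 2 * ((2 * ?Kc + B) * (1 + T)) * (2 * CARD('m option \<times> 'k) * ?K0)) * T)
      * gap (sqrt (real N)) (others_pos N (i, i0, x)) (snd (snd (i, i0, x)))"
  proof (rule labelled_game_comparison[where E="?E" and q="\<lambda>s d k j x. q_fb q \<phi> s k j (snd d) x"
        and rl="?rl" and ?lab1.0=minor_label and ?lab2.0=minor_label and C="\<lambda>s d. f_fb f \<psi> s (fst d) (snd d)"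
        and G="\<lambda>d. g (fst d) (snd d)" and n="others_mass N" and T=T and R=Kq and K="Kq * (1 + K\<phi>)"
        and ?K0.0="?K0" and Kc="?Kc" and B=B and ?B0.0="2 * C" and ?act1.0="\<lambda>z. snd (snd z)" and ?pos2.0="\<lambda>z. snd (snd z)"])
    show "markov_chain T ?E (N_minor_rate N (q0_fb q0 \<phi>0) (q_fb q \<phi>) (q_fb q \<psi>)) \<Omega>N PN ZN"
      using chain by (simp add: N_minor_process_def minor_states_def)
    show "labelled_markov T minor_top \<Omega> P Z minor_label (\<lambda>z. snd (snd z)) (\<lambda>s z j. ?rl s (minor_label z) j (snd (snd z)))
      (\<lambda>s z. mass_flow (mass (snd (snd z))) (\<lambda>k j. q_fb q \<phi> s k j (snd (minor_label z)) (snd (snd z)))) (\<lambda>_ _. 0)"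
      unfolding snd_conv by (rule mf_minor_labelled[OF limit rows C(3,1,2)])
    show "continuous_map (minor_top :: ('m option \<times> 'k \<times> (real ^ 'm)) topology) (top_of_set simplex_set) (\<lambda>z. snd (snd z))"
      by (rule minor_top_continuous(2))
    show "finite ?E" by (rule finite_minor_states)
    show "\<bar>q_fb q \<phi> s k (Some l) (snd d) x\<bar> \<le> Kq" if "s \<in> {0..T}" "x \<in> simplex_set" "k \<noteq> Some l" for s k l x
      and d :: "'m option \<times> 'k"
      unfolding q_fb_def by (rule q_into_minor_state_bound[OF that(1) feedback_in(2)[OF that(1,2)] that(2,3)])
    show "\<bar>f_fb f \<psi> s (fst d) (snd d) x - f_fb f \<psi> s' (fst d) (snd d) x'\<bar> \<le> ?Kc * (\<bar>s - s'\<bar> + norm (x - x'))"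
      if "s \<in> {0..T}" "s' \<in> {0..T}" "x \<in> simplex_set" "x' \<in> simplex_set" for s s' x x' and d :: "'m option \<times> 'k"
    proof -
      have "\<bar>f_fb f \<psi> s (fst d) (snd d) x - f_fb f \<psi> s' (fst d) (snd d) x'\<bar> \<le> Kf * (1 + K\<psi>) * (\<bar>s - s'\<bar> + norm (x - x'))"
        unfolding f_fb_def by (rule lipschitz_along_feedback[OF model_lipschitz(3) fb' that])
      also have "\<dots> \<le> ?Kc * (\<bar>s - s'\<bar> + norm (x - x'))" using nonneg by (intro mult_right_mono) auto
      finally show ?thesis .
    qed
    show "\<bar>g (fst d) (snd d) x - g (fst d) (snd d) x'\<bar> \<le> ?Kc * norm (x - x')"
      if "x \<in> simplex_set" "x' \<in> simplex_set" for x x' and d :: "'m option \<times> 'k"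
    proof -
      have "\<bar>g (fst d) (snd d) x - g (fst d) (snd d) x'\<bar> \<le> Kg * norm (x - x')"
        using lipschitz_on_normD[OF model_lipschitz(5)[of "fst d" "snd d"] that] by simp
      also have "\<dots> \<le> ?Kc * norm (x - x')" using nonneg by (intro mult_right_mono) auto
      finally show ?thesis .
    qed
    show "\<bar>?rl s d e x - ?rl s d e y\<bar> \<le> ?K0 * norm (x - y)"
      if "s \<in> {0..T}" "x \<in> simplex_set" "y \<in> simplex_set" for s d e x y
    proof -
      have "\<bar>?rl s d e x - ?rl s d e y\<bar> \<le> \<bar>q0_fb q0 \<phi>0 s (snd d) (snd e) x - q0_fb q0 \<phi>0 s (snd d) (snd e) y\<bar>
         + \<bar>q_fb q \<psi> s (fst d) (fst e) (snd d) x - q_fb q \<psi> s (fst d) (fst e) (snd d) y\<bar>"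
        by (auto simp: minor_label_rate_def of_bool_def)
      also have "\<dots> \<le> Kq0 * (1 + K\<phi>0) * norm (x - y) + Kq * (1 + K\<psi>) * norm (x - y)"
        by (intro add_mono feedback_lipschitz_x that)
      finally show ?thesis by (simp add: distrib_right)
    qed
    show "\<bar>?rl s d e x\<bar> \<le> 2 * C \<and> \<bar>q_fb q \<phi> s k j (snd d) x\<bar> \<le> 2 * C"
      if "s \<in> {0..T}" "x \<in> simplex_set" for s d x e k j
    proof -
      have "\<bar>?rl s d e x\<bar> \<le> \<bar>q0_fb q0 \<phi>0 s (snd d) (snd e) x\<bar> + \<bar>q_fb q \<psi> s (fst d) (fst e) (snd d) x\<bar>"
        by (auto simp: minor_label_rate_def of_bool_def)
      then show ?thesis
        using C(1)[OF that, of k j "snd d"] C(2)[OF that, of "fst d" "fst e" "snd d"] C(3)[OF that, of "snd d" "snd e"]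
        by linarith
    qed
    show "(\<Sum>e\<in>UNIV. ?rl s d e x) = 0" if "s \<in> {0..T}" "x \<in> simplex_set" for s d x
      using sum_minor_label_rate[of "\<lambda>_. 1" "\<lambda>i0 j0. q0_fb q0 \<phi>0 s i0 j0 x" "\<lambda>i j. q_fb q \<psi> s i j (snd d) x" "fst d" "snd d"]
        rows[OF that] by simp
    show "\<bar>g (fst d) (snd d) x - g (fst d') (snd d') x\<bar> \<le> B" if "x \<in> simplex_set" for x and d d' :: "'m option \<times> 'k"
      using osc[OF _ that, of 0] T by auto
    show "\<bar>f_fb f \<psi> s (fst d) (snd d) x - f_fb f \<psi> s (fst d') (snd d') x\<bar> \<le> B"
      if "s \<in> {0..T}" "x \<in> simplex_set" for s x and d d' :: "'m option \<times> 'k"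
      using osc[OF that] by blast
    show "(\<Sum>z'\<in>?E. N_minor_rate N (q0_fb q0 \<phi>0) (q_fb q \<phi>) (q_fb q \<psi>) s z z' * (F (minor_label z') (others_pos N z') - F (minor_label z) (others_pos N z))) =
      (\<Sum>j\<in>UNIV. ?rl s (minor_label z) j (snd (snd z)) * (F j (others_pos N z) - F (minor_label z) (others_pos N z)))
      + (\<Sum>k\<in>UNIV. \<Sum>j\<in>UNIV - {k}. real N * others_mass N z k * q_fb q \<phi> s k j (snd (minor_label z)) (snd (snd z))
           * (F (minor_label z) (others_pos N z + (1 / real N) *\<^sub>R jump_vec k j) - F (minor_label z) (others_pos N z)))"
      if "z \<in> ?E" for s z F unfolding snd_conv by (rule minor_jump_form[OF N that])
    show "(i, i0, x) \<in> topspace minor_top"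
      using x grid_subset_simplex[OF N] by (auto simp: topspace_minor_top)
  qed (use N T t z nonneg Q_matrix_feedback feedback_lipschitz_x others_mass_props[OF N] in auto)
  also have "\<dots> \<le> (1 + 2 * ?Kc) * exp ((2 * drift_const (CARD('m)) Kq (Kq * (1 + K\<phi>)) + 1
         + 2 * ((2 * ?Kc + B) * (1 + T)) * (2 * CARD('m option \<times> 'k) * ?K0)) * T)
      * (6 / sqrt (real N))"
  proof (rule mult_left_mono)
    have "(\<Sum>l\<in>UNIV. others_pos N (i, i0, x) $ l) \<le> (\<Sum>k\<in>UNIV. others_mass N (i, i0, x) k)"
      using others_mass_props(1,4)[OF N z] by (simp add: sum_UNIV_option)
    also have "\<dots> \<le> 1" by (rule others_mass_props(3)[OF N z])
    finally show "gap (sqrt (real N)) (others_pos N (i, i0, x)) (snd (snd (i, i0, x))) \<le> 6 / sqrt (real N)"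
      using others_mass_props(7)[OF N z] by (intro gap_initial[OF N]) (auto simp: norm_minus_commute)
  qed (use nonneg in auto)
  finally show ?thesis by (simp add: minor_cost_def cost_const_def case_prod_unfold)
qed

end

theorem theorem9:
  fixes T Kq Kq0 Kf Kf0 Kg Kg0 K\<phi>0 K\<phi> K\<psi> B :: real
  assumes "0 < T"
  shows "\<exists>L. \<forall>(A0 :: 'b::real_normed_vector set) (A :: 'a::real_normed_vector set)
      (q :: real \<Rightarrow> 'm::finite option \<Rightarrow> 'm option \<Rightarrow> 'a \<Rightarrow> 'k::finite \<Rightarrow> real ^ 'm \<Rightarrow> real)
      (q0 :: real \<Rightarrow> 'k \<Rightarrow> 'k \<Rightarrow> 'b \<Rightarrow> real ^ 'm \<Rightarrow> real)
      (f :: real \<Rightarrow> 'm option \<Rightarrow> 'a \<Rightarrow> 'k \<Rightarrow> real ^ 'm \<Rightarrow> real)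
      (f0 :: real \<Rightarrow> 'k \<Rightarrow> 'b \<Rightarrow> real ^ 'm \<Rightarrow> real)
      (g :: 'm option \<Rightarrow> 'k \<Rightarrow> real ^ 'm \<Rightarrow> real)
      (g0 :: 'k \<Rightarrow> real ^ 'm \<Rightarrow> real)
      (\<phi>0 :: real \<Rightarrow> 'k \<Rightarrow> real ^ 'm \<Rightarrow> 'b)
      (\<phi> :: real \<Rightarrow> 'm option \<Rightarrow> 'k \<Rightarrow> real ^ 'm \<Rightarrow> 'a)
      (\<psi> :: real \<Rightarrow> 'm option \<Rightarrow> 'k \<Rightarrow> real ^ 'm \<Rightarrow> 'a).
    game_model T A0 A q q0 f f0 g g0 Kq Kq0 Kf Kf0 Kg Kg0 \<longrightarrow>
    (\<forall>i0. lipschitz_feedback T A0 K\<phi>0 (\<lambda>t x. \<phi>0 t i0 x)) \<longrightarrow>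
    (\<forall>i i0. lipschitz_feedback T A K\<phi> (\<lambda>t x. \<phi> t i i0 x)) \<longrightarrow>
    (\<forall>i i0. lipschitz_feedback T A K\<psi> (\<lambda>t x. \<psi> t i i0 x)) \<longrightarrow>
    (\<forall>t\<in>{0..T}. \<forall>x\<in>simplex_set. \<forall>i j i0 j0.
       \<bar>f0_fb f0 \<phi>0 t i0 x - f0_fb f0 \<phi>0 t j0 x\<bar> \<le> B \<and>
       \<bar>g0 i0 x - g0 j0 x\<bar> \<le> B \<and>
       \<bar>f_fb f \<psi> t i i0 x - f_fb f \<psi> t j j0 x\<bar> \<le> B \<and>
       \<bar>g i i0 x - g j j0 x\<bar> \<le> B) \<longrightarrow>
    (\<forall>N>0.
      (\<forall>(\<Omega>N :: 'w1 measure) PN ZN (\<Omega> :: 'w2 measure) P Z.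
         N_major_process T N (q0_fb q0 \<phi>0) (q_fb q \<phi>) \<Omega>N PN ZN \<longrightarrow>
         mf_major_process T (q0_fb q0 \<phi>0) (q_fb q \<phi>) \<Omega> P Z \<longrightarrow>
         (\<forall>t\<in>{0..T}. \<forall>x\<in>simplex_grid N. \<forall>i0.
            \<bar>major_cost T f0 g0 \<phi>0 PN ZN t i0 x - major_cost T f0 g0 \<phi>0 P Z t i0 x\<bar>
            \<le> L / sqrt (real N))) \<and>
      (\<forall>(\<Omega>N :: 'w3 measure) PN ZN (\<Omega> :: 'w4 measure) P Z.
         N_minor_process T N (q0_fb q0 \<phi>0) (q_fb q \<phi>) (q_fb q \<psi>) \<Omega>N PN ZN \<longrightarrow>
         mf_minor_process T (q0_fb q0 \<phi>0) (q_fb q \<phi>) (q_fb q \<psi>) \<Omega> P Z \<longrightarrow>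
         (\<forall>t\<in>{0..T}. \<forall>x\<in>simplex_grid N. \<forall>i i0. 1 / real N \<le> mass x i \<longrightarrow>
            \<bar>minor_cost T f g \<psi> PN ZN t i i0 x - minor_cost T f g \<psi> P Z t i i0 x\<bar>
            \<le> L / sqrt (real N))))"
proof -
  define L1 where "L1 = cost_const T (CARD('m)) (CARD('k)) Kq (Kq * (1 + K\<phi>))
    (Kq0 * (1 + K\<phi>0)) (Kf0 * (1 + K\<phi>0) + Kg0) B"
  define L2 where "L2 = cost_const T (CARD('m)) (CARD('m option \<times> 'k)) Kq (Kq * (1 + K\<phi>))
    (Kq0 * (1 + K\<phi>0) + Kq * (1 + K\<psi>)) (Kf * (1 + K\<psi>) + Kg) B"
  \<comment> \<open>Absolute values, since the signs of the given constants are known only in the presence of a model.\<close>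
  have L1: "L1 / sqrt (real N) \<le> (\<bar>L1\<bar> + \<bar>L2\<bar>) / sqrt (real N)"
    and L2: "L2 / sqrt (real N) \<le> (\<bar>L1\<bar> + \<bar>L2\<bar>) / sqrt (real N)" for N :: nat
    by (auto intro!: divide_right_mono)
  show ?thesis
  proof (rule exI[of _ "\<bar>L1\<bar> + \<bar>L2\<bar>"], intro allI impI)
    fix A0 :: "'b set" and A :: "'a set"
      and q :: "real \<Rightarrow> 'm option \<Rightarrow> 'm option \<Rightarrow> 'a \<Rightarrow> 'k \<Rightarrow> real ^ 'm \<Rightarrow> real"
      and q0 :: "real \<Rightarrow> 'k \<Rightarrow> 'k \<Rightarrow> 'b \<Rightarrow> real ^ 'm \<Rightarrow> real"
      and f :: "real \<Rightarrow> 'm option \<Rightarrow> 'a \<Rightarrow> 'k \<Rightarrow> real ^ 'm \<Rightarrow> real"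
      and f0 :: "real \<Rightarrow> 'k \<Rightarrow> 'b \<Rightarrow> real ^ 'm \<Rightarrow> real"
      and g :: "'m option \<Rightarrow> 'k \<Rightarrow> real ^ 'm \<Rightarrow> real"
      and g0 :: "'k \<Rightarrow> real ^ 'm \<Rightarrow> real"
      and \<phi>0 :: "real \<Rightarrow> 'k \<Rightarrow> real ^ 'm \<Rightarrow> 'b"
      and \<phi> \<psi> :: "real \<Rightarrow> 'm option \<Rightarrow> 'k \<Rightarrow> real ^ 'm \<Rightarrow> 'a"
      and N :: nat
    assume model: "game_model T A0 A q q0 f f0 g g0 Kq Kq0 Kf Kf0 Kg Kg0"
      and fb: "\<forall>i0. lipschitz_feedback T A0 K\<phi>0 (\<lambda>t x. \<phi>0 t i0 x)"
        "\<forall>i i0. lipschitz_feedback T A K\<phi> (\<lambda>t x. \<phi> t i i0 x)"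
        "\<forall>i i0. lipschitz_feedback T A K\<psi> (\<lambda>t x. \<psi> t i i0 x)"
      and osc: "\<forall>t\<in>{0..T}. \<forall>x\<in>simplex_set. \<forall>i j i0 j0.
       \<bar>f0_fb f0 \<phi>0 t i0 x - f0_fb f0 \<phi>0 t j0 x\<bar> \<le> B \<and>
       \<bar>g0 i0 x - g0 j0 x\<bar> \<le> B \<and>
       \<bar>f_fb f \<psi> t i i0 x - f_fb f \<psi> t j j0 x\<bar> \<le> B \<and>
       \<bar>g i i0 x - g j j0 x\<bar> \<le> B"
      and N: "0 < N"
    interpret game T A0 A q q0 f f0 g g0 Kq Kq0 Kf Kf0 Kg Kg0 \<phi>0 \<phi> \<psi> K\<phi>0 K\<phi> K\<psi> B
    proof
      show "0 < T" by (rule assms)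
      show "game_model T A0 A q q0 f f0 g g0 Kq Kq0 Kf Kf0 Kg Kg0" by (rule model)
    qed (rule fb[rule_format] osc[rule_format], assumption?, assumption?)+
    note major = order_trans[OF major_cost_comparison[OF N, folded L1_def] L1]
    note minor = order_trans[OF minor_cost_comparison[OF N, folded L2_def] L2]
    show "(\<forall>(\<Omega>N :: 'w1 measure) PN ZN (\<Omega> :: 'w2 measure) P Z.
         N_major_process T N (q0_fb q0 \<phi>0) (q_fb q \<phi>) \<Omega>N PN ZN \<longrightarrow>
         mf_major_process T (q0_fb q0 \<phi>0) (q_fb q \<phi>) \<Omega> P Z \<longrightarrow>
         (\<forall>t\<in>{0..T}. \<forall>x\<in>simplex_grid N. \<forall>i0.
            \<bar>major_cost T f0 g0 \<phi>0 PN ZN t i0 x - major_cost T f0 g0 \<phi>0 P Z t i0 x\<bar>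
            \<le> (\<bar>L1\<bar> + \<bar>L2\<bar>) / sqrt (real N))) \<and>
      (\<forall>(\<Omega>N :: 'w3 measure) PN ZN (\<Omega> :: 'w4 measure) P Z.
         N_minor_process T N (q0_fb q0 \<phi>0) (q_fb q \<phi>) (q_fb q \<psi>) \<Omega>N PN ZN \<longrightarrow>
         mf_minor_process T (q0_fb q0 \<phi>0) (q_fb q \<phi>) (q_fb q \<psi>) \<Omega> P Z \<longrightarrow>
         (\<forall>t\<in>{0..T}. \<forall>x\<in>simplex_grid N. \<forall>i i0. 1 / real N \<le> mass x i \<longrightarrow>
            \<bar>minor_cost T f g \<psi> PN ZN t i i0 x - minor_cost T f g \<psi> P Z t i i0 x\<bar>
            \<le> (\<bar>L1\<bar> + \<bar>L2\<bar>) / sqrt (real N)))"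
      by (intro conjI allI impI ballI; rule major minor; assumption)
  qed
qed

end
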